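(* Let $G(t)$ be a solution of cross curvature flow on the solid torus $M=D^2\times S^1$ with the boundary conditions and initial metric $G_0$ as in the context, and define $$K_0=\sup_{M\times\{0\}}\{\alpha,\beta,\gamma\},\qquad L_0=\inf_{M\times\{0\}}\{\alpha,\beta,\gamma\}.$$ Then: (1) For as long as a solution exists, $\alpha>0$ (thus the cross curvature flow operator remains elliptic). (2) The quantities $\alpha,\beta,\gamma$ are bounded from above by $K_0$ for as long as the solution exists. (3) The quantities $\alpha,\beta,\gamma$ are bounded from below by $L_0e^{-4K_0^2t}$ at each time $t$ for which the solution exists. (4) Negative sectional curvature is preserved. (5) Over the course of the evolution, $$\alpha\ge\frac{L_0}{4K_0L_0t+1}.$$
   Context: Setting. On the solid torus $M=D^2\times S^1$ use cylindrical coordinates $(\mu,\lambda,r)\in[0,1)\times[0,1)\times[0,1]$: a point of $D^2$ is $(r\cos 2\pi\mu, r\sin 2\pi\mu)$ and a point of $S^1$ is $(\cos 2\pi\lambda,\sin 2\pi\lambda)$. The core is $\{r=0\}$, the boundary torus is $\{r=1\}$. Consider time-dependent rotationally symmetric diagonal metrics $G=f^2\,d\mu^2+g^2\,d\lambda^2+h^2\,dr^2$ with $f,g,h$ functions of $(r,t)$, smooth across the core ($g,h$ extend to even functions of $r$ positive at $0$, $f$ extends to an odd function with $f_r(0)=2\pi h(0)$). Put $s(r,t)=\int_0^r h(\rho,t)\,d\rho$ (distance from the core), $\partial_s=h^{-1}\partial_r$; $\partial_t$ is taken at fixed $r$. Put $u=\log f$, $v=\log g$, $w=\log h$. The negatives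 of the principal sectional curvatures of $G$ are $\alpha=-K_{\lambda\mu}=\frac{f_sg_s}{fg}=u_sv_s$, $\beta=-K_{\lambda r}=\frac{g_{ss}}{g}=v_{ss}+v_s^2$, $\gamma=-K_{\mu r}=\frac{f_{ss}}{f}=u_{ss}+u_s^2$ (extended continuously to the core). Cross curvature flow is $\partial_tG=-2X$, where $X_{ij}=\frac12P^{uv}R_{iuvj}$ and $P$ is the Einstein tensor; for such metrics it is the system $u_t=\alpha\gamma$, $v_t=\alpha\beta$, $w_t=\beta\gamma$. Boundary conditions at $r=1$: $u=\log(f(1,0)(1+4t)^{1/4})$, $v=\log(g(1,0)(1+4t)^{1/4})$, $w=\log((1+4t)^{1/4})$. Standing assumptions on $G_0=G(\cdot,0)$: it is smooth (with a global $C^{2+\theta}$ bound, $\theta\in(0,1)$ fixed), of the form $f^2\,d\mu^2+g^2\,d\lambda^2+h^2\,dr^2$ with $f,g,h$ functions of $r$ ($g,h$ extending to even functions of $r$ positive at $0$, $f$ extending to an odd function with $f_r(0)=2\pi h(0)$), has negative sectional curvatures, $f(1,0)=\ell_1>2\pi$, $h(1,0)=1$, the initial radius $r_0=s(1,0)$ satisfies $1<r_0<\ell_1/2\pi$, $\alpha=\beta=\gamma>0$ at the core, and (as for the metrics used in the Gromov–Thurston $2\pi$-Theorem) near the boundary torus $f=f(1,0)e^{s-r_0}$, $g=g(1,0)e^{s-r_0}$. *)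

theory Defs
  imports "HOL-Analysis.Analysis"
begin

section \<open>Curvature of a metric given in coordinates\<close>

text \<open>
  \<open>U\<close> is the range of the coordinates and \<open>G x $ i $ j\<close> are the components of the metric at \<open>x\<close>.
  All derivatives are taken within \<open>U\<close>, so they are one-sided at boundary points of \<open>U\<close>.
\<close>

definition partial ::
  "(real^'n) set \<Rightarrow> 'n::finite \<Rightarrow> (real^'n \<Rightarrow> real) \<Rightarrow> real^'n \<Rightarrow> real" where
  "partial U i F x =
     vector_derivative (\<lambda>e. F (x + e *\<^sub>R axis i 1)) (at 0 within {e. x + e *\<^sub>R axis i 1 \<in> U})"

definition metric_inv :: "(real^'n \<Rightarrow> real^'n^'n) \<Rightarrow> 'n::finite \<Rightarrow> 'n \<Rightarrow> real^'n \<Rightarrow> real" where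
  "metric_inv G i j x = matrix_inv (G x) $ i $ j"

text \<open>The covariant derivative of the \<open>j\<close>-th coordinate field along the \<open>i\<close>-th one has
  \<open>k\<close>-th component \<open>christoffel U G k i j\<close>.\<close>

definition christoffel ::
  "(real^'n) set \<Rightarrow> (real^'n \<Rightarrow> real^'n^'n) \<Rightarrow> 'n::finite \<Rightarrow> 'n \<Rightarrow> 'n \<Rightarrow> real^'n \<Rightarrow> real" where
  "christoffel U G k i j x =
     1/2 * (\<Sum>l\<in>UNIV. metric_inv G k l x *
       (partial U i (\<lambda>y. G y $ j $ l) x + partial U j (\<lambda>y. G y $ i $ l) x
        - partial U l (\<lambda>y. G y $ i $ j) x))"

text \<open>With \<open>d\<^sub>i\<close> the coordinate fields, \<open>D\<close> the Levi-Civita connection and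
  \<open>R(X,Y)Z = D\<^sub>X D\<^sub>Y Z - D\<^sub>Y D\<^sub>X Z - D\<^bsub>[X,Y]\<^esub> Z\<close>: \<open>riemann_up U G i j k l\<close> is the
  \<open>l\<close>-th component of \<open>R(d\<^sub>i,d\<^sub>j)d\<^sub>k\<close>, and \<open>riemann U G i j k l\<close> is
  \<open>R\<^bsub>ijkl\<^esub> = \<langle>R(d\<^sub>i,d\<^sub>j)d\<^sub>k, d\<^sub>l\<rangle>\<close>; thus \<open>R\<^bsub>ijji\<^esub> > 0\<close> on round spheres.\<close>

definition riemann_up ::
  "(real^'n) set \<Rightarrow> (real^'n \<Rightarrow> real^'n^'n) \<Rightarrow> 'n::finite \<Rightarrow> 'n \<Rightarrow> 'n \<Rightarrow> 'n \<Rightarrow> real^'n \<Rightarrow> real" where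
  "riemann_up U G i j k l x =
     partial U i (christoffel U G l j k) x - partial U j (christoffel U G l i k) x
     + (\<Sum>m\<in>UNIV. christoffel U G m j k x * christoffel U G l i m x
                 - christoffel U G m i k x * christoffel U G l j m x)"

definition riemann ::
  "(real^'n) set \<Rightarrow> (real^'n \<Rightarrow> real^'n^'n) \<Rightarrow> 'n::finite \<Rightarrow> 'n \<Rightarrow> 'n \<Rightarrow> 'n \<Rightarrow> real^'n \<Rightarrow> real" where
  "riemann U G i j k l x = (\<Sum>m\<in>UNIV. riemann_up U G i j k m x * G x $ m $ l)"

definition sectional_curvature ::
  "(real^'n) set \<Rightarrow> (real^'n \<Rightarrow> real^'n^'n) \<Rightarrow> real^'n \<Rightarrow> real^'n \<Rightarrow> real^'n \<Rightarrow> real" where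
  "sectional_curvature U G x X Y =
     (\<Sum>i\<in>UNIV. \<Sum>j\<in>UNIV. \<Sum>k\<in>UNIV. \<Sum>l\<in>UNIV.
        riemann U G i j k l x * X $ i * Y $ j * Y $ k * X $ l)
     / ((X \<bullet> (G x *v X)) * (Y \<bullet> (G x *v Y)) - (X \<bullet> (G x *v Y))\<^sup>2)"

definition ricci ::
  "(real^'n) set \<Rightarrow> (real^'n \<Rightarrow> real^'n^'n) \<Rightarrow> 'n::finite \<Rightarrow> 'n \<Rightarrow> real^'n \<Rightarrow> real" where
  "ricci U G j k x = (\<Sum>i\<in>UNIV. \<Sum>l\<in>UNIV. metric_inv G i l x * riemann U G i j k l x)"

definition scalar_curvature ::
  "(real^'n) set \<Rightarrow> (real^'n \<Rightarrow> real^'n^'n) \<Rightarrow> real^'n \<Rightarrow> real" where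
  "scalar_curvature U G x = (\<Sum>j\<in>UNIV. \<Sum>k\<in>UNIV. metric_inv G j k x * ricci U G j k x)"

definition einstein ::
  "(real^'n) set \<Rightarrow> (real^'n \<Rightarrow> real^'n^'n) \<Rightarrow> 'n::finite \<Rightarrow> 'n \<Rightarrow> real^'n \<Rightarrow> real" where
  "einstein U G i j x = ricci U G i j x - 1/2 * scalar_curvature U G x * G x $ i $ j"

definition einstein_up ::
  "(real^'n) set \<Rightarrow> (real^'n \<Rightarrow> real^'n^'n) \<Rightarrow> 'n::finite \<Rightarrow> 'n \<Rightarrow> real^'n \<Rightarrow> real" where
  "einstein_up U G u v x =
     (\<Sum>i\<in>UNIV. \<Sum>j\<in>UNIV. metric_inv G u i x * metric_inv G v j x * einstein U G i j x)"

definition cross_curvature ::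
  "(real^'n) set \<Rightarrow> (real^'n \<Rightarrow> real^'n^'n) \<Rightarrow> 'n::finite \<Rightarrow> 'n \<Rightarrow> real^'n \<Rightarrow> real" where
  "cross_curvature U G i j x =
     1/2 * (\<Sum>u\<in>UNIV. \<Sum>v\<in>UNIV. einstein_up U G u v x * riemann U G i u v j x)"


section \<open>Rotationally symmetric diagonal metrics on the solid torus\<close>

text \<open>
  The components 1, 2, 3 of a point of \<open>real^3\<close> are the cylindrical coordinates \<open>\<mu>, \<lambda>, r\<close>.
  The angles range over the whole real line (all data are independent of them). The coordinates
  degenerate at the core \<open>r = 0\<close>, which is therefore not in the chart.
\<close>

definition chart :: "(real^3) set" where
  "chart = {x. 0 < x $ 3 \<and> x $ 3 \<le> 1}"

definition rot_metric ::
  "(real \<Rightarrow> real) \<Rightarrow> (real \<Rightarrow> real) \<Rightarrow> (real \<Rightarrow> real) \<Rightarrow> real^3 \<Rightarrow> real^3^3" where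
  "rot_metric f g h x =
     (\<chi> i j. if i \<noteq> j then 0
             else if i = 1 then (f (x $ 3))\<^sup>2
             else if i = 2 then (g (x $ 3))\<^sup>2
             else (h (x $ 3))\<^sup>2)"

text \<open>The derivative in \<open>r\<close> on \<open>[0,1]\<close>, one-sided at the endpoints.\<close>

definition d_r :: "(real \<Rightarrow> real) \<Rightarrow> real \<Rightarrow> real" where
  "d_r p r = vector_derivative p (at r within {0..1})"

definition core_dist :: "(real \<Rightarrow> real) \<Rightarrow> real \<Rightarrow> real" where
  "core_dist h r = integral {0..r} h"

text \<open>
  Planes are given by their components in the orthonormal frame
  \<open>f\<^sup>-\<^sup>1 d\<^sub>\<mu>, g\<^sup>-\<^sup>1 d\<^sub>\<lambda>, h\<^sup>-\<^sup>1 d\<^sub>r\<close>. Along a ray of constant \<open>\<mu>, \<lambda>\<close> this frame extends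
  continuously to the core, where the curvature of a plane is defined by continuous extension.
\<close>

definition sec_curv ::
  "(real \<Rightarrow> real) \<Rightarrow> (real \<Rightarrow> real) \<Rightarrow> (real \<Rightarrow> real) \<Rightarrow> real \<Rightarrow> real \<Rightarrow> real \<Rightarrow> real^3 \<Rightarrow> real^3 \<Rightarrow> real"
where
  "sec_curv f g h m l r X Y =
     (let K = \<lambda>\<rho>. sectional_curvature chart (rot_metric f g h) (vector [m, l, \<rho>])
                (vector [X $ 1 / f \<rho>, X $ 2 / g \<rho>, X $ 3 / h \<rho>])
                (vector [Y $ 1 / f \<rho>, Y $ 2 / g \<rho>, Y $ 3 / h \<rho>])
      in if r = 0 then Lim (at_right 0) K else K r)"

definition negative_sectional_curvature ::
  "(real \<Rightarrow> real) \<Rightarrow> (real \<Rightarrow> real) \<Rightarrow> (real \<Rightarrow> real) \<Rightarrow> bool" where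
  "negative_sectional_curvature f g h \<longleftrightarrow>
     (\<forall>m l. \<forall>r\<in>{0..1}. \<forall>X Y. X \<noteq> Y \<and> independent {X, Y} \<longrightarrow> sec_curv f g h m l r X Y < 0)"

text \<open>Negatives of the principal sectional curvatures. They do not depend on the angles, so these
  are set to zero.\<close>

definition alpha :: "(real \<Rightarrow> real) \<Rightarrow> (real \<Rightarrow> real) \<Rightarrow> (real \<Rightarrow> real) \<Rightarrow> real \<Rightarrow> real" where
  "alpha f g h r = - sec_curv f g h 0 0 r (axis 2 1) (axis 1 1)"

definition beta :: "(real \<Rightarrow> real) \<Rightarrow> (real \<Rightarrow> real) \<Rightarrow> (real \<Rightarrow> real) \<Rightarrow> real \<Rightarrow> real" where
  "beta f g h r = - sec_curv f g h 0 0 r (axis 2 1) (axis 3 1)"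

definition gamma :: "(real \<Rightarrow> real) \<Rightarrow> (real \<Rightarrow> real) \<Rightarrow> (real \<Rightarrow> real) \<Rightarrow> real \<Rightarrow> real" where
  "gamma f g h r = - sec_curv f g h 0 0 r (axis 1 1) (axis 3 1)"

definition curvature_values ::
  "(real \<Rightarrow> real) \<Rightarrow> (real \<Rightarrow> real) \<Rightarrow> (real \<Rightarrow> real) \<Rightarrow> real set" where
  "curvature_values f g h = (\<Union>r\<in>{0..1}. {alpha f g h r, beta f g h r, gamma f g h r})"


section \<open>Smooth families of metrics\<close>

text \<open>From here on \<open>f t r\<close> is the value at radius \<open>r\<close> and time \<open>t\<close>, so that \<open>f t\<close> is the time slice.
  \<open>F\<close> is smooth up to the boundary of \<open>A \<times> I\<close>: \<open>D i j\<close> is the derivative of order \<open>i\<close> in \<open>r\<close> and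
  \<open>j\<close> in \<open>t\<close>.\<close>

definition smooth_family_on :: "real set \<Rightarrow> real set \<Rightarrow> (real \<Rightarrow> real \<Rightarrow> real) \<Rightarrow> bool" where
  "smooth_family_on I A F \<longleftrightarrow>
     (\<exists>D :: nat \<Rightarrow> nat \<Rightarrow> real \<Rightarrow> real \<Rightarrow> real.
        (\<forall>t\<in>I. \<forall>r\<in>A. D 0 0 t r = F t r) \<and>
        (\<forall>i j. continuous_on (I \<times> A) (\<lambda>(t, r). D i j t r)) \<and>
        (\<forall>i j. \<forall>t\<in>I. \<forall>r\<in>A.
           ((\<lambda>\<rho>. D i j t \<rho>) has_real_derivative D (Suc i) j t r) (at r within A) \<and>
           ((\<lambda>\<tau>. D i j \<tau> r) has_real_derivative D i (Suc j) t r) (at t within I)))"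

definition smooth_even_family :: "real set \<Rightarrow> (real \<Rightarrow> real \<Rightarrow> real) \<Rightarrow> bool" where
  "smooth_even_family I p \<longleftrightarrow>
     (\<exists>F. smooth_family_on I {-1..1} F \<and>
        (\<forall>t\<in>I. \<forall>r\<in>{-1..1}. F t (- r) = F t r) \<and> (\<forall>t\<in>I. \<forall>r\<in>{0..1}. F t r = p t r))"

definition smooth_odd_family :: "real set \<Rightarrow> (real \<Rightarrow> real \<Rightarrow> real) \<Rightarrow> bool" where
  "smooth_odd_family I p \<longleftrightarrow>
     (\<exists>F. smooth_family_on I {-1..1} F \<and>
        (\<forall>t\<in>I. \<forall>r\<in>{-1..1}. F t (- r) = - F t r) \<and> (\<forall>t\<in>I. \<forall>r\<in>{0..1}. F t r = p t r))"

definition smooth_rot_metrics ::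
  "real set \<Rightarrow> (real \<Rightarrow> real \<Rightarrow> real) \<Rightarrow> (real \<Rightarrow> real \<Rightarrow> real) \<Rightarrow> (real \<Rightarrow> real \<Rightarrow> real) \<Rightarrow> bool" where
  "smooth_rot_metrics I f g h \<longleftrightarrow>
     smooth_odd_family I f \<and> smooth_even_family I g \<and> smooth_even_family I h \<and>
     (\<forall>t\<in>I. (\<forall>r\<in>{0<..1}. 0 < f t r) \<and> (\<forall>r\<in>{0..1}. 0 < g t r \<and> 0 < h t r) \<and>
            d_r (f t) 0 = 2 * pi * h t 0)"

definition C2_Holder_bounded :: "real \<Rightarrow> (real \<Rightarrow> real) \<Rightarrow> bool" where
  "C2_Holder_bounded \<theta> p \<longleftrightarrow>
     (\<exists>C. (\<forall>r\<in>{0..1}. \<bar>p r\<bar> \<le> C \<and> \<bar>d_r p r\<bar> \<le> C \<and> \<bar>d_r (d_r p) r\<bar> \<le> C) \<and>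
          (\<forall>r\<in>{0..1}. \<forall>r'\<in>{0..1}.
             \<bar>d_r (d_r p) r - d_r (d_r p) r'\<bar> \<le> C * \<bar>r - r'\<bar> powr \<theta>))"


section \<open>The flow\<close>

text \<open>The equation is imposed off the core only; at the core it then holds by continuity.\<close>

definition cross_curvature_flow ::
  "real set \<Rightarrow> (real \<Rightarrow> real \<Rightarrow> real) \<Rightarrow> (real \<Rightarrow> real \<Rightarrow> real) \<Rightarrow> (real \<Rightarrow> real \<Rightarrow> real) \<Rightarrow> bool" where
  "cross_curvature_flow I f g h \<longleftrightarrow>
     smooth_rot_metrics I f g h \<and>
     (\<forall>t\<in>I. \<forall>x\<in>chart. \<forall>i j.
        ((\<lambda>\<tau>. rot_metric (f \<tau>) (g \<tau>) (h \<tau>) x $ i $ j) has_real_derivative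
           - 2 * cross_curvature chart (rot_metric (f t) (g t) (h t)) i j x) (at t within I))"

definition boundary_conditions ::
  "real set \<Rightarrow> (real \<Rightarrow> real \<Rightarrow> real) \<Rightarrow> (real \<Rightarrow> real \<Rightarrow> real) \<Rightarrow> (real \<Rightarrow> real \<Rightarrow> real) \<Rightarrow> bool" where
  "boundary_conditions I f g h \<longleftrightarrow>
     (\<forall>t\<in>I. ln (f t 1) = ln (f 0 1 * (1 + 4 * t) powr (1/4)) \<and>
            ln (g t 1) = ln (g 0 1 * (1 + 4 * t) powr (1/4)) \<and>
            ln (h t 1) = ln ((1 + 4 * t) powr (1/4)))"

text \<open>Smoothness of the single metric is that of the constant family.\<close>

definition admissible_initial_metric ::
  "real \<Rightarrow> (real \<Rightarrow> real) \<Rightarrow> (real \<Rightarrow> real) \<Rightarrow> (real \<Rightarrow> real) \<Rightarrow> bool" where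
  "admissible_initial_metric \<theta> f g h \<longleftrightarrow>
     smooth_rot_metrics UNIV (\<lambda>_. f) (\<lambda>_. g) (\<lambda>_. h) \<and>
     C2_Holder_bounded \<theta> f \<and> C2_Holder_bounded \<theta> g \<and> C2_Holder_bounded \<theta> h \<and>
     negative_sectional_curvature f g h \<and>
     f 1 > 2 * pi \<and> h 1 = 1 \<and>
     1 < core_dist h 1 \<and> core_dist h 1 < f 1 / (2 * pi) \<and>
     alpha f g h 0 = beta f g h 0 \<and> beta f g h 0 = gamma f g h 0 \<and> gamma f g h 0 > 0 \<and>
     (\<exists>\<delta>>0. \<forall>r\<in>{0..1}. 1 - \<delta> < r \<longrightarrow>
        f r = f 1 * exp (core_dist h r - core_dist h 1) \<and>
        g r = g 1 * exp (core_dist h r - core_dist h 1))"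

end

(*
  Write p = u_s and q = v_s, so alpha = p q. The Codazzi identity
  alpha_s = (gamma - alpha) q + (beta - alpha) p turns the evolution of the curvatures into
    alpha_t = alpha alpha_ss + (...) alpha_s
       + alpha (alpha beta + alpha gamma - 4 beta gamma + (gamma - alpha) q^2 + (beta - alpha) p^2),
    beta_t  = alpha beta_ss + (...) beta_s - 2 beta (beta - alpha) p^2 - 2 alpha beta gamma,
    gamma_t = alpha gamma_ss + (...) gamma_s - 2 gamma (gamma - alpha) q^2 - 2 alpha beta gamma,
  to which the maximum principle applies as long as all three are positive. The coefficients are
  singular at the core; there u = log f tends to minus infinity, so a maximum of X + eps u
  (X = alpha, beta, gamma) is attained off the core, and since (beta - alpha) p^2 is bounded the
  error vanishes as eps tends to 0. At r = 1 the boundary conditions force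
  alpha = beta = gamma = (1 + 4 t)^(-1/2). The maximum of the three is thus at most K0. At a minimum
  of alpha, beta and gamma lie on different sides of alpha, whence alpha_t >= -4 K0 alpha^2; this is
  (5), and it implies the exponential bound for alpha. Beta and gamma can then only fall below that
  bound where they are smaller than alpha, and there the quadratic terms have the good sign. The
  lower bounds exclude a first time at which positivity fails.
*)

theory Submission
  imports Defs
begin

section \<open>Curvature of rotationally symmetric diagonal metrics\<close>

text \<open>The evolution equations rest on one commutator: since w_t = \<beta>\<gamma>,
  differentiation in t and in s satisfies [d_t, d_s] = - \<beta>\<gamma> d_s. Hence p_t =
  (\<alpha>\<gamma>)_s - \<beta>\<gamma> p, and \<gamma> = p_s + p^2 follows by one more
  differentiation; q and \<beta> are obtained by exchanging the two angles. In the equation for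
  \<alpha> the terms with p^2 and q^2 are unbounded or without sign. At a critical point the Codazzi
  identity, multiplied by p or by q, turns them into multiples of \<alpha>, because p q = \<alpha>;
  what remains is 2 \<alpha>^3 - 4 \<alpha>\<beta>\<gamma>. At a minimum one of \<beta>, \<gamma> is
  at most \<alpha> and the other at most K0, which gives -4 K0 \<alpha>^2. The bound (5) is the
  solution of y' = -4 K0 y^2 with y(0) = L0. For \<beta> and \<gamma> the loss is only 2
  \<alpha>\<beta>\<gamma>, at most 2 K0^2 times the quantity itself, so half of the rate 4 K0^2 is
  left to absorb the error of the barrier. How small \<epsilon> must be depends on compactness
  bounds on [0, T]; these disappear in the limit, so the final bounds do not depend on them.\<close>

lemma partial_chart_radial:
  assumes x: "x \<in> chart"
    and d: "(\<phi> has_real_derivative d) (at (x $ 3) within {0<..1})"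
    and F: "\<And>y. y \<in> chart \<Longrightarrow> F y = \<phi> (y $ 3)"
  shows "partial chart i F x = (if i = 3 then d else 0)"
proof -
  let ?S = "{e. x + e *\<^sub>R axis i 1 \<in> chart}"
  have x3: "0 < x $ 3" "x $ 3 \<le> 1" using x by (auto simp: chart_def)
  have eq: "(\<lambda>e. F (x + e *\<^sub>R axis i 1)) e = \<phi> (x $ 3 + (if i = 3 then e else 0))" if "e \<in> ?S" for e
    using F[of "x + e *\<^sub>R axis i 1"] that by (auto simp: axis_def)
  have S: "?S = (if i = 3 then {- x $ 3 <.. 1 - x $ 3} else UNIV)"
    using x3 by (auto simp: chart_def axis_def)
  have nt: "at 0 within ?S \<noteq> bot"
  proof (cases "i = 3")
    case True
    have "at 0 within {- x $ 3 <.. 1 - x $ 3} \<noteq> bot"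
      using islimpt_subset[OF islimpt_greaterThanLessThan2[of "- x $ 3" 0], of "{- x $ 3 <.. 1 - x $ 3}"] x3
      by (auto simp: trivial_limit_within)
    then show ?thesis using True S by simp
  next
    case False then show ?thesis using S by simp
  qed
  have "((\<lambda>e. \<phi> (x $ 3 + (if i = 3 then e else 0))) has_vector_derivative (if i = 3 then d else 0)) (at 0 within ?S)"
  proof (cases "i = 3")
    case True
    have "((\<lambda>e. x $ 3 + e) has_real_derivative 1) (at 0 within ?S)"
      by (auto intro!: derivative_eq_intros)
    moreover have "(\<lambda>e. x $ 3 + e) ` ?S = {0<..1}"
      unfolding S using True by (auto simp: image_iff intro!: bexI[of _ "_ - x $ 3"])
    then have "(\<phi> has_real_derivative d) (at (x $ 3 + 0) within (\<lambda>e. x $ 3 + e) ` ?S)" using d by simp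
    ultimately have "((\<lambda>e. \<phi> (x $ 3 + e)) has_real_derivative d * 1) (at 0 within ?S)"
      using DERIV_image_chain[of \<phi> d "\<lambda>e. x $ 3 + e" 0 ?S 1] by (simp add: o_def)
    then show ?thesis using True by (simp add: has_real_derivative_iff_has_vector_derivative)
  qed auto
  then have "((\<lambda>e. F (x + e *\<^sub>R axis i 1)) has_vector_derivative (if i = 3 then d else 0)) (at 0 within ?S)"
    apply (rule has_vector_derivative_transform[rotated 2])
    subgoal using x by simp
    subgoal for e using eq[of e] by simp
    done
  then show ?thesis
    unfolding partial_def using vector_derivative_within[OF nt] by blast
qed

lemma matrix_inv_unique_two_sided:
  fixes A B :: "real^'n^'n"
  assumes "A ** B = mat 1" "B ** A = mat 1"
  shows "matrix_inv A = B"
proof -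
  have "A ** matrix_inv A = mat 1 \<and> matrix_inv A ** A = mat 1"
    unfolding matrix_inv_def using assms by (rule_tac someI[of _ B]) auto
  then show ?thesis using assms
    by (metis matrix_mul_assoc matrix_mul_lid matrix_mul_rid)
qed

lemma metric_inv_rot_metric:
  assumes "f (x $ 3) \<noteq> 0" "g (x $ 3) \<noteq> 0" "h (x $ 3) \<noteq> 0"
  shows "metric_inv (rot_metric f g h) i j x =
    (if i \<noteq> j then 0 else if i = 1 then 1 / (f (x $ 3))\<^sup>2 else if i = 2 then 1 / (g (x $ 3))\<^sup>2 else 1 / (h (x $ 3))\<^sup>2)"
proof -
  let ?B = "(\<chi> i j. (if i \<noteq> j then 0 else if i = 1 then 1 / (f (x $ 3))\<^sup>2 else if i = 2 then 1 / (g (x $ 3))\<^sup>2 else 1 / (h (x $ 3))\<^sup>2)) :: real^3^3"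
  have "matrix_inv (rot_metric f g h x) = ?B"
    by (rule matrix_inv_unique_two_sided)
       (use assms in \<open>simp_all add: rot_metric_def matrix_matrix_mult_def vec_eq_iff forall_3 sum_3 mat_def\<close>)
  then show ?thesis by (simp add: metric_inv_def)
qed

text \<open>One time slice off the core. The derivatives are taken within \<open>{0<..1}\<close>,
  the range of \<open>x $ 3\<close> on \<open>chart\<close>, so at r = 1 they are the one-sided
  derivatives that \<open>partial\<close> sees.\<close>

locale rot_data =
  fixes f g h f1 g1 h1 f2 g2 h2 :: "real \<Rightarrow> real"
  assumes pos: "\<And>r. 0 < r \<Longrightarrow> r \<le> 1 \<Longrightarrow> 0 < f r \<and> 0 < g r \<and> 0 < h r"
    and deriv: "\<And>r. 0 < r \<Longrightarrow> r \<le> 1 \<Longrightarrow> (f has_real_derivative f1 r) (at r within {0<..1})"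
      "\<And>r. 0 < r \<Longrightarrow> r \<le> 1 \<Longrightarrow> (g has_real_derivative g1 r) (at r within {0<..1})"
      "\<And>r. 0 < r \<Longrightarrow> r \<le> 1 \<Longrightarrow> (h has_real_derivative h1 r) (at r within {0<..1})"
      "\<And>r. 0 < r \<Longrightarrow> r \<le> 1 \<Longrightarrow> (f1 has_real_derivative f2 r) (at r within {0<..1})"
      "\<And>r. 0 < r \<Longrightarrow> r \<le> 1 \<Longrightarrow> (g1 has_real_derivative g2 r) (at r within {0<..1})"
      "\<And>r. 0 < r \<Longrightarrow> r \<le> 1 \<Longrightarrow> (h1 has_real_derivative h2 r) (at r within {0<..1})"
begin

abbreviation G where "G \<equiv> rot_metric f g h"

definition chr :: "3 \<Rightarrow> 3 \<Rightarrow> 3 \<Rightarrow> real \<Rightarrow> real" where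
  "chr k i j r =
    (if k = 1 \<and> (i = 1 \<and> j = 3 \<or> i = 3 \<and> j = 1) then f1 r / f r
     else if k = 2 \<and> (i = 2 \<and> j = 3 \<or> i = 3 \<and> j = 2) then g1 r / g r
     else if k = 3 \<and> i = 1 \<and> j = 1 then - (f r * f1 r / (h r)\<^sup>2)
     else if k = 3 \<and> i = 2 \<and> j = 2 then - (g r * g1 r / (h r)\<^sup>2)
     else if k = 3 \<and> i = 3 \<and> j = 3 then h1 r / h r else 0)"

definition chr' :: "3 \<Rightarrow> 3 \<Rightarrow> 3 \<Rightarrow> real \<Rightarrow> real" where
  "chr' k i j r =
    (if k = 1 \<and> (i = 1 \<and> j = 3 \<or> i = 3 \<and> j = 1) then (f2 r * f r - f1 r * f1 r) / (f r)\<^sup>2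
     else if k = 2 \<and> (i = 2 \<and> j = 3 \<or> i = 3 \<and> j = 2) then (g2 r * g r - g1 r * g1 r) / (g r)\<^sup>2
     else if k = 3 \<and> i = 1 \<and> j = 1 then
       - ((f1 r * f1 r + f r * f2 r) / (h r)\<^sup>2 - 2 * f r * f1 r * h1 r / (h r)^3)
     else if k = 3 \<and> i = 2 \<and> j = 2 then
       - ((g1 r * g1 r + g r * g2 r) / (h r)\<^sup>2 - 2 * g r * g1 r * h1 r / (h r)^3)
     else if k = 3 \<and> i = 3 \<and> j = 3 then (h2 r * h r - h1 r * h1 r) / (h r)\<^sup>2 else 0)"

lemma chr_deriv:
  assumes "0 < r" "r \<le> 1"
  shows "(chr k i j has_real_derivative chr' k i j r) (at r within {0<..1})"
proof -
  note p = pos[OF assms] and d = deriv[OF assms]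
  have "((\<lambda>r. f1 r / f r) has_real_derivative (f2 r * f r - f1 r * f1 r) / (f r)\<^sup>2) (at r within {0<..1})"
    using p by (auto intro!: derivative_eq_intros d simp: power2_eq_square)
  moreover have "((\<lambda>r. g1 r / g r) has_real_derivative (g2 r * g r - g1 r * g1 r) / (g r)\<^sup>2) (at r within {0<..1})"
    using p by (auto intro!: derivative_eq_intros d simp: power2_eq_square)
  moreover have "((\<lambda>r. h1 r / h r) has_real_derivative (h2 r * h r - h1 r * h1 r) / (h r)\<^sup>2) (at r within {0<..1})"
    using p by (auto intro!: derivative_eq_intros d simp: power2_eq_square)
  moreover have "((\<lambda>r. - (f r * f1 r / (h r)\<^sup>2)) has_real_derivative - ((f1 r * f1 r + f r * f2 r) / (h r)\<^sup>2 - 2 * f r * f1 r * h1 r / (h r)^3)) (at r within {0<..1})"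
    using p by (auto intro!: derivative_eq_intros d simp: field_simps power2_eq_square power3_eq_cube)
  moreover have "((\<lambda>r. - (g r * g1 r / (h r)\<^sup>2)) has_real_derivative - ((g1 r * g1 r + g r * g2 r) / (h r)\<^sup>2 - 2 * g r * g1 r * h1 r / (h r)^3)) (at r within {0<..1})"
    using p by (auto intro!: derivative_eq_intros d simp: field_simps power2_eq_square power3_eq_cube)
  ultimately have "\<forall>k i j. (chr k i j has_real_derivative chr' k i j r) (at r within {0<..1})"
    unfolding forall_3 chr_def[abs_def] chr'_def by simp
  then show ?thesis by blast
qed

lemma metric_deriv:
  assumes x: "x \<in> chart"
  shows "partial chart k (\<lambda>y. G y $ i $ j) x = (if k = 3 \<and> i = j then
    (if i = 1 then 2 * f (x $ 3) * f1 (x $ 3) else if i = 2 then 2 * g (x $ 3) * g1 (x $ 3) else 2 * h (x $ 3) * h1 (x $ 3)) else 0)"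
proof -
  have r: "0 < x $ 3" "x $ 3 \<le> 1" using x by (auto simp: chart_def)
  note d = deriv[OF r]
  let ?\<phi> = "\<lambda>r. if i \<noteq> j then 0 else if i = 1 then (f r)\<^sup>2 else if i = 2 then (g r)\<^sup>2 else (h r)\<^sup>2"
  let ?d = "if i \<noteq> j then 0 else if i = 1 then 2 * f (x $ 3) * f1 (x $ 3) else if i = 2 then 2 * g (x $ 3) * g1 (x $ 3) else 2 * h (x $ 3) * h1 (x $ 3)"
  have "partial chart k (\<lambda>y. G y $ i $ j) x = (if k = 3 then ?d else 0)"
    by (rule partial_chart_radial[OF x, where \<phi> = ?\<phi>])
       (auto intro!: derivative_eq_intros d simp: rot_metric_def)
  then show ?thesis by auto
qed

lemma christoffel_eq:
  assumes x: "x \<in> chart"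
  shows "christoffel chart G k i j x = chr k i j (x $ 3)"
proof -
  have r: "0 < x $ 3" "x $ 3 \<le> 1" using x by (auto simp: chart_def)
  have p: "0 < f (x $ 3)" "0 < g (x $ 3)" "0 < h (x $ 3)" using pos[OF r] by auto
  have m: "metric_inv G i j x = (if i \<noteq> j then 0 else if i = 1 then 1 / (f (x $ 3))\<^sup>2 else if i = 2 then 1 / (g (x $ 3))\<^sup>2 else 1 / (h (x $ 3))\<^sup>2)" for i j
    using p by (intro metric_inv_rot_metric) auto
  have "\<forall>k i j. christoffel chart G k i j x = chr k i j (x $ 3)"
    unfolding christoffel_def m metric_deriv[OF x] chr_def
    using p by (simp add: forall_3 sum_3 power2_eq_square)
  then show ?thesis by blast
qed

lemma partial_christoffel:
  assumes x: "x \<in> chart"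
  shows "partial chart m (christoffel chart G k i j) x = (if m = 3 then chr' k i j (x $ 3) else 0)"
  using x by (intro partial_chart_radial[OF x chr_deriv]) (auto simp: christoffel_eq, auto simp: chart_def)

text \<open>With d_s = h^-1 d_r, the three functions are f_s g_s / (f g), g_ss / g and f_ss / f,
  that is \<alpha>, \<beta>, \<gamma> off the core, expanded in r-derivatives.\<close>

definition A where "A r = f1 r * g1 r / ((h r)\<^sup>2 * f r * g r)"
definition B where "B r = (g2 r * h r - g1 r * h1 r) / ((h r)^3 * g r)"
definition C where "C r = (f2 r * h r - f1 r * h1 r) / ((h r)^3 * f r)"

definition sec where "sec r i j =
   (if {i,j} = {1,2::3} then A r else if {i,j} = {2,3} then B r else if {i,j} = {1,3} then C r else 0)"

definition diag where "diag r i = (if i = (1::3) then f r ^ 2 else if i = 2 then g r ^ 2 else h r ^ 2)"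

text \<open>The curvature operator is diagonal on the coordinate bivectors. On equal indices
  \<open>sec\<close> is 0, so the overlap i = j = k = l of the two cases gives the correct value
  0.\<close>

lemma riemann_eq:
  assumes x: "x \<in> chart"
  shows "riemann chart G i j k l x =
    (if i = l \<and> j = k then - sec (x $ 3) i j * diag (x $ 3) i * diag (x $ 3) j
     else if i = k \<and> j = l then sec (x $ 3) i j * diag (x $ 3) i * diag (x $ 3) j else 0)"
proof -
  have r: "0 < x $ 3" "x $ 3 \<le> 1" using x by (auto simp: chart_def)
  have p: "f (x $ 3) \<noteq> 0" "g (x $ 3) \<noteq> 0" "h (x $ 3) \<noteq> 0" using pos[OF r] by auto
  have "\<forall>i j k l. riemann chart G i j k l x =
    (if i = l \<and> j = k then - sec (x $ 3) i j * diag (x $ 3) i * diag (x $ 3) j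
     else if i = k \<and> j = l then sec (x $ 3) i j * diag (x $ 3) i * diag (x $ 3) j else 0)"
    unfolding riemann_def riemann_up_def partial_christoffel[OF x] christoffel_eq[OF x]
    using p
    by (simp add: forall_3 sum_3 rot_metric_def chr_def chr'_def sec_def diag_def doubleton_eq_iff,
        simp add: A_def B_def C_def, intro conjI)
       (simp_all add: field_simps power2_eq_square power3_eq_cube)
  then show ?thesis by blast
qed

lemma ricci_eq:
  assumes x: "x \<in> chart"
  shows "ricci chart G j k x = (if j = k then - (\<Sum>i\<in>UNIV. sec (x $ 3) i j) * diag (x $ 3) j else 0)"
proof -
  have r: "0 < x $ 3" "x $ 3 \<le> 1" using x by (auto simp: chart_def)
  have p: "f (x $ 3) \<noteq> 0" "g (x $ 3) \<noteq> 0" "h (x $ 3) \<noteq> 0" using pos[OF r] by auto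
  have "\<forall>j k. ricci chart G j k x = (if j = k then - (\<Sum>i\<in>UNIV. sec (x $ 3) i j) * diag (x $ 3) j else 0)"
    unfolding ricci_def riemann_eq[OF x] metric_inv_rot_metric[of f x g h, OF p]
    using p by (simp add: forall_3 sum_3 sec_def diag_def doubleton_eq_iff field_simps)
  then show ?thesis by blast
qed

lemma scalar_curvature_eq:
  assumes x: "x \<in> chart"
  shows "scalar_curvature chart G x = - 2 * (A (x $ 3) + B (x $ 3) + C (x $ 3))"
proof -
  have r: "0 < x $ 3" "x $ 3 \<le> 1" using x by (auto simp: chart_def)
  have p: "f (x $ 3) \<noteq> 0" "g (x $ 3) \<noteq> 0" "h (x $ 3) \<noteq> 0" using pos[OF r] by auto
  show ?thesis
    unfolding scalar_curvature_def ricci_eq[OF x] metric_inv_rot_metric[of f x g h, OF p]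
    using p by (simp add: sum_3 sec_def diag_def doubleton_eq_iff)
qed

text \<open>In dimension three the Einstein tensor in a principal direction is minus the sectional
  curvature of the orthogonal plane, hence \<open>B\<close>, \<open>C\<close>, \<open>A\<close> in
  the directions 1, 2, 3.\<close>

lemma einstein_up_eq:
  assumes x: "x \<in> chart"
  shows "einstein_up chart G i j x = (if i = j then
    (if i = 1 then B (x $ 3) else if i = 2 then C (x $ 3) else A (x $ 3)) / diag (x $ 3) i else 0)"
proof -
  have r: "0 < x $ 3" "x $ 3 \<le> 1" using x by (auto simp: chart_def)
  have p: "f (x $ 3) \<noteq> 0" "g (x $ 3) \<noteq> 0" "h (x $ 3) \<noteq> 0" using pos[OF r] by auto
  have "\<forall>i j. einstein_up chart G i j x = (if i = j then
    (if i = 1 then B (x $ 3) else if i = 2 then C (x $ 3) else A (x $ 3)) / diag (x $ 3) i else 0)"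
    unfolding einstein_up_def einstein_def scalar_curvature_eq[OF x] ricci_eq[OF x] metric_inv_rot_metric[of f x g h, OF p]
    using p by (simp add: forall_3 sum_3 sec_def diag_def doubleton_eq_iff rot_metric_def field_simps power2_eq_square)
  then show ?thesis by blast
qed

text \<open>The contraction has two nonzero terms, one for each coordinate plane through the
  direction. Both equal minus the product of the \<open>sec\<close> values of these two planes times
  the metric component, so their sum cancels the factor 1/2.\<close>

lemma cross_curvature_eq:
  assumes x: "x \<in> chart"
  shows "cross_curvature chart G 1 1 x = - A (x $ 3) * C (x $ 3) * (f (x $ 3))\<^sup>2"
    "cross_curvature chart G 2 2 x = - A (x $ 3) * B (x $ 3) * (g (x $ 3))\<^sup>2"
    "cross_curvature chart G 3 3 x = - B (x $ 3) * C (x $ 3) * (h (x $ 3))\<^sup>2"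
proof -
  have r: "0 < x $ 3" "x $ 3 \<le> 1" using x by (auto simp: chart_def)
  have p: "f (x $ 3) \<noteq> 0" "g (x $ 3) \<noteq> 0" "h (x $ 3) \<noteq> 0" using pos[OF r] by auto
  show "cross_curvature chart G 1 1 x = - A (x $ 3) * C (x $ 3) * (f (x $ 3))\<^sup>2"
    "cross_curvature chart G 2 2 x = - A (x $ 3) * B (x $ 3) * (g (x $ 3))\<^sup>2"
    "cross_curvature chart G 3 3 x = - B (x $ 3) * C (x $ 3) * (h (x $ 3))\<^sup>2"
    unfolding cross_curvature_def einstein_up_eq[OF x] riemann_eq[OF x]
    using p by (simp_all add: forall_3 sum_3 sec_def diag_def doubleton_eq_iff)
qed

section \<open>Sectional curvature of arbitrary planes\<close>

definition plane_curv :: "real \<Rightarrow> real^3 \<Rightarrow> real^3 \<Rightarrow> real" where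
  "plane_curv r X Y =
     - (A r * (X $ 1 * Y $ 2 - X $ 2 * Y $ 1)\<^sup>2 + B r * (X $ 2 * Y $ 3 - X $ 3 * Y $ 2)\<^sup>2
        + C r * (X $ 1 * Y $ 3 - X $ 3 * Y $ 1)\<^sup>2)
     / ((X $ 1 * Y $ 2 - X $ 2 * Y $ 1)\<^sup>2 + (X $ 2 * Y $ 3 - X $ 3 * Y $ 2)\<^sup>2 + (X $ 1 * Y $ 3 - X $ 3 * Y $ 1)\<^sup>2)"

text \<open>By Lagrange's identity the Gram determinant in the orthonormal frame is the sum of the
  squared 2x2 minors of X and Y; diagonality of the curvature operator makes the numerator the same
  sum with weights \<open>- A r\<close>, \<open>- B r\<close>, \<open>- C r\<close>.\<close>

lemma sectional_curvature_eq:
  assumes r: "0 < r" "r \<le> 1"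
  shows "sectional_curvature chart G (vector [m, l, r])
           (vector [X $ 1 / f r, X $ 2 / g r, X $ 3 / h r])
           (vector [Y $ 1 / f r, Y $ 2 / g r, Y $ 3 / h r]) = plane_curv r X Y"
proof -
  have x: "vector [m, l, r] \<in> chart" using r by (simp add: chart_def)
  have p: "f r \<noteq> 0" "g r \<noteq> 0" "h r \<noteq> 0" using pos[OF r] by auto
  let ?V = "vector [X $ 1 / f r, X $ 2 / g r, X $ 3 / h r] :: real^3"
  let ?W = "vector [Y $ 1 / f r, Y $ 2 / g r, Y $ 3 / h r] :: real^3"
  have "(\<Sum>i\<in>UNIV. \<Sum>j\<in>UNIV. \<Sum>k\<in>UNIV. \<Sum>l'\<in>UNIV.
        riemann chart G i j k l' (vector [m, l, r]) * ?V $ i * ?W $ j * ?W $ k * ?V $ l') =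
     - (A r * (X $ 1 * Y $ 2 - X $ 2 * Y $ 1)\<^sup>2 + B r * (X $ 2 * Y $ 3 - X $ 3 * Y $ 2)\<^sup>2
        + C r * (X $ 1 * Y $ 3 - X $ 3 * Y $ 1)\<^sup>2)"
    unfolding riemann_eq[OF x]
    using p by (simp add: sum_3 sec_def diag_def doubleton_eq_iff power2_eq_square, simp add: algebra_simps)
  moreover have "((?V \<bullet> (G (vector [m, l, r]) *v ?V)) * (?W \<bullet> (G (vector [m, l, r]) *v ?W)) - (?V \<bullet> (G (vector [m, l, r]) *v ?W))\<^sup>2)
     = ((X $ 1 * Y $ 2 - X $ 2 * Y $ 1)\<^sup>2 + (X $ 2 * Y $ 3 - X $ 3 * Y $ 2)\<^sup>2 + (X $ 1 * Y $ 3 - X $ 3 * Y $ 1)\<^sup>2)"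
    using p by (simp add: inner_vec_def sum_3 matrix_vector_mult_def rot_metric_def power2_eq_square, simp add: algebra_simps)
  ultimately show ?thesis
    unfolding sectional_curvature_def plane_curv_def by simp
qed

lemma sec_curv_eq:
  assumes "0 < r" "r \<le> 1"
  shows "sec_curv f g h m l r X Y = plane_curv r X Y"
  using assms by (simp add: sec_curv_def sectional_curvature_eq)

lemma sec_curv_core:
  assumes lim: "(A \<longlongrightarrow> a) (at_right 0)" "(B \<longlongrightarrow> b) (at_right 0)" "(C \<longlongrightarrow> c) (at_right 0)"
  shows "sec_curv f g h m l 0 X Y =
     - (a * (X $ 1 * Y $ 2 - X $ 2 * Y $ 1)\<^sup>2 + b * (X $ 2 * Y $ 3 - X $ 3 * Y $ 2)\<^sup>2
        + c * (X $ 1 * Y $ 3 - X $ 3 * Y $ 1)\<^sup>2)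
     / ((X $ 1 * Y $ 2 - X $ 2 * Y $ 1)\<^sup>2 + (X $ 2 * Y $ 3 - X $ 3 * Y $ 2)\<^sup>2 + (X $ 1 * Y $ 3 - X $ 3 * Y $ 1)\<^sup>2)"
    (is "_ = ?v")
proof -
  \<comment> \<open>The denominator does not depend on \<rho>. Written as a constant factor it may
    vanish, so dependent X and Y, where both sides are 0, are covered.\<close>
  have *: "((\<lambda>\<rho>. plane_curv \<rho> X Y) \<longlongrightarrow> ?v) (at_right 0)"
    unfolding plane_curv_def divide_inverse by (intro tendsto_intros lim)
  have "\<forall>\<^sub>F \<rho> in at_right (0::real). \<rho> \<in> {0<..<1}"
    by (rule eventually_at_right_real) simp
  then have "\<forall>\<^sub>F \<rho> in at_right 0. plane_curv \<rho> X Y = sectional_curvature chart G (vector [m, l, \<rho>])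
           (vector [X $ 1 / f \<rho>, X $ 2 / g \<rho>, X $ 3 / h \<rho>])
           (vector [Y $ 1 / f \<rho>, Y $ 2 / g \<rho>, Y $ 3 / h \<rho>])"
    by eventually_elim (simp add: sectional_curvature_eq)
  with * have "((\<lambda>\<rho>. sectional_curvature chart G (vector [m, l, \<rho>])
           (vector [X $ 1 / f \<rho>, X $ 2 / g \<rho>, X $ 3 / h \<rho>])
           (vector [Y $ 1 / f \<rho>, Y $ 2 / g \<rho>, Y $ 3 / h \<rho>])) \<longlongrightarrow> ?v) (at_right 0)"
    by (rule Lim_transform_eventually)
  then show ?thesis by (simp add: sec_curv_def tendsto_Lim)
qed

end

section \<open>Maximum principle for the curvatures\<close>

lemma second_derivative_nonpos_at_max:
  fixes \<phi> \<phi>' :: "real \<Rightarrow> real"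
  assumes r: "l < r" "r < m"
    and d: "\<And>x. l < x \<Longrightarrow> x < m \<Longrightarrow> (\<phi> has_real_derivative \<phi>' x) (at x)"
    and d2: "(\<phi>' has_real_derivative D) (at r)"
    and max: "\<And>x. l < x \<Longrightarrow> x < m \<Longrightarrow> \<phi> x \<le> \<phi> r"
  shows "\<phi>' r = 0" "D \<le> 0"
proof -
  define \<delta> where "\<delta> = min (r - l) (m - r)"
  have \<delta>: "\<delta> > 0" "\<And>x. \<bar>r - x\<bar> < \<delta> \<Longrightarrow> l < x \<and> x < m" using r by (auto simp: \<delta>_def)
  show z: "\<phi>' r = 0"
    by (rule DERIV_local_max[OF d[OF r] \<delta>(1)]) (use \<delta>(2) max in auto)
  show "D \<le> 0"
  proof (rule ccontr)
    assume "\<not> D \<le> 0"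
    then obtain e where e: "e > 0" "\<And>y. 0 < y \<Longrightarrow> y < e \<Longrightarrow> \<phi>' r < \<phi>' (r + y)"
      using DERIV_pos_inc_right[OF d2] by auto
    define y where "y = min e (m - r) / 2"
    have y: "0 < y" "y < e" "r + y < m" using e(1) r by (auto simp: y_def min_def field_simps)
    obtain z where z': "r < z" "z < r + y" "\<phi> (r + y) - \<phi> r = (r + y - r) * \<phi>' z"
      using MVT2[of r "r + y" \<phi> \<phi>'] d y r by force
    have "\<phi>' z > 0" using e(2)[of "z - r"] z' y z by auto
    then have "\<phi> (r + y) > \<phi> r" using z' y by (simp add: algebra_simps)
    moreover have "\<phi> (r + y) \<le> \<phi> r" using max[of "r + y"] y r by simp
    ultimately show False by simp
  qed
qed

text \<open>The contradiction uses earlier times only, so the final time t = T is allowed and the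
  derivative within \<open>{0..T}\<close> is enough there.\<close>

lemma time_derivative_nonneg_at_max:
  fixes \<phi> :: "real \<Rightarrow> real"
  assumes "0 < t" "t \<le> T" and d: "(\<phi> has_real_derivative D) (at t within {0..T})"
    and max: "\<And>s. 0 \<le> s \<Longrightarrow> s \<le> T \<Longrightarrow> \<phi> s \<le> \<phi> t"
  shows "D \<ge> 0"
proof (rule ccontr)
  assume "\<not> D \<ge> 0"
  then obtain e where e: "e > 0" "\<And>y. 0 < y \<Longrightarrow> t - y \<in> {0..T} \<Longrightarrow> y < e \<Longrightarrow> \<phi> t < \<phi> (t - y)"
    using has_real_derivative_neg_dec_left[OF d] by auto
  define y where "y = min e t / 2"
  have y: "0 < y" "y < e" "y \<le> t" using e(1) assms(1) by (auto simp: y_def min_def)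
  have "\<phi> t < \<phi> (t - y)" using y assms(2) by (intro e(2)) auto
  moreover have "\<phi> (t - y) \<le> \<phi> t" using y assms(2) by (intro max) auto
  ultimately show False by simp
qed

text \<open>The index and the point of the overall largest value are chosen together. In
  \<open>step\<close> the function \<open>\<phi> i\<close> therefore dominates the whole family at
  that point and itself on both axes through it, and the nonsmooth pointwise maximum of the family
  is never differentiated.\<close>

lemma joint_maximum_principle:
  fixes \<phi> :: "'i \<Rightarrow> real \<Rightarrow> real \<Rightarrow> real"
  assumes J: "finite J" and "0 \<le> T" "\<rho> \<le> 1"
    and cont: "\<And>i. i \<in> J \<Longrightarrow> continuous_on ({0..T} \<times> {\<rho>..1}) (\<lambda>(t, r). \<phi> i t r)"
    and init: "\<And>i r. i \<in> J \<Longrightarrow> \<rho> \<le> r \<Longrightarrow> r \<le> 1 \<Longrightarrow> \<phi> i 0 r \<le> 0"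
    and inner: "\<And>i t. i \<in> J \<Longrightarrow> 0 \<le> t \<Longrightarrow> t \<le> T \<Longrightarrow> \<phi> i t \<rho> \<le> 0"
    and outer: "\<And>i t. i \<in> J \<Longrightarrow> 0 \<le> t \<Longrightarrow> t \<le> T \<Longrightarrow> \<phi> i t 1 \<le> 0"
    and step: "\<And>i t r. i \<in> J \<Longrightarrow> 0 < t \<Longrightarrow> t \<le> T \<Longrightarrow> \<rho> < r \<Longrightarrow> r < 1 \<Longrightarrow> \<phi> i t r > 0 \<Longrightarrow>
      (\<And>j. j \<in> J \<Longrightarrow> \<phi> j t r \<le> \<phi> i t r) \<Longrightarrow>
      (\<And>r'. \<rho> \<le> r' \<Longrightarrow> r' \<le> 1 \<Longrightarrow> \<phi> i t r' \<le> \<phi> i t r) \<Longrightarrow>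
      (\<And>t'. 0 \<le> t' \<Longrightarrow> t' \<le> T \<Longrightarrow> \<phi> i t' r \<le> \<phi> i t r) \<Longrightarrow> False"
    and i: "i \<in> J" and t: "0 \<le> t" "t \<le> T" and r: "\<rho> \<le> r" "r \<le> 1"
  shows "\<phi> i t r \<le> 0"
proof -
  let ?S = "{0..T} \<times> {\<rho>..1}"
  have "\<exists>z\<in>?S. \<forall>y\<in>?S. (\<lambda>(t, r). \<phi> j t r) y \<le> (\<lambda>(t, r). \<phi> j t r) z" if "j \<in> J" for j
    using assms by (intro continuous_attains_sup compact_Times compact_Icc cont that) auto
  then obtain z where z: "\<And>j. j \<in> J \<Longrightarrow> z j \<in> ?S"
    "\<And>j y. j \<in> J \<Longrightarrow> y \<in> ?S \<Longrightarrow> (\<lambda>(t, r). \<phi> j t r) y \<le> (\<lambda>(t, r). \<phi> j t r) (z j)"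
    by metis
  let ?m = "\<lambda>j. \<phi> j (fst (z j)) (snd (z j))"
  have "Max (?m ` J) \<in> ?m ` J" using J i by (intro Max_in) auto
  then obtain k where k: "k \<in> J" "Max (?m ` J) = ?m k" by auto
  define t0 r0 where "t0 = fst (z k)" and "r0 = snd (z k)"
  have in0: "0 \<le> t0" "t0 \<le> T" "\<rho> \<le> r0" "r0 \<le> 1"
    using z(1)[OF k(1)] by (auto simp: t0_def r0_def mem_Times_iff)
  have top: "\<phi> j t' r' \<le> \<phi> k t0 r0" if "j \<in> J" "0 \<le> t'" "t' \<le> T" "\<rho> \<le> r'" "r' \<le> 1" for j t' r'
  proof -
    have "\<phi> j t' r' \<le> ?m j" using z(2)[OF that(1), of "(t', r')"] that by (auto simp: case_prod_beta)
    also have "\<dots> \<le> ?m k" using Max_ge[of "?m ` J" "?m j"] J that k(2) by auto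
    finally show ?thesis by (simp add: t0_def r0_def)
  qed
  show ?thesis
  proof (rule ccontr)
    assume "\<not> ?thesis"
    then have pos: "\<phi> k t0 r0 > 0" using top[OF i t r] by simp
    have "t0 \<noteq> 0" "r0 \<noteq> \<rho>" "r0 \<noteq> 1"
      using pos init[OF k(1)] inner[OF k(1)] outer[OF k(1)] in0 by (auto simp: not_le[symmetric])
    with in0 show False
      by (intro step[of k t0 r0]) (use pos top k in auto)
  qed
qed

text \<open>The hypotheses on \<open>a1\<close> and \<open>a2\<close> are the conditions at a
  spatial maximum of \<alpha> + \<epsilon> u, where u_ss = c - p^2, and the conclusion says
  (\<alpha> + \<epsilon> u)_t < 0, since u_t = a c. No smallness of \<epsilon> enters.\<close>

lemma reaction_max_a:
  fixes a b c p q a1 a2 \<epsilon> :: real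
  assumes pos: "0 < a" "0 < b" "0 < c" "0 < \<epsilon>"
    and a: "a = p * q" and codazzi: "a1 = (c - a) * q + (b - a) * p"
    and le: "b \<le> a" "c \<le> a" and a1: "a1 = - \<epsilon> * p" and a2: "a2 \<le> - \<epsilon> * (c - p\<^sup>2)"
  shows "a * a2 + (a * (p + q) + q * c + p * b) * a1
         + a * (a * b + a * c - 4 * b * c + (c - a) * q\<^sup>2 + (b - a) * p\<^sup>2) + \<epsilon> * (a * c) < 0"
proof -
  have p: "p \<noteq> 0" using a pos by auto
  \<comment> \<open>The Codazzi identity times p and times q. With p q = a these two relations bound
    a - b by \<epsilon> and a (a - c) by \<open>\<epsilon> * p\<^sup>2\<close>, and they remove p^2
    and q^2 from the reaction term.\<close>
  have cp: "(c - a) * a + (b - a) * p\<^sup>2 = - \<epsilon> * p\<^sup>2"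
    using arg_cong[OF codazzi[unfolded a1], of "\<lambda>x. x * p"] unfolding a by (simp add: algebra_simps power2_eq_square)
  have cq: "(c - a) * q\<^sup>2 + (b - a) * a = - \<epsilon> * a"
    using arg_cong[OF codazzi[unfolded a1], of "\<lambda>x. x * q"] unfolding a by (simp add: algebra_simps power2_eq_square)
  have "(\<epsilon> - (a - b)) * p\<^sup>2 = a * (a - c)" using cp by (simp add: algebra_simps)
  moreover have "0 \<le> a * (a - c)" using pos le by simp
  ultimately have ab: "a - b \<le> \<epsilon>" using p by (metis diff_ge_0_iff_ge zero_le_mult_iff zero_less_power2 not_le)
  have "(a - b) * p\<^sup>2 \<ge> 0" using le by simp
  then have ac: "a * (a - c) \<le> \<epsilon> * p\<^sup>2" using cp by (simp add: algebra_simps)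
  have "a * a2 \<le> a * (- \<epsilon> * (c - p\<^sup>2))" using a2 pos by (intro mult_left_mono) auto
  moreover have "(a * (p + q) + q * c + p * b) * a1 = - \<epsilon> * (a * p\<^sup>2 + a * a + a * c + b * p\<^sup>2)"
    unfolding a1 a by (simp add: algebra_simps power2_eq_square)
  moreover have "a * b + a * c - 4 * b * c + (c - a) * q\<^sup>2 + (b - a) * p\<^sup>2
      = a * b + a * c - 4 * b * c - \<epsilon> * p\<^sup>2 - (c - a) * a - \<epsilon> * a - (b - a) * a"
    using cp cq by linarith
  ultimately have "a * a2 + (a * (p + q) + q * c + p * b) * a1
         + a * (a * b + a * c - 4 * b * c + (c - a) * q\<^sup>2 + (b - a) * p\<^sup>2) + \<epsilon> * (a * c)
      \<le> a * (- \<epsilon> * (c - p\<^sup>2)) + - \<epsilon> * (a * p\<^sup>2 + a * a + a * c + b * p\<^sup>2)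
         + a * (a * b + a * c - 4 * b * c - \<epsilon> * p\<^sup>2 - (c - a) * a - \<epsilon> * a - (b - a) * a) + \<epsilon> * (a * c)"
    by (intro add_mono) (simp_all only: order_refl)
  also have "\<dots> = - \<epsilon> * a * c - 2 * \<epsilon> * a * a - (a + b) * (\<epsilon> * p\<^sup>2) + 2 * a * a * a - 4 * a * b * c"
    by (simp add: algebra_simps)
  \<comment> \<open>The bound \<open>ac\<close> uses the negative p^2 term to reduce 2 a^3 to a (a +
    c) (a - b) plus part of the abc term; by \<open>ab\<close> this is of order \<epsilon> and loses
    against -2 \<epsilon> a^2 - \<epsilon> a c.\<close>
  also have "\<dots> \<le> - \<epsilon> * a * c - 2 * \<epsilon> * a * a - (a + b) * (a * (a - c)) + 2 * a * a * a - 4 * a * b * c"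
    using mult_left_mono[OF ac, of "a + b"] pos by simp
  also have "\<dots> = - \<epsilon> * a * c - 2 * \<epsilon> * a * a + a * (a + c) * (a - b) - 2 * a * b * c"
    by (simp add: algebra_simps)
  also have "\<dots> \<le> - \<epsilon> * a * c - 2 * \<epsilon> * a * a + a * (a + c) * \<epsilon> - 2 * a * b * c"
    using mult_left_mono[OF ab, of "a * (a + c)"] pos by simp
  also have "\<dots> = - (\<epsilon> * a * a) - 2 * a * b * c" by (simp add: algebra_simps)
  also have "\<dots> < 0"
  proof -
    have "0 < \<epsilon> * a * a" "0 < 2 * a * b * c" using pos by simp_all
    then show ?thesis by linarith
  qed
  finally show ?thesis .
qed

text \<open>At a critical point the drift coefficient \<open>2 * a1\<close> is multiplied by
  \<epsilon> p. This form shows that the product involves p only through p^2 times b - a, which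
  stays bounded at the core.\<close>

lemma codazzi_mult_p:
  fixes a b c p q a1 :: real
  assumes a: "a = p * q" and codazzi: "a1 = (c - a) * q + (b - a) * p"
  shows "p * a1 = (c - a) * a + (b - a) * p\<^sup>2"
  unfolding codazzi a by (simp add: algebra_simps power2_eq_square)

text \<open>No sign is imposed on \<epsilon>: the identity is used with \<epsilon> at maxima of
  \<beta> + \<epsilon> u and with -\<epsilon> at minima of \<beta> - \<epsilon> u. The first bracket
  is controlled by the second-derivative test, and (b - a) p^2 carries a sign whenever \<alpha> and
  \<beta> are compared.\<close>

lemma reaction_b:
  fixes a b c p q a1 b1 b2 \<epsilon> :: real
  assumes a: "a = p * q" and codazzi: "a1 = (c - a) * q + (b - a) * p" and b1: "b1 = - \<epsilon> * p"
  shows "a * b2 + (2 * a1 + b * p + 2 * q * a - q * c) * b1 - 2 * b * (b - a) * p\<^sup>2 - 2 * a * b * c + \<epsilon> * (a * c)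
    = a * (b2 + \<epsilon> * (c - p\<^sup>2)) - (3 * \<epsilon> + 2 * b) * ((b - a) * p\<^sup>2) - \<epsilon> * a * c - 2 * a * b * c"
proof -
  have "(2 * a1 + b * p + 2 * q * a - q * c) * b1 = - \<epsilon> * (2 * (p * a1) + b * p\<^sup>2 + 2 * a * (p * q) - c * (p * q))"
    unfolding b1 by (simp add: algebra_simps power2_eq_square)
  also have "\<dots> = - \<epsilon> * (2 * ((c - a) * a + (b - a) * p\<^sup>2) + b * p\<^sup>2 + 2 * a * a - c * a)"
    unfolding codazzi_mult_p[OF a codazzi] using a by simp
  finally show ?thesis by (simp add: algebra_simps)
qed

text \<open>Here \<epsilon> (b - a) p^2 appears while only \<gamma> and \<alpha> are compared, so
  its sign is unknown. This term is the reason for the bound \<open>D\<close> on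
  \<open>\<bar>b - a\<bar> * p\<^sup>2\<close> in the estimates for \<gamma>.\<close>

lemma reaction_c:
  fixes a b c p q a1 c1 c2 \<epsilon> :: real
  assumes a: "a = p * q" and codazzi: "a1 = (c - a) * q + (b - a) * p" and c1: "c1 = - \<epsilon> * p"
  shows "a * c2 + (2 * a1 + c * q + 2 * p * a - p * b) * c1 - 2 * c * (c - a) * q\<^sup>2 - 2 * a * b * c + \<epsilon> * (a * c)
    = a * (c2 + \<epsilon> * (c - p\<^sup>2)) - \<epsilon> * ((b - a) * p\<^sup>2) - 3 * \<epsilon> * a * c + 2 * \<epsilon> * a\<^sup>2 - 2 * c * (c - a) * q\<^sup>2 - 2 * a * b * c"
proof -
  have "(2 * a1 + c * q + 2 * p * a - p * b) * c1 = - \<epsilon> * (2 * (p * a1) + c * (p * q) + 2 * a * p\<^sup>2 - b * p\<^sup>2)"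
    unfolding c1 by (simp add: algebra_simps power2_eq_square)
  also have "\<dots> = - \<epsilon> * (2 * ((c - a) * a + (b - a) * p\<^sup>2) + c * a + 2 * a * p\<^sup>2 - b * p\<^sup>2)"
    unfolding codazzi_mult_p[OF a codazzi] using a by simp
  finally show ?thesis by (simp add: algebra_simps power2_eq_square)
qed

lemma reaction_max_b:
  fixes a b c p q a1 b1 b2 \<epsilon> :: real
  assumes pos: "0 < a" "0 < b" "0 < c" "0 < \<epsilon>"
    and a: "a = p * q" and codazzi: "a1 = (c - a) * q + (b - a) * p"
    and le: "a \<le> b" and b1: "b1 = - \<epsilon> * p" and b2: "b2 \<le> - \<epsilon> * (c - p\<^sup>2)"
  shows "a * b2 + (2 * a1 + b * p + 2 * q * a - q * c) * b1
         - 2 * b * (b - a) * p\<^sup>2 - 2 * a * b * c + \<epsilon> * (a * c) < 0"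
proof -
  have "a * (b2 + \<epsilon> * (c - p\<^sup>2)) \<le> 0" using b2 pos by (simp add: mult_le_0_iff)
  moreover have "0 \<le> (3 * \<epsilon> + 2 * b) * ((b - a) * p\<^sup>2)" using pos le by simp
  moreover have "0 < \<epsilon> * a * c" "0 < 2 * a * b * c" using pos by simp_all
  ultimately show ?thesis unfolding reaction_b[OF a codazzi b1] by linarith
qed

lemma reaction_max_c:
  fixes a b c p q a1 c1 c2 \<epsilon> D :: real
  assumes pos: "0 < a" "0 < b" "0 < c" "0 < \<epsilon>"
    and a: "a = p * q" and codazzi: "a1 = (c - a) * q + (b - a) * p"
    and le: "a \<le> c" and c1: "c1 = - \<epsilon> * p" and c2: "c2 \<le> - \<epsilon> * (c - p\<^sup>2)"
    and D: "\<bar>b - a\<bar> * p\<^sup>2 \<le> D" and small: "\<epsilon> * (D + 2 * a\<^sup>2) < 2 * a * b * c"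
  shows "a * c2 + (2 * a1 + c * q + 2 * p * a - p * b) * c1
         - 2 * c * (c - a) * q\<^sup>2 - 2 * a * b * c + \<epsilon> * (a * c) < 0"
proof -
  have "a * (c2 + \<epsilon> * (c - p\<^sup>2)) \<le> 0" using c2 pos by (simp add: mult_le_0_iff)
  moreover have "0 \<le> 2 * c * (c - a) * q\<^sup>2" using pos le by simp
  moreover have "0 < \<epsilon> * a * c" using pos by simp
  moreover have "- (\<epsilon> * ((b - a) * p\<^sup>2)) \<le> \<epsilon> * D"
  proof -
    have "- ((b - a) * p\<^sup>2) \<le> \<bar>b - a\<bar> * p\<^sup>2"
      by (metis abs_ge_minus_self mult_minus_left mult_right_mono zero_le_power2)
    then have "\<epsilon> * (- ((b - a) * p\<^sup>2)) \<le> \<epsilon> * D" using D pos by (intro mult_left_mono) auto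
    then show ?thesis by simp
  qed
  ultimately show ?thesis using small unfolding reaction_c[OF a codazzi c1]
    by (simp add: distrib_left)
qed

text \<open>The conditions are those at a minimum of \<alpha> - \<epsilon> u. After elimination of
  p^2 and q^2 by the Codazzi identity the remaining terms are at least 2 a^3 - 4 a b c plus positive
  terms in \<epsilon>; the cubic pays for the error 4 K \<epsilon> a in the bound for b c, which is
  what \<open>small\<close> expresses.\<close>

lemma reaction_min_a:
  fixes a b c p q a1 a2 \<epsilon> K :: real
  assumes pos: "0 < a" "0 < b" "0 < c" "0 < \<epsilon>"
    and a: "a = p * q" and codazzi: "a1 = (c - a) * q + (b - a) * p"
    and K: "b \<le> K" "c \<le> K" and a1: "a1 = \<epsilon> * p" and a2: "\<epsilon> * (c - p\<^sup>2) \<le> a2"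
    and small: "2 * K * \<epsilon> < a\<^sup>2"
  shows "- 4 * K * a\<^sup>2 + \<epsilon> * (a * c) < a * a2 + (a * (p + q) + q * c + p * b) * a1
         + a * (a * b + a * c - 4 * b * c + (c - a) * q\<^sup>2 + (b - a) * p\<^sup>2)"
proof -
  have p: "p \<noteq> 0" using a pos by auto
  have K0: "0 < K" using K pos by simp
  have cp: "(c - a) * a + (b - a) * p\<^sup>2 = \<epsilon> * p\<^sup>2"
    using arg_cong[OF codazzi[unfolded a1], of "\<lambda>x. x * p"] unfolding a by (simp add: algebra_simps power2_eq_square)
  have cq: "(c - a) * q\<^sup>2 + (b - a) * a = \<epsilon> * a"
    using arg_cong[OF codazzi[unfolded a1], of "\<lambda>x. x * q"] unfolding a by (simp add: algebra_simps power2_eq_square)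
  \<comment> \<open>By \<open>cp\<close>, b and c cannot both exceed a by more than the barrier
    allows: either c is at most a, or b is at most a + \<epsilon>. The other factor is bounded by
    K.\<close>
  have bc: "b * c \<le> K * (a + \<epsilon>)"
  proof (cases "c \<le> a")
    case True
    then have "b * c \<le> K * (a + \<epsilon>)" using K pos by (intro mult_mono) auto
    then show ?thesis .
  next
    case False
    then have "0 \<le> (c - a) * a" using pos by simp
    then have "(b - a) * p\<^sup>2 \<le> \<epsilon> * p\<^sup>2" using cp by simp
    then have "b \<le> a + \<epsilon>" using p by simp
    then have "c * b \<le> K * (a + \<epsilon>)" using K pos by (intro mult_mono) auto
    then show ?thesis by (simp add: mult.commute)
  qed
  have "a * (\<epsilon> * (c - p\<^sup>2)) \<le> a * a2" using a2 pos by (intro mult_left_mono) auto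
  moreover have "(a * (p + q) + q * c + p * b) * a1 = \<epsilon> * (a * p\<^sup>2 + a * a + a * c + b * p\<^sup>2)"
    unfolding a1 a by (simp add: algebra_simps power2_eq_square)
  moreover have "a * b + a * c - 4 * b * c + (c - a) * q\<^sup>2 + (b - a) * p\<^sup>2
      = a * b + a * c - 4 * b * c + \<epsilon> * p\<^sup>2 - (c - a) * a + \<epsilon> * a - (b - a) * a"
    using cp cq by linarith
  ultimately have "a * (\<epsilon> * (c - p\<^sup>2)) + \<epsilon> * (a * p\<^sup>2 + a * a + a * c + b * p\<^sup>2)
         + a * (a * b + a * c - 4 * b * c + \<epsilon> * p\<^sup>2 - (c - a) * a + \<epsilon> * a - (b - a) * a)
     \<le> a * a2 + (a * (p + q) + q * c + p * b) * a1
         + a * (a * b + a * c - 4 * b * c + (c - a) * q\<^sup>2 + (b - a) * p\<^sup>2)" (is "?l \<le> _")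
    by (intro add_mono) (simp_all only: order_refl)
  moreover have "?l = 2 * \<epsilon> * a * c + 2 * \<epsilon> * a * a + \<epsilon> * (a + b) * p\<^sup>2 + 2 * a * a\<^sup>2 - 4 * a * (b * c)"
    by (simp add: algebra_simps power2_eq_square)
  moreover have "0 < \<epsilon> * a * c" "0 < \<epsilon> * a * a" "0 \<le> \<epsilon> * (a + b) * p\<^sup>2" using pos by simp_all
  moreover have "a * (b * c) \<le> a * (K * (a + \<epsilon>))" using bc pos by (intro mult_left_mono) auto
  moreover have "a * (K * (a + \<epsilon>)) = K * a\<^sup>2 + a * (K * \<epsilon>)" by (simp add: algebra_simps power2_eq_square)
  moreover have "a * (2 * K * \<epsilon>) < a * a\<^sup>2" using small pos by (intro mult_strict_left_mono) auto
  ultimately show ?thesis by simp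
qed

text \<open>The functions are written in terms of time and radius; \<open>a1\<close>, \<open>a2\<close>, \<open>b1\<close>, \<dots> are derivatives
  in the distance \<open>s\<close> from the core, \<open>p = u\<^sub>s\<close> and \<open>q = v\<^sub>s\<close>.\<close>

locale curvature_evolution =
  fixes T :: real and a b c p q u h h' a1 a2 b1 b2 c1 c2 :: "real \<Rightarrow> real \<Rightarrow> real"
    and K0 L0 D U :: real
  assumes T: "0 \<le> T"
    and cont: "continuous_on ({0..T} \<times> {0..1}) (\<lambda>(t, r). a t r)"
      "continuous_on ({0..T} \<times> {0..1}) (\<lambda>(t, r). b t r)"
      "continuous_on ({0..T} \<times> {0..1}) (\<lambda>(t, r). c t r)"
    and cont_u: "continuous_on ({0..T} \<times> {0<..1}) (\<lambda>(t, r). u t r)"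
    and u_le: "\<And>t r. 0 \<le> t \<Longrightarrow> t \<le> T \<Longrightarrow> 0 < r \<Longrightarrow> r \<le> 1 \<Longrightarrow> u t r \<le> U"
    and u_core: "\<And>M. \<exists>\<delta>>0. \<forall>t r. 0 \<le> t \<longrightarrow> t \<le> T \<longrightarrow> 0 < r \<longrightarrow> r < \<delta> \<longrightarrow> r \<le> 1 \<longrightarrow> u t r \<le> M"
    and h_pos: "\<And>t r. 0 \<le> t \<Longrightarrow> t \<le> T \<Longrightarrow> 0 < r \<Longrightarrow> r < 1 \<Longrightarrow> 0 < h t r"
    and a_eq: "\<And>t r. 0 \<le> t \<Longrightarrow> t \<le> T \<Longrightarrow> 0 < r \<Longrightarrow> r < 1 \<Longrightarrow> a t r = p t r * q t r"
    and codazzi: "\<And>t r. 0 \<le> t \<Longrightarrow> t \<le> T \<Longrightarrow> 0 < r \<Longrightarrow> r < 1 \<Longrightarrow>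
      a1 t r = (c t r - a t r) * q t r + (b t r - a t r) * p t r"
    and core_bound: "\<And>t r. 0 \<le> t \<Longrightarrow> t \<le> T \<Longrightarrow> 0 < r \<Longrightarrow> r < 1 \<Longrightarrow> \<bar>b t r - a t r\<bar> * (p t r)\<^sup>2 \<le> D"
    and dr: "\<And>t r. 0 \<le> t \<Longrightarrow> t \<le> T \<Longrightarrow> 0 < r \<Longrightarrow> r < 1 \<Longrightarrow> (h t has_real_derivative h' t r) (at r)"
      "\<And>t r. 0 \<le> t \<Longrightarrow> t \<le> T \<Longrightarrow> 0 < r \<Longrightarrow> r < 1 \<Longrightarrow> (u t has_real_derivative h t r * p t r) (at r)"
      "\<And>t r. 0 \<le> t \<Longrightarrow> t \<le> T \<Longrightarrow> 0 < r \<Longrightarrow> r < 1 \<Longrightarrow> (p t has_real_derivative h t r * (c t r - (p t r)\<^sup>2)) (at r)"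
      "\<And>t r. 0 \<le> t \<Longrightarrow> t \<le> T \<Longrightarrow> 0 < r \<Longrightarrow> r < 1 \<Longrightarrow> (a t has_real_derivative h t r * a1 t r) (at r)"
      "\<And>t r. 0 \<le> t \<Longrightarrow> t \<le> T \<Longrightarrow> 0 < r \<Longrightarrow> r < 1 \<Longrightarrow> (a1 t has_real_derivative h t r * a2 t r) (at r)"
      "\<And>t r. 0 \<le> t \<Longrightarrow> t \<le> T \<Longrightarrow> 0 < r \<Longrightarrow> r < 1 \<Longrightarrow> (b t has_real_derivative h t r * b1 t r) (at r)"
      "\<And>t r. 0 \<le> t \<Longrightarrow> t \<le> T \<Longrightarrow> 0 < r \<Longrightarrow> r < 1 \<Longrightarrow> (b1 t has_real_derivative h t r * b2 t r) (at r)"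
      "\<And>t r. 0 \<le> t \<Longrightarrow> t \<le> T \<Longrightarrow> 0 < r \<Longrightarrow> r < 1 \<Longrightarrow> (c t has_real_derivative h t r * c1 t r) (at r)"
      "\<And>t r. 0 \<le> t \<Longrightarrow> t \<le> T \<Longrightarrow> 0 < r \<Longrightarrow> r < 1 \<Longrightarrow> (c1 t has_real_derivative h t r * c2 t r) (at r)"
    and dt_u: "\<And>t r. 0 \<le> t \<Longrightarrow> t \<le> T \<Longrightarrow> 0 < r \<Longrightarrow> r < 1 \<Longrightarrow>
      ((\<lambda>\<tau>. u \<tau> r) has_real_derivative a t r * c t r) (at t within {0..T})"
    and dt_a: "\<And>t r. 0 \<le> t \<Longrightarrow> t \<le> T \<Longrightarrow> 0 < r \<Longrightarrow> r < 1 \<Longrightarrow>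
      ((\<lambda>\<tau>. a \<tau> r) has_real_derivative
         a t r * a2 t r + (a t r * (p t r + q t r) + q t r * c t r + p t r * b t r) * a1 t r
         + a t r * (a t r * b t r + a t r * c t r - 4 * b t r * c t r
            + (c t r - a t r) * (q t r)\<^sup>2 + (b t r - a t r) * (p t r)\<^sup>2)) (at t within {0..T})"
    and dt_b: "\<And>t r. 0 \<le> t \<Longrightarrow> t \<le> T \<Longrightarrow> 0 < r \<Longrightarrow> r < 1 \<Longrightarrow>
      ((\<lambda>\<tau>. b \<tau> r) has_real_derivative
         a t r * b2 t r + (2 * a1 t r + b t r * p t r + 2 * q t r * a t r - q t r * c t r) * b1 t r
         - 2 * b t r * (b t r - a t r) * (p t r)\<^sup>2 - 2 * a t r * b t r * c t r) (at t within {0..T})"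
    and dt_c: "\<And>t r. 0 \<le> t \<Longrightarrow> t \<le> T \<Longrightarrow> 0 < r \<Longrightarrow> r < 1 \<Longrightarrow>
      ((\<lambda>\<tau>. c \<tau> r) has_real_derivative
         a t r * c2 t r + (2 * a1 t r + c t r * q t r + 2 * p t r * a t r - p t r * b t r) * c1 t r
         - 2 * c t r * (c t r - a t r) * (q t r)\<^sup>2 - 2 * a t r * b t r * c t r) (at t within {0..T})"
    and outer: "\<And>t. 0 \<le> t \<Longrightarrow> t \<le> T \<Longrightarrow> a t 1 = (1 + 4 * t) powr (-1/2)"
      "\<And>t. 0 \<le> t \<Longrightarrow> t \<le> T \<Longrightarrow> b t 1 = (1 + 4 * t) powr (-1/2)"
      "\<And>t. 0 \<le> t \<Longrightarrow> t \<le> T \<Longrightarrow> c t 1 = (1 + 4 * t) powr (-1/2)"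
    and init: "\<And>r. 0 \<le> r \<Longrightarrow> r \<le> 1 \<Longrightarrow> L0 \<le> a 0 r \<and> a 0 r \<le> K0"
      "\<And>r. 0 \<le> r \<Longrightarrow> r \<le> 1 \<Longrightarrow> L0 \<le> b 0 r \<and> b 0 r \<le> K0"
      "\<And>r. 0 \<le> r \<Longrightarrow> r \<le> 1 \<Longrightarrow> L0 \<le> c 0 r \<and> c 0 r \<le> K0"
    and L0: "0 < L0"
    and positive: "\<And>t r. 0 \<le> t \<Longrightarrow> t \<le> T \<Longrightarrow> 0 \<le> r \<Longrightarrow> r \<le> 1 \<Longrightarrow> 0 < a t r \<and> 0 < b t r \<and> 0 < c t r"
begin

section \<open>A priori bounds while all three curvatures are positive\<close>

lemma positive_lower_bound:
  "\<exists>m>0. \<forall>t r. 0 \<le> t \<longrightarrow> t \<le> T \<longrightarrow> 0 \<le> r \<longrightarrow> r \<le> 1 \<longrightarrow> m \<le> a t r \<and> m \<le> b t r \<and> m \<le> c t r"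
proof -
  let ?S = "{0..T} \<times> {0..1::real}"
  have S: "compact ?S" "?S \<noteq> {}" using T by (auto intro!: compact_Times)
  have "\<exists>m>0. \<forall>z\<in>?S. m \<le> k z" if "continuous_on ?S k" "\<forall>z\<in>?S. 0 < k z" for k :: "real \<times> real \<Rightarrow> real"
    using continuous_attains_inf[OF S that(1)] that(2) by blast
  from this[OF cont(1)] this[OF cont(2)] this[OF cont(3)] obtain m1 m2 m3 where
    "m1 > 0" "m2 > 0" "m3 > 0" "\<forall>z\<in>?S. m1 \<le> (\<lambda>(t, r). a t r) z" "\<forall>z\<in>?S. m2 \<le> (\<lambda>(t, r). b t r) z" "\<forall>z\<in>?S. m3 \<le> (\<lambda>(t, r). c t r) z"
    using positive by auto
  then show ?thesis
    by (intro exI[of _ "min m1 (min m2 m3)"]) (auto simp: Ball_def min_le_iff_disj)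
qed

text \<open>A crude bound, needed because the admissible size of \<epsilon> in
  \<open>upper_bound\<close> has to be fixed before the bound by \<open>K0\<close> is
  available.\<close>

lemma a_bounded: "\<exists>M. \<forall>t r. 0 \<le> t \<longrightarrow> t \<le> T \<longrightarrow> 0 \<le> r \<longrightarrow> r \<le> 1 \<longrightarrow> a t r \<le> M"
proof -
  have "\<exists>z\<in>{0..T} \<times> {0..1}. \<forall>y\<in>{0..T} \<times> {0..1}. (\<lambda>(t, r). a t r) y \<le> (\<lambda>(t, r). a t r) z"
    using T by (intro continuous_attains_sup cont compact_Times) auto
  then show ?thesis by (auto simp: Ball_def)
qed

text \<open>Since \<open>u\<close> tends to \<open>-\<infinity>\<close> at the core, adding \<open>\<epsilon> u\<close> keeps the maximum away from the
  singular points of the equations.\<close>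

lemma barrier_principle:
  fixes Y Y1 Y2 Yt :: "'i \<Rightarrow> real \<Rightarrow> real \<Rightarrow> real"
  assumes J: "finite J"
    and contY: "\<And>i. i \<in> J \<Longrightarrow> continuous_on ({0..T} \<times> {0..1}) (\<lambda>(t, r). Y i t r)"
    and dY: "\<And>i t r. i \<in> J \<Longrightarrow> 0 \<le> t \<Longrightarrow> t \<le> T \<Longrightarrow> 0 < r \<Longrightarrow> r < 1 \<Longrightarrow> (Y i t has_real_derivative h t r * Y1 i t r) (at r)"
      "\<And>i t r. i \<in> J \<Longrightarrow> 0 \<le> t \<Longrightarrow> t \<le> T \<Longrightarrow> 0 < r \<Longrightarrow> r < 1 \<Longrightarrow> (Y1 i t has_real_derivative h t r * Y2 i t r) (at r)"
      "\<And>i t r. i \<in> J \<Longrightarrow> 0 \<le> t \<Longrightarrow> t \<le> T \<Longrightarrow> 0 < r \<Longrightarrow> r < 1 \<Longrightarrow> ((\<lambda>\<tau>. Y i \<tau> r) has_real_derivative Yt i t r) (at t within {0..T})"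
    and initY: "\<And>i r. i \<in> J \<Longrightarrow> 0 \<le> r \<Longrightarrow> r \<le> 1 \<Longrightarrow> Y i 0 r \<le> 0"
    and outerY: "\<And>i t. i \<in> J \<Longrightarrow> 0 \<le> t \<Longrightarrow> t \<le> T \<Longrightarrow> Y i t 1 \<le> 0"
    and \<epsilon>0: "0 < \<epsilon>0"
    and step: "\<And>\<epsilon> i t r. 0 < \<epsilon> \<Longrightarrow> \<epsilon> < \<epsilon>0 \<Longrightarrow> i \<in> J \<Longrightarrow> 0 < t \<Longrightarrow> t \<le> T \<Longrightarrow> 0 < r \<Longrightarrow> r < 1 \<Longrightarrow>
      Y i t r > 0 \<Longrightarrow> (\<And>j. j \<in> J \<Longrightarrow> Y j t r \<le> Y i t r) \<Longrightarrow>
      Y1 i t r = - \<epsilon> * p t r \<Longrightarrow> Y2 i t r \<le> - \<epsilon> * (c t r - (p t r)\<^sup>2) \<Longrightarrow>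
      Yt i t r + \<epsilon> * (a t r * c t r) < 0"
    and i: "i \<in> J" and t: "0 \<le> t" "t \<le> T" and r: "0 \<le> r" "r \<le> 1"
  shows "Y i t r \<le> 0"
proof -
  have "\<exists>M. \<forall>z\<in>{0..T} \<times> {0..1}. (\<lambda>(t, r). Y j t r) z \<le> M" if "j \<in> J" for j
  proof -
    have "compact ((\<lambda>(t, r). Y j t r) ` ({0..T} \<times> {0..1}))"
      by (intro compact_continuous_image contY that compact_Times compact_Icc)
    then have "bdd_above ((\<lambda>(t, r). Y j t r) ` ({0..T} \<times> {0..1}))"
      by (intro bounded_imp_bdd_above compact_imp_bounded)
    then show ?thesis by (auto simp: bdd_above_def)
  qed
  then obtain M where M: "\<And>j t r. j \<in> J \<Longrightarrow> 0 \<le> t \<Longrightarrow> t \<le> T \<Longrightarrow> 0 \<le> r \<Longrightarrow> r \<le> 1 \<Longrightarrow> Y j t r \<le> M j"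
    by (simp add: Ball_def) metis
  define N where "N = Max (insert 0 (M ` J))"
  have N: "Y j t r \<le> N" if "j \<in> J" "0 \<le> t" "t \<le> T" "0 \<le> r" "r \<le> 1" for j t r
  proof -
    have "M j \<le> N" unfolding N_def using J that(1) by (intro Max_ge) auto
    then show ?thesis using M[OF that] by simp
  qed
  have eps: "Y i t r \<le> \<epsilon> * (U - u t r)" if "0 < \<epsilon>" "\<epsilon> < \<epsilon>0" "0 < r" "r \<le> 1" for \<epsilon> r
  proof -
    \<comment> \<open>So close to the core that \<epsilon> (u - U) is at most -N, which outweighs
      every \<open>Y j\<close>; this supplies the inner boundary condition at \<rho>.\<close>
    obtain \<delta> where \<delta>: "\<delta> > 0" "\<And>t r. 0 \<le> t \<Longrightarrow> t \<le> T \<Longrightarrow> 0 < r \<Longrightarrow> r < \<delta> \<Longrightarrow> r \<le> 1 \<Longrightarrow> u t r \<le> U - N / \<epsilon>"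
      using u_core by blast
    define \<rho> where "\<rho> = min \<delta> r / 2"
    have \<rho>: "0 < \<rho>" "\<rho> < \<delta>" "\<rho> < r" using \<delta>(1) that by (auto simp: \<rho>_def min_def)
    \<comment> \<open>Subtracting the upper bound \<open>U\<close> makes the barrier nonpositive.
      The conditions at t = 0 and r = 1 therefore survive, and positivity of this function implies
      positivity of \<open>Y\<close>.\<close>
    let ?\<phi> = "\<lambda>i t r. Y i t r + \<epsilon> * (u t r - U)"
    have "?\<phi> i t r \<le> 0"
    proof (rule joint_maximum_principle[where J = J and \<rho> = \<rho> and T = T and \<phi> = ?\<phi>])
      fix j assume j: "j \<in> J"
      have "continuous_on ({0..T} \<times> {\<rho>..1}) (\<lambda>(t, r). Y j t r)"
        by (rule continuous_on_subset[OF contY[OF j]]) (use \<rho> in auto)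
      moreover have "continuous_on ({0..T} \<times> {\<rho>..1}) (\<lambda>(t, r). u t r)"
        by (rule continuous_on_subset[OF cont_u]) (use \<rho> in auto)
      ultimately show "continuous_on ({0..T} \<times> {\<rho>..1}) (\<lambda>(t, r). Y j t r + \<epsilon> * (u t r - U))"
        unfolding case_prod_beta by (intro continuous_intros)
    next
      fix j r assume "j \<in> J" "\<rho> \<le> r" "r \<le> 1"
      then show "?\<phi> j 0 r \<le> 0"
        using initY[of j r] u_le[of 0 r] T \<rho> that mult_nonneg_nonpos[of \<epsilon> "u 0 r - U"] by auto
    next
      fix j t assume "j \<in> J" "0 \<le> t" "t \<le> T"
      then show "?\<phi> j t 1 \<le> 0"
        using outerY[of j t] u_le[of t 1] that mult_nonneg_nonpos[of \<epsilon> "u t 1 - U"] by auto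
    next
      fix j t assume *: "j \<in> J" "0 \<le> t" "t \<le> T"
      have "\<epsilon> * (u t \<rho> - U) \<le> \<epsilon> * (- N / \<epsilon>)"
        using \<delta>(2)[of t \<rho>] * \<rho> that by (intro mult_left_mono) auto
      also have "\<dots> = - N" using that by simp
      finally show "?\<phi> j t \<rho> \<le> 0" using N[of j t \<rho>] * \<rho> that by simp
    next
      fix j t r
      assume j: "j \<in> J" and t: "0 < t" "t \<le> T" and r: "\<rho> < r" "r < 1" and pos: "0 < ?\<phi> j t r"
        and joint: "\<And>k. k \<in> J \<Longrightarrow> ?\<phi> k t r \<le> ?\<phi> j t r"
        and space: "\<And>r'. \<rho> \<le> r' \<Longrightarrow> r' \<le> 1 \<Longrightarrow> ?\<phi> j t r' \<le> ?\<phi> j t r"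
        and time: "\<And>t'. 0 \<le> t' \<Longrightarrow> t' \<le> T \<Longrightarrow> ?\<phi> j t' r \<le> ?\<phi> j t r"
      have r0: "0 < r" "r \<le> 1" "0 \<le> t" using r \<rho> t by auto
      have hp: "0 < h t r" using h_pos r0 r t by auto
      have d1: "(?\<phi> j t has_real_derivative h t x * (Y1 j t x + \<epsilon> * p t x)) (at x)" if "\<rho> < x" "x < 1" for x
        using that \<rho> t r0 j by (auto intro!: derivative_eq_intros dY dr simp: algebra_simps)
      have d2: "((\<lambda>x. h t x * (Y1 j t x + \<epsilon> * p t x)) has_real_derivative
          h' t r * (Y1 j t r + \<epsilon> * p t r) + h t r * (h t r * (Y2 j t r + \<epsilon> * (c t r - (p t r)\<^sup>2)))) (at r)"
        using r t r0 j by (auto intro!: derivative_eq_intros dY dr simp: algebra_simps)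
      \<comment> \<open>The second r-derivative contains h' times the first s-derivative, which
        vanishes at the critical point; the remaining factor h^2 is positive, so the test holds in
        the variable s.\<close>
      have crit: "h t r * (Y1 j t r + \<epsilon> * p t r) = 0"
        and sec: "h' t r * (Y1 j t r + \<epsilon> * p t r) + h t r * (h t r * (Y2 j t r + \<epsilon> * (c t r - (p t r)\<^sup>2))) \<le> 0"
        using second_derivative_nonpos_at_max[OF r d1 d2] space by auto
      have y1: "Y1 j t r + \<epsilon> * p t r = 0" using crit hp by simp
      have "Y2 j t r + \<epsilon> * (c t r - (p t r)\<^sup>2) \<le> 0"
        using sec hp unfolding y1 by (simp add: mult_le_0_iff)
      moreover have "0 \<le> Yt j t r + \<epsilon> * (a t r * c t r - 0)"
      proof (rule time_derivative_nonneg_at_max[OF t])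
        show "((\<lambda>t. ?\<phi> j t r) has_real_derivative Yt j t r + \<epsilon> * (a t r * c t r - 0)) (at t within {0..T})"
          using j r0 t r by (intro DERIV_add DERIV_cmult DERIV_diff DERIV_const dY(3) dt_u) auto
      qed (rule time)
      moreover have "0 < Y j t r"
        using pos u_le[of t r] r0 t that mult_nonneg_nonpos[of \<epsilon> "u t r - U"] by auto
      ultimately show False
        using step[OF that(1,2) j t r0(1) r(2)] joint y1 by (simp add: algebra_simps)
    qed (use J T i t that \<rho> in auto)
    then show ?thesis by (simp add: algebra_simps)
  qed
  \<comment> \<open>At fixed r > 0 the value of u is finite, so the barrier can be removed by
    letting \<epsilon> tend to 0; the core itself is then reached by continuity.\<close>
  have off_core: "Y i t r \<le> 0" if "0 < r" "r \<le> 1" for r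
  proof (rule tendsto_lowerbound)
    show "((\<lambda>\<epsilon>. \<epsilon> * (U - u t r)) \<longlongrightarrow> 0) (at_right 0)"
      by (auto intro!: tendsto_eq_intros)
    have "\<forall>\<^sub>F \<epsilon> in at_right (0::real). \<epsilon> \<in> {0<..<\<epsilon>0}" by (rule eventually_at_right_real[OF \<epsilon>0])
    then show "\<forall>\<^sub>F \<epsilon> in at_right 0. Y i t r \<le> \<epsilon> * (U - u t r)"
      by eventually_elim (use eps that in auto)
  qed simp
  show ?thesis
  proof (cases "r = 0")
    case True
    have "continuous_on {0..1} (\<lambda>r. (t, r))" by (intro continuous_intros)
    then have "continuous_on {0..1} (Y i t)"
      using continuous_on_compose2[OF contY[OF i], of "{0..1}" "\<lambda>r. (t, r)"] t
      by (simp add: image_subset_iff)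
    then have "(Y i t \<longlongrightarrow> Y i t 0) (at_right 0)"
      unfolding continuous_on_def
      by (metis atLeastAtMost_iff at_within_Icc_at_right order_refl zero_le_one zero_less_one)
    moreover have "\<forall>\<^sub>F r in at_right (0::real). r \<in> {0<..<1}" by (rule eventually_at_right_real) simp
    then have "\<forall>\<^sub>F r in at_right 0. Y i t r \<le> 0" by eventually_elim (use off_core in auto)
    ultimately show ?thesis using True by (simp add: tendsto_upperbound)
  qed (use off_core r in auto)
qed

lemma upper_bound:
  assumes t: "0 \<le> t" "t \<le> T" and r: "0 \<le> r" "r \<le> 1"
  shows "a t r \<le> K0 \<and> b t r \<le> K0 \<and> c t r \<le> K0"
proof -
  obtain m where m: "0 < m" "\<And>t r. 0 \<le> t \<Longrightarrow> t \<le> T \<Longrightarrow> 0 \<le> r \<Longrightarrow> r \<le> 1 \<Longrightarrow> m \<le> a t r \<and> m \<le> b t r \<and> m \<le> c t r"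
    using positive_lower_bound by blast
  obtain M where M: "\<And>t r. 0 \<le> t \<Longrightarrow> t \<le> T \<Longrightarrow> 0 \<le> r \<Longrightarrow> r \<le> 1 \<Longrightarrow> a t r \<le> M"
    using a_bounded by blast
  \<comment> \<open>Chosen for \<open>reaction_max_c\<close>: it makes \<epsilon> (D + 2 a^2)
    smaller than m^3, hence than 2 a b c. The summand 1 keeps the denominator positive.\<close>
  define \<epsilon>0 where "\<epsilon>0 = m^3 / (\<bar>D\<bar> + 2 * M\<^sup>2 + 1)"
  let ?Y = "\<lambda>i t r. (if i = 0 then a t r else if i = 1 then b t r else c t r) - K0"
  let ?Y1 = "\<lambda>i t r. (if i = 0 then a1 t r else if i = 1 then b1 t r else c1 t r)"
  let ?Y2 = "\<lambda>i t r. (if i = 0 then a2 t r else if i = 1 then b2 t r else c2 t r)"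
  let ?Yt = "\<lambda>i t r. (if i = 0 then
         a t r * a2 t r + (a t r * (p t r + q t r) + q t r * c t r + p t r * b t r) * a1 t r
         + a t r * (a t r * b t r + a t r * c t r - 4 * b t r * c t r
            + (c t r - a t r) * (q t r)\<^sup>2 + (b t r - a t r) * (p t r)\<^sup>2) else if i = 1 then
         a t r * b2 t r + (2 * a1 t r + b t r * p t r + 2 * q t r * a t r - q t r * c t r) * b1 t r
         - 2 * b t r * (b t r - a t r) * (p t r)\<^sup>2 - 2 * a t r * b t r * c t r else
         a t r * c2 t r + (2 * a1 t r + c t r * q t r + 2 * p t r * a t r - p t r * b t r) * c1 t r
         - 2 * c t r * (c t r - a t r) * (q t r)\<^sup>2 - 2 * a t r * b t r * c t r)"
  have "?Y i t r \<le> 0" if "i \<in> {0,1,2::nat}" for i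
  proof (rule barrier_principle[where J = "{0,1,2::nat}" and Y = ?Y and ?Y1.0 = ?Y1 and ?Y2.0 = ?Y2 and Yt = ?Yt and ?\<epsilon>0.0 = \<epsilon>0])
    fix i :: nat
    show "continuous_on ({0..T} \<times> {0..1}) (\<lambda>(t, r). (if i = 0 then a t r else if i = 1 then b t r else c t r) - K0)"
      using cont unfolding case_prod_beta by (cases "i = 0"; cases "i = 1") (auto intro!: continuous_intros)
  next
    fix i :: nat and t r :: real assume "0 \<le> t" "t \<le> T" "0 < r" "r < 1"
    note z = this
    note d = dr(4)[OF z] dr(6)[OF z] dr(8)[OF z] dt_a[OF z] dt_b[OF z] dt_c[OF z]
    note d' = d[THEN DERIV_diff, OF DERIV_const[of K0]]
    show "(?Y i t has_real_derivative h t r * ?Y1 i t r) (at r)"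
      using d'(1-3) by simp
    show "(?Y1 i t has_real_derivative h t r * ?Y2 i t r) (at r)"
      using dr(5)[OF z] dr(7)[OF z] dr(9)[OF z] by simp
    show "((\<lambda>\<tau>. ?Y i \<tau> r) has_real_derivative ?Yt i t r) (at t within {0..T})"
      using d'(4-6) by simp
  next
    fix i :: nat and r :: real assume "0 \<le> r" "r \<le> 1"
    then show "?Y i 0 r \<le> 0" using init[of r] by auto
  next
    fix i :: nat and t :: real assume t: "0 \<le> t" "t \<le> T"
    have "(1 + 4 * t) powr (- 1 / 2) \<le> 1 powr (-1/2)" using t by (intro powr_mono2') auto
    \<comment> \<open>The corner t = 0, r = 1 has curvature 1 by the boundary values, and initial
      curvatures are at most \<open>K0\<close>.\<close>
    moreover have "1 \<le> K0" using outer(1)[of 0] init(1)[of 1] T by simp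
    ultimately show "?Y i t 1 \<le> 0" using outer t by auto
  next
    show "0 < \<epsilon>0" using m(1) by (auto simp: \<epsilon>0_def intro!: divide_pos_pos add_nonneg_pos)
  next
    fix \<epsilon> t r :: real and i :: nat
    assume e: "0 < \<epsilon>" "\<epsilon> < \<epsilon>0" and i: "i \<in> {0,1,2}" and t: "0 < t" "t \<le> T" and r: "0 < r" "r < 1"
      and joint: "\<And>j. j \<in> {0,1,2::nat} \<Longrightarrow> ?Y j t r \<le> ?Y i t r"
      and y1: "?Y1 i t r = - \<epsilon> * p t r" and y2: "?Y2 i t r \<le> - \<epsilon> * (c t r - (p t r)\<^sup>2)"
    have pos: "0 < a t r" "0 < b t r" "0 < c t r" using positive[of t r] t r by auto
    have z: "0 \<le> t" "t \<le> T" "0 < r" "r < 1" using t r by auto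
    note eq = a_eq[OF z] codazzi[OF z]
    consider "i = 0" | "i = 1" | "i = 2" using i by auto
    then show "?Yt i t r + \<epsilon> * (a t r * c t r) < 0"
    proof cases
      case 1
      have "b t r \<le> a t r" "c t r \<le> a t r" "a1 t r = - \<epsilon> * p t r" "a2 t r \<le> - \<epsilon> * (c t r - (p t r)\<^sup>2)"
        using 1 y1 y2 joint[of 1] joint[of 2] by simp_all
      from reaction_max_a[OF pos e(1) eq this] 1 show ?thesis by simp
    next
      case 2
      have "a t r \<le> b t r" "b1 t r = - \<epsilon> * p t r" "b2 t r \<le> - \<epsilon> * (c t r - (p t r)\<^sup>2)"
        using 2 y1 y2 joint[of 0] by simp_all
      from reaction_max_b[OF pos e(1) eq this] 2 show ?thesis by simp
    next
      case 3
      have le: "a t r \<le> c t r" "c1 t r = - \<epsilon> * p t r" "c2 t r \<le> - \<epsilon> * (c t r - (p t r)\<^sup>2)"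
        using 3 y1 y2 joint[of 0] by simp_all
      have "(a t r)\<^sup>2 \<le> M\<^sup>2" using M[of t r] pos(1) t r by (intro power_mono) auto
      then have "\<epsilon> * (D + 2 * (a t r)\<^sup>2) \<le> \<epsilon> * (\<bar>D\<bar> + 2 * M\<^sup>2 + 1)"
        using e(1) by (intro mult_left_mono) auto
      also have "\<dots> < m ^ 3"
        using e(2) pos_less_divide_eq[of "\<bar>D\<bar> + 2 * M\<^sup>2 + 1" \<epsilon> "m^3"]
        by (simp add: \<epsilon>0_def add_nonneg_pos)
      also have "\<dots> = m * m * m" by (simp add: power3_eq_cube)
      also have "\<dots> \<le> a t r * b t r * c t r"
        using m(1) m(2)[of t r] pos t r by (intro mult_mono) auto
      also have "\<dots> < 2 * a t r * b t r * c t r" using pos by simp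
      finally have "\<epsilon> * (D + 2 * (a t r)\<^sup>2) < 2 * a t r * b t r * c t r" .
      from reaction_max_c[OF pos e(1) eq le core_bound[OF z] this] 3 show ?thesis by simp
    qed
  qed (use that t r in auto)
  from this[of 0] this[of 1] this[of 2] show ?thesis by simp
qed

section \<open>Lower bounds by comparison with ordinary differential equations\<close>

lemma one_between: "L0 \<le> 1" "1 \<le> K0"
  using outer(1)[of 0] init(1)[of 1] T by simp_all

lemma L0_le_K0: "L0 \<le> K0" using one_between by simp

lemma lower_bound_a:
  assumes t: "0 \<le> t" "t \<le> T" and r: "0 \<le> r" "r \<le> 1"
  shows "L0 / (4 * K0 * L0 * t + 1) \<le> a t r"
proof -
  \<comment> \<open>The solution of y' = -4 K0 y^2 with y(0) = L0; the right-hand side is the decay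
    rate in \<open>reaction_min_a\<close>.\<close>
  define \<eta> where "\<eta> t = L0 / (4 * K0 * L0 * t + 1)" for t :: real
  have K0: "0 < K0" using one_between by simp
  have den: "0 < 4 * K0 * L0 * t + 1" if "0 \<le> t" for t
    using that K0 L0 by (intro add_nonneg_pos mult_nonneg_nonneg) auto
  have \<eta>_pos: "0 < \<eta> t" if "0 \<le> t" for t
    using den[OF that] L0 by (simp add: \<eta>_def)
  obtain m where m: "0 < m" "\<And>t r. 0 \<le> t \<Longrightarrow> t \<le> T \<Longrightarrow> 0 \<le> r \<Longrightarrow> r \<le> 1 \<Longrightarrow> m \<le> a t r \<and> m \<le> b t r \<and> m \<le> c t r"
    using positive_lower_bound by blast
  have d\<eta>: "(\<eta> has_real_derivative - 4 * K0 * (\<eta> t)\<^sup>2) (at t within {0..T})" if "0 \<le> t" for t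
    unfolding \<eta>_def[abs_def] using den[OF that] L0
    by (auto intro!: derivative_eq_intros simp: power2_eq_square)
  let ?at = "\<lambda>t r. a t r * a2 t r + (a t r * (p t r + q t r) + q t r * c t r + p t r * b t r) * a1 t r
         + a t r * (a t r * b t r + a t r * c t r - 4 * b t r * c t r
            + (c t r - a t r) * (q t r)\<^sup>2 + (b t r - a t r) * (p t r)\<^sup>2)"
  have "\<eta> t - a t r \<le> 0"
  proof (rule barrier_principle[where J = "{()}" and Y = "\<lambda>_ t r. \<eta> t - a t r" and ?Y1.0 = "\<lambda>_ t r. - a1 t r"
        and ?Y2.0 = "\<lambda>_ t r. - a2 t r" and Yt = "\<lambda>_ t r. - 4 * K0 * (\<eta> t)\<^sup>2 - ?at t r" and ?\<epsilon>0.0 = "m\<^sup>2 / (2 * K0)"])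
    have "continuous_on {0..T} \<eta>"
      unfolding continuous_on_eq_continuous_within by (auto intro!: DERIV_continuous d\<eta>)
    then have "continuous_on ({0..T} \<times> {0..1::real}) (\<lambda>z. \<eta> (fst z))"
      by (rule continuous_on_compose2) (auto intro!: continuous_intros)
    then show "continuous_on ({0..T} \<times> {0..1}) (\<lambda>(t, r). \<eta> t - a t r)"
      using cont unfolding case_prod_beta by (intro continuous_intros)
  next
    fix t r :: real assume z: "0 \<le> t" "t \<le> T" "0 < r" "r < 1"
    show "((\<lambda>r. \<eta> t - a t r) has_real_derivative h t r * - a1 t r) (at r)"
      using DERIV_diff[OF DERIV_const dr(4)[OF z]] by simp
    show "((\<lambda>r. - a1 t r) has_real_derivative h t r * - a2 t r) (at r)"
      using DERIV_minus[OF dr(5)[OF z]] by simp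
    show "((\<lambda>t. \<eta> t - a t r) has_real_derivative - 4 * K0 * (\<eta> t)\<^sup>2 - ?at t r) (at t within {0..T})"
      by (rule DERIV_diff[OF d\<eta>[OF z(1)] dt_a[OF z]])
  next
    fix r :: real assume "0 \<le> r" "r \<le> 1"
    then show "\<eta> 0 - a 0 r \<le> 0" using init(1)[of r] by (simp add: \<eta>_def)
  next
    fix t :: real assume t: "0 \<le> t" "t \<le> T"
    \<comment> \<open>From L0 \<le> 1 \<le> K0. Thus \<eta> lies below (1 + 4t)^(-1), and so below
      the boundary value (1 + 4t)^(-1/2).\<close>
    have "L0 * (1 + 4 * t) \<le> 4 * K0 * L0 * t + 1"
    proof -
      have "L0 * (4 * t) * 1 \<le> L0 * (4 * t) * K0" using one_between L0 t by (intro mult_left_mono) auto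
      then show ?thesis using one_between by (simp add: algebra_simps)
    qed
    then have "\<eta> t \<le> (1 + 4 * t) powr (-1)"
      using t den[OF t(1)] by (simp add: \<eta>_def powr_minus field_simps)
    also have "\<dots> \<le> (1 + 4 * t) powr (-1/2)" using t by (intro powr_mono) auto
    finally show "\<eta> t - a t 1 \<le> 0" using outer t by simp
  next
    show "0 < m\<^sup>2 / (2 * K0)" using m K0 by simp
  next
    fix \<epsilon> t r :: real
    assume e: "0 < \<epsilon>" "\<epsilon> < m\<^sup>2 / (2 * K0)" and t: "0 < t" "t \<le> T" and r: "0 < r" "r < 1"
      and Y: "0 < \<eta> t - a t r"
      and y1: "- a1 t r = - \<epsilon> * p t r" and y2: "- a2 t r \<le> - \<epsilon> * (c t r - (p t r)\<^sup>2)"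
    have pos: "0 < a t r" "0 < b t r" "0 < c t r" using positive[of t r] t r by auto
    have z: "0 \<le> t" "t \<le> T" "0 < r" "r < 1" using t r by auto
    have K: "b t r \<le> K0" "c t r \<le> K0" using upper_bound[of t r] t r by auto
    have "2 * K0 * \<epsilon> < m\<^sup>2" using e(2) K0 by (simp add: field_simps)
    also have "\<dots> \<le> (a t r)\<^sup>2" using m(1) m(2)[of t r] t r by (intro power_mono) auto
    finally have small: "2 * K0 * \<epsilon> < (a t r)\<^sup>2" .
    have "- 4 * K0 * (a t r)\<^sup>2 + \<epsilon> * (a t r * c t r) < ?at t r"
      by (rule reaction_min_a[OF pos e(1) a_eq[OF z] codazzi[OF z] K _ _ small]) (use y1 y2 in simp_all)
    moreover have "K0 * (a t r)\<^sup>2 \<le> K0 * (\<eta> t)\<^sup>2"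
      using Y K0 pos by (intro mult_left_mono power_mono) auto
    ultimately show "- 4 * K0 * (\<eta> t)\<^sup>2 - ?at t r + \<epsilon> * (a t r * c t r) < 0" by simp
  qed (use t r in auto)
  then show ?thesis by (simp add: \<eta>_def)
qed

lemma exp_decay_le:
  assumes "0 \<le> t"
  shows "L0 * exp (- 4 * K0\<^sup>2 * t) \<le> L0 / (4 * K0 * L0 * t + 1)"
proof -
  have K0: "0 < K0" using one_between by simp
  have "4 * t * K0 * L0 \<le> 4 * t * K0 * K0" using assms K0 L0_le_K0 by (intro mult_left_mono) auto
  then have "4 * K0 * L0 * t + 1 \<le> 1 + 4 * K0\<^sup>2 * t" by (simp add: power2_eq_square algebra_simps)
  also have "\<dots> \<le> exp (4 * K0\<^sup>2 * t)" by (rule exp_ge_add_one_self)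
  finally have "4 * K0 * L0 * t + 1 \<le> exp (4 * K0\<^sup>2 * t)" .
  moreover have "0 < 4 * K0 * L0 * t + 1"
    using assms K0 L0 by (intro add_nonneg_pos mult_nonneg_nonneg) auto
  ultimately have "L0 / exp (4 * K0\<^sup>2 * t) \<le> L0 / (4 * K0 * L0 * t + 1)"
    using L0 by (intro divide_left_mono) auto
  then show ?thesis by (simp add: exp_minus divide_inverse)
qed

lemma exp_lower_bound_a:
  assumes t: "0 \<le> t" "t \<le> T" and r: "0 \<le> r" "r \<le> 1"
  shows "L0 * exp (- 4 * K0\<^sup>2 * t) \<le> a t r"
  using exp_decay_le[OF t(1)] lower_bound_a[OF assms] by (rule order_trans)

text \<open>Shared by \<beta> and \<gamma>. Since \<alpha> already satisfies the exponential bound,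
  a point where X falls below it has X < \<alpha>; \<open>step\<close> may assume this, and it is
  what gives the quadratic terms of the evolution their sign.\<close>

lemma exp_lower_bound:
  fixes X X1 X2 Xt :: "real \<Rightarrow> real \<Rightarrow> real"
  assumes contX: "continuous_on ({0..T} \<times> {0..1}) (\<lambda>(t, r). X t r)"
    and dX: "\<And>t r. 0 \<le> t \<Longrightarrow> t \<le> T \<Longrightarrow> 0 < r \<Longrightarrow> r < 1 \<Longrightarrow> (X t has_real_derivative h t r * X1 t r) (at r)"
      "\<And>t r. 0 \<le> t \<Longrightarrow> t \<le> T \<Longrightarrow> 0 < r \<Longrightarrow> r < 1 \<Longrightarrow> (X1 t has_real_derivative h t r * X2 t r) (at r)"
      "\<And>t r. 0 \<le> t \<Longrightarrow> t \<le> T \<Longrightarrow> 0 < r \<Longrightarrow> r < 1 \<Longrightarrow> ((\<lambda>\<tau>. X \<tau> r) has_real_derivative Xt t r) (at t within {0..T})"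
    and initX: "\<And>r. 0 \<le> r \<Longrightarrow> r \<le> 1 \<Longrightarrow> L0 \<le> X 0 r"
    and outerX: "\<And>t. 0 \<le> t \<Longrightarrow> t \<le> T \<Longrightarrow> X t 1 = a t 1"
    and \<epsilon>0: "0 < \<epsilon>0"
    and step: "\<And>\<epsilon> t r. 0 < \<epsilon> \<Longrightarrow> \<epsilon> < \<epsilon>0 \<Longrightarrow> 0 \<le> t \<Longrightarrow> t \<le> T \<Longrightarrow> 0 < r \<Longrightarrow> r < 1 \<Longrightarrow> X t r < a t r \<Longrightarrow>
      X1 t r = \<epsilon> * p t r \<Longrightarrow> \<epsilon> * (c t r - (p t r)\<^sup>2) \<le> X2 t r \<Longrightarrow>
      \<epsilon> * (a t r * c t r) - 4 * K0\<^sup>2 * X t r < Xt t r"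
    and t: "0 \<le> t" "t \<le> T" and r: "0 \<le> r" "r \<le> 1"
  shows "L0 * exp (- 4 * K0\<^sup>2 * t) \<le> X t r"
proof -
  define m where "m t = L0 * exp (- 4 * K0\<^sup>2 * t)" for t
  have K0: "0 < K0" using one_between by simp
  have dm: "(m has_real_derivative - 4 * K0\<^sup>2 * m t) (at t within {0..T})" for t
    unfolding m_def[abs_def] by (auto intro!: derivative_eq_intros)
  have "m t - X t r \<le> 0"
  proof (rule barrier_principle[where J = "{()}" and Y = "\<lambda>_ t r. m t - X t r" and ?Y1.0 = "\<lambda>_ t r. - X1 t r"
        and ?Y2.0 = "\<lambda>_ t r. - X2 t r" and Yt = "\<lambda>_ t r. - 4 * K0\<^sup>2 * m t - Xt t r", OF _ _ _ _ _ _ _ \<epsilon>0])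
    show "continuous_on ({0..T} \<times> {0..1}) (\<lambda>(t, r). m t - X t r)"
      using contX unfolding case_prod_beta m_def by (intro continuous_intros)
  next
    fix t r :: real assume z: "0 \<le> t" "t \<le> T" "0 < r" "r < 1"
    show "((\<lambda>r. m t - X t r) has_real_derivative h t r * - X1 t r) (at r)"
      using DERIV_diff[OF DERIV_const dX(1)[OF z]] by simp
    show "((\<lambda>r. - X1 t r) has_real_derivative h t r * - X2 t r) (at r)"
      using DERIV_minus[OF dX(2)[OF z]] by simp
    show "((\<lambda>t. m t - X t r) has_real_derivative - 4 * K0\<^sup>2 * m t - Xt t r) (at t within {0..T})"
      by (rule DERIV_diff[OF dm dX(3)[OF z]])
  next
    fix r :: real assume "0 \<le> r" "r \<le> 1"
    then show "m 0 - X 0 r \<le> 0" using initX[of r] by (simp add: m_def)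
  next
    fix t :: real assume t: "0 \<le> t" "t \<le> T"
    then show "m t - X t 1 \<le> 0" using exp_lower_bound_a[of t 1] outerX by (simp add: m_def)
  next
    fix \<epsilon> t r :: real
    assume e: "0 < \<epsilon>" "\<epsilon> < \<epsilon>0" and t: "0 < t" "t \<le> T" and r: "0 < r" "r < 1"
      and Y: "0 < m t - X t r"
      and y1: "- X1 t r = - \<epsilon> * p t r" and y2: "- X2 t r \<le> - \<epsilon> * (c t r - (p t r)\<^sup>2)"
    have "\<epsilon> * (a t r * c t r) - 4 * K0\<^sup>2 * X t r < Xt t r"
      using y1 y2 Y exp_lower_bound_a[of t r] t r by (intro step[OF e]) (auto simp: m_def)
    moreover have "K0\<^sup>2 * X t r \<le> K0\<^sup>2 * m t" using Y by (intro mult_left_mono) auto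
    ultimately show "- 4 * K0\<^sup>2 * m t - Xt t r + \<epsilon> * (a t r * c t r) < 0" by simp
  qed (use t r in auto)
  then show ?thesis by (simp add: m_def)
qed

text \<open>Bounds the loss 2 \<alpha>\<beta>\<gamma> by 2 K0^2 times \<beta> or \<gamma>, half of
  the decay rate allowed in \<open>exp_lower_bound\<close>.\<close>

lemma curvature_product_le:
  assumes t: "0 \<le> t" "t \<le> T" and r: "0 \<le> r" "r \<le> 1"
  shows "a t r * b t r * c t r \<le> K0\<^sup>2 * b t r" "a t r * b t r * c t r \<le> K0\<^sup>2 * c t r"
proof -
  note u = upper_bound[OF assms] and pos = positive[OF assms]
  have "a t r * c t r \<le> K0 * K0" "a t r * b t r \<le> K0 * K0" using u pos by (auto intro!: mult_mono)
  then have "a t r * c t r * b t r \<le> K0 * K0 * b t r" "a t r * b t r * c t r \<le> K0 * K0 * c t r"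
    using pos by (auto intro: mult_right_mono)
  then show "a t r * b t r * c t r \<le> K0\<^sup>2 * b t r" "a t r * b t r * c t r \<le> K0\<^sup>2 * c t r"
    by (simp_all add: power2_eq_square mult_ac)
qed

lemma lower_bound_b:
  assumes t: "0 \<le> t" "t \<le> T" and r: "0 \<le> r" "r \<le> 1"
  shows "L0 * exp (- 4 * K0\<^sup>2 * t) \<le> b t r"
proof -
  obtain m where m: "0 < m" "\<And>t r. 0 \<le> t \<Longrightarrow> t \<le> T \<Longrightarrow> 0 \<le> r \<Longrightarrow> r \<le> 1 \<Longrightarrow> m \<le> a t r \<and> m \<le> b t r \<and> m \<le> c t r"
    using positive_lower_bound by blast
  \<comment> \<open>With -\<epsilon> in \<open>reaction_b\<close> the quadratic term has the factor
    2 b - 3 \<epsilon>, which must stay nonnegative.\<close>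
  have \<epsilon>0: "0 < 2 * m / 3" using m by simp
  show ?thesis
  proof (rule exp_lower_bound[OF cont(2) dr(6) dr(7) dt_b _ _ \<epsilon>0])
    fix \<epsilon> t r :: real
    assume e: "0 < \<epsilon>" "\<epsilon> < 2 * m / 3" and z: "0 \<le> t" "t \<le> T" "0 < r" "r < 1"
      and le: "b t r < a t r"
      and b1: "b1 t r = \<epsilon> * p t r" and b2: "\<epsilon> * (c t r - (p t r)\<^sup>2) \<le> b2 t r"
    have z': "0 \<le> r" "r \<le> 1" using z by auto
    have pos: "0 < a t r" "0 < b t r" "0 < c t r" using positive[OF z(1,2) z'] by auto
    have "0 \<le> a t r * (b2 t r - \<epsilon> * (c t r - (p t r)\<^sup>2))" using b2 pos by simp
    moreover have "0 \<le> (2 * b t r - 3 * \<epsilon>) * ((a t r - b t r) * (p t r)\<^sup>2)"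
      using m(2)[OF z(1,2) z'] e le by (intro mult_nonneg_nonneg) auto
    then have "(- 3 * \<epsilon> + 2 * b t r) * ((b t r - a t r) * (p t r)\<^sup>2) \<le> 0" by (simp add: algebra_simps)
    moreover have "0 < K0\<^sup>2 * b t r" using pos one_between by simp
    moreover have "0 < \<epsilon> * a t r * c t r" using pos e by simp
    ultimately show "\<epsilon> * (a t r * c t r) - 4 * K0\<^sup>2 * b t r
       < a t r * b2 t r + (2 * a1 t r + b t r * p t r + 2 * q t r * a t r - q t r * c t r) * b1 t r
         - 2 * b t r * (b t r - a t r) * (p t r)\<^sup>2 - 2 * a t r * b t r * c t r"
      using curvature_product_le(1)[OF z(1,2) z'] reaction_b[OF a_eq[OF z] codazzi[OF z], of "b1 t r" "- \<epsilon>" "b2 t r"] b1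
      by simp
  qed (use init outer t r in auto)
qed

lemma lower_bound_c:
  assumes t: "0 \<le> t" "t \<le> T" and r: "0 \<le> r" "r \<le> 1"
  shows "L0 * exp (- 4 * K0\<^sup>2 * t) \<le> c t r"
proof -
  obtain m where m: "0 < m" "\<And>t r. 0 \<le> t \<Longrightarrow> t \<le> T \<Longrightarrow> 0 \<le> r \<Longrightarrow> r \<le> 1 \<Longrightarrow> m \<le> a t r \<and> m \<le> b t r \<and> m \<le> c t r"
    using positive_lower_bound by blast
  have K0: "0 < K0" using one_between by simp
  define \<epsilon>0 where "\<epsilon>0 = K0\<^sup>2 * m / (\<bar>D\<bar> + 2 * K0\<^sup>2 + 1)"
  have \<epsilon>0: "0 < \<epsilon>0" using m K0 by (auto simp: \<epsilon>0_def intro!: divide_pos_pos add_nonneg_pos)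
  show ?thesis
  proof (rule exp_lower_bound[OF cont(3) dr(8) dr(9) dt_c _ _ \<epsilon>0])
    fix \<epsilon> t r :: real
    assume e: "0 < \<epsilon>" "\<epsilon> < \<epsilon>0" and z: "0 \<le> t" "t \<le> T" "0 < r" "r < 1"
      and le: "c t r < a t r"
      and c1: "c1 t r = \<epsilon> * p t r" and c2: "\<epsilon> * (c t r - (p t r)\<^sup>2) \<le> c2 t r"
    have z': "0 \<le> r" "r \<le> 1" using z by auto
    have pos: "0 < a t r" "0 < b t r" "0 < c t r" using positive[OF z(1,2) z'] by auto
    have "0 \<le> a t r * (c2 t r - \<epsilon> * (c t r - (p t r)\<^sup>2))" using c2 pos by simp
    moreover have "0 \<le> 2 * c t r * (a t r - c t r) * (q t r)\<^sup>2" using pos le by simp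
    then have "2 * c t r * (c t r - a t r) * (q t r)\<^sup>2 \<le> 0" by (simp add: algebra_simps)
    moreover have "- (\<epsilon> * ((b t r - a t r) * (p t r)\<^sup>2)) + 2 * \<epsilon> * (a t r)\<^sup>2 < K0\<^sup>2 * c t r"
    proof -
      have "- (b t r - a t r) * (p t r)\<^sup>2 \<le> \<bar>b t r - a t r\<bar> * (p t r)\<^sup>2" by (intro mult_right_mono) auto
      also have "\<dots> \<le> \<bar>D\<bar>" using core_bound[OF z] by simp
      finally have "- (b t r - a t r) * (p t r)\<^sup>2 \<le> \<bar>D\<bar>" .
      moreover have "(a t r)\<^sup>2 \<le> K0\<^sup>2" using upper_bound[OF z(1,2) z'] pos by (intro power_mono) auto
      ultimately have "\<epsilon> * (- (b t r - a t r) * (p t r)\<^sup>2 + 2 * (a t r)\<^sup>2) \<le> \<epsilon> * (\<bar>D\<bar> + 2 * K0\<^sup>2 + 1)"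
        using e(1) by (intro mult_left_mono) auto
      also have "\<dots> < K0\<^sup>2 * m"
        using e(2) pos_less_divide_eq[of "\<bar>D\<bar> + 2 * K0\<^sup>2 + 1" \<epsilon> "K0\<^sup>2 * m"]
        by (simp add: \<epsilon>0_def add_nonneg_pos)
      also have "\<dots> \<le> K0\<^sup>2 * c t r" using m(2)[OF z(1,2) z'] by (intro mult_left_mono) auto
      finally show ?thesis by (simp add: algebra_simps)
    qed
    moreover have "0 < \<epsilon> * a t r * c t r" "0 < K0\<^sup>2 * c t r" using pos e K0 by simp_all
    ultimately show "\<epsilon> * (a t r * c t r) - 4 * K0\<^sup>2 * c t r
       < a t r * c2 t r + (2 * a1 t r + c t r * q t r + 2 * p t r * a t r - p t r * b t r) * c1 t r
         - 2 * c t r * (c t r - a t r) * (q t r)\<^sup>2 - 2 * a t r * b t r * c t r"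
      using curvature_product_le(2)[OF z(1,2) z'] reaction_c[OF a_eq[OF z] codazzi[OF z], of "c1 t r" "- \<epsilon>" "c2 t r"] c1
      by simp
  qed (use init outer t r in auto)
qed

end

section \<open>Radial quotients and mixed derivatives\<close>

text \<open>Hadamard's lemma with a parameter: the quotient is the integral of
  \<open>K' t (x * r)\<close> over x in [0, 1], also at r = 0, and such an integral depends
  continuously on (t, r) jointly.\<close>

lemma continuous_on_radial_quotient:
  fixes K K' :: "real \<Rightarrow> real \<Rightarrow> real"
  assumes d: "\<And>t r. t \<in> S \<Longrightarrow> r \<in> {0..1} \<Longrightarrow> (K t has_real_derivative K' t r) (at r within {0..1})"
    and zero: "\<And>t. t \<in> S \<Longrightarrow> K t 0 = 0"
    and cont: "continuous_on (S \<times> {0..1}) (\<lambda>(t, r). K' t r)"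
  shows "continuous_on (S \<times> {0..1}) (\<lambda>(t, r). if r = 0 then K' t 0 else K t r / r)"
proof -
  have "continuous_on ((S \<times> {0..1}) \<times> cbox 0 (1::real)) (\<lambda>y. (fst (fst y), snd y * snd (fst y)))"
    by (intro continuous_intros)
  moreover have "(\<lambda>y. (fst (fst y), snd y * snd (fst y))) ` ((S \<times> {0..1}) \<times> cbox 0 1) \<subseteq> S \<times> {0..1::real}"
    by (auto intro: mult_le_one)
  ultimately have "continuous_on ((S \<times> {0..1}) \<times> cbox 0 1) (\<lambda>y. K' (fst (fst y)) (snd y * snd (fst y)))"
    using continuous_on_compose2[OF cont, of _ "\<lambda>y. (fst (fst y), snd y * snd (fst y))"] by simp
  then have "continuous_on (S \<times> {0..1}) (\<lambda>z. integral (cbox 0 1) (\<lambda>x. K' (fst z) (x * snd z)))"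
    by (intro integral_continuous_on_param) (simp add: case_prod_beta)
  moreover have "integral (cbox 0 1) (\<lambda>x. K' (fst z) (x * snd z)) = (\<lambda>(t, r). if r = 0 then K' t 0 else K t r / r) z"
    if z: "z \<in> S \<times> {0..1}" for z
  proof (cases "snd z = 0")
    case False
    obtain t r where z': "z = (t, r)" "t \<in> S" "0 < r" "r \<le> 1" using z False by (cases z) auto
    have "((\<lambda>x. K t (x * r) / r) has_vector_derivative K' t (x * r)) (at x within {0..1})" if x: "x \<in> {0..1}" for x
    proof -
      have "((\<lambda>x. x * r) has_real_derivative r) (at x within {0..1})" by (auto intro!: derivative_eq_intros)
      moreover have "(K t has_real_derivative K' t (x * r)) (at (x * r) within (\<lambda>x. x * r) ` {0..1})"
        by (rule DERIV_subset[OF d]) (use z' x in \<open>auto intro!: mult_le_one\<close>)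
      ultimately have "((\<lambda>x. K t (x * r)) has_real_derivative K' t (x * r) * r) (at x within {0..1})"
        using DERIV_image_chain[of "K t" "K' t (x * r)" "\<lambda>x. x * r" x "{0..1}" r] by (simp add: o_def)
      then have "((\<lambda>x. K t (x * r) / r) has_real_derivative K' t (x * r) * r / r) (at x within {0..1})"
        by (rule DERIV_cdivide)
      then show ?thesis using z' by (simp add: has_real_derivative_iff_has_vector_derivative)
    qed
    then have "((\<lambda>x. K' t (x * r)) has_integral (K t (1 * r) / r - K t (0 * r) / r)) {0..1}"
      by (intro fundamental_theorem_of_calculus) auto
    then show ?thesis using z' zero by (simp add: integral_unique)
  qed (use z in \<open>auto simp: case_prod_beta\<close>)
  ultimately show ?thesis
    by (rule continuous_on_eq)
qed

text \<open>The factor \<sigma> is 1 for even and -1 for odd functions, so that iteration alternates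
  between the two.\<close>

lemma derivative_parity:
  fixes K K' :: "real \<Rightarrow> real"
  assumes d: "\<And>r. r \<in> {-1..1} \<Longrightarrow> (K has_real_derivative K' r) (at r within {-1..1})"
    and parity: "\<And>r. r \<in> {-1..1} \<Longrightarrow> K (- r) = \<sigma> * K r"
    and r: "r \<in> {-1..1}"
  shows "K' (- r) = - \<sigma> * K' r"
proof -
  have "((\<lambda>x. K (- x)) has_real_derivative K' (- r) * (-1)) (at r within {-1..1})"
  proof -
    have "(uminus ` {-1..1::real}) = {-1..1}" by auto
    then have "(K has_real_derivative K' (- r)) (at (- r) within uminus ` {-1..1})" using d[of "- r"] r by simp
    moreover have "(uminus has_real_derivative -1) (at r within {-1..1})" by (auto intro!: derivative_eq_intros)
    ultimately show ?thesis using DERIV_image_chain[of K "K' (- r)" uminus r "{-1..1}" "-1"] by (simp add: o_def)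
  qed
  then have "((\<lambda>x. \<sigma> * K x) has_real_derivative K' (- r) * (-1)) (at r within {-1..1})"
    by (rule has_field_derivative_transform_within[OF _ zero_less_one r]) (use parity in auto)
  moreover have "((\<lambda>x. \<sigma> * K x) has_real_derivative \<sigma> * K' r) (at r within {-1..1})"
    using d[OF r] by (rule DERIV_cmult)
  moreover have "at r within {-1..1} \<noteq> bot" using r by (simp add: trivial_limit_within)
  ultimately have "K' (- r) * (-1) = \<sigma> * K' r" by (rule has_field_derivative_unique)
  then show ?thesis by simp
qed

text \<open>The last two clauses say that both orders of mixed differentiation give the same
  \<open>Krt\<close>. This is built into the derivatives of a smooth family and passes to products
  and inverses, so the commutator argument for p and q needs no separate theorem on mixed
  partials.\<close>

definition has_mixed ::
  "real set \<Rightarrow> (real \<Rightarrow> real \<Rightarrow> real) \<Rightarrow> (real \<Rightarrow> real \<Rightarrow> real) \<Rightarrow> (real \<Rightarrow> real \<Rightarrow> real) \<Rightarrow> (real \<Rightarrow> real \<Rightarrow> real) \<Rightarrow> bool"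
where
  "has_mixed I K Kr Kt Krt \<longleftrightarrow> (\<forall>t\<in>I. \<forall>r. 0 < r \<and> r < 1 \<longrightarrow>
     (K t has_real_derivative Kr t r) (at r) \<and> ((\<lambda>\<tau>. K \<tau> r) has_real_derivative Kt t r) (at t within I) \<and>
     ((\<lambda>\<tau>. Kr \<tau> r) has_real_derivative Krt t r) (at t within I) \<and> (Kt t has_real_derivative Krt t r) (at r))"

lemma has_mixedD:
  assumes "has_mixed I K Kr Kt Krt" "t \<in> I" "0 < r" "r < 1"
  shows "(K t has_real_derivative Kr t r) (at r)" "((\<lambda>\<tau>. K \<tau> r) has_real_derivative Kt t r) (at t within I)"
     "((\<lambda>\<tau>. Kr \<tau> r) has_real_derivative Krt t r) (at t within I)" "(Kt t has_real_derivative Krt t r) (at r)"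
  using assms by (auto simp: has_mixed_def)

lemma has_mixed_mult:
  assumes K: "has_mixed I K Kr Kt Krt" and L: "has_mixed I L Lr Lt Lrt"
  shows "has_mixed I (\<lambda>t r. K t r * L t r) (\<lambda>t r. Kr t r * L t r + Lr t r * K t r) (\<lambda>t r. Kt t r * L t r + Lt t r * K t r)
    (\<lambda>t r. Krt t r * L t r + Lt t r * Kr t r + (Lrt t r * K t r + Kt t r * Lr t r))"
  unfolding has_mixed_def
proof (intro ballI allI impI)
  fix t r :: real assume z: "t \<in> I" "0 < r \<and> r < 1"
  note K = has_mixedD[OF K, of t r] and L = has_mixedD[OF L, of t r]
  show "((\<lambda>r. K t r * L t r) has_real_derivative Kr t r * L t r + Lr t r * K t r) (at r) \<and>
       ((\<lambda>\<tau>. K \<tau> r * L \<tau> r) has_real_derivative Kt t r * L t r + Lt t r * K t r) (at t within I) \<and>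
       ((\<lambda>\<tau>. Kr \<tau> r * L \<tau> r + Lr \<tau> r * K \<tau> r) has_real_derivative
         Krt t r * L t r + Lt t r * Kr t r + (Lrt t r * K t r + Kt t r * Lr t r)) (at t within I) \<and>
       ((\<lambda>r. Kt t r * L t r + Lt t r * K t r) has_real_derivative
         Krt t r * L t r + Lt t r * Kr t r + (Lrt t r * K t r + Kt t r * Lr t r)) (at r)"
    using K L z by (intro conjI) (auto intro!: derivative_eq_intros)
qed

lemma has_mixed_inverse:
  assumes K: "has_mixed I K Kr Kt Krt" and nz: "\<And>t r. t \<in> I \<Longrightarrow> 0 < r \<Longrightarrow> r < 1 \<Longrightarrow> K t r \<noteq> 0"
  shows "has_mixed I (\<lambda>t r. inverse (K t r)) (\<lambda>t r. - Kr t r / (K t r)\<^sup>2) (\<lambda>t r. - Kt t r / (K t r)\<^sup>2)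
    (\<lambda>t r. 2 * Kr t r * Kt t r / (K t r)^3 - Krt t r / (K t r)\<^sup>2)"
  unfolding has_mixed_def
proof (intro ballI allI impI)
  fix t r :: real assume z: "t \<in> I" "0 < r \<and> r < 1"
  note K = has_mixedD[OF K, of t r]
  have "K t r \<noteq> 0" using nz z by auto
  then show "((\<lambda>r. inverse (K t r)) has_real_derivative - Kr t r / (K t r)\<^sup>2) (at r) \<and>
       ((\<lambda>\<tau>. inverse (K \<tau> r)) has_real_derivative - Kt t r / (K t r)\<^sup>2) (at t within I) \<and>
       ((\<lambda>\<tau>. - Kr \<tau> r / (K \<tau> r)\<^sup>2) has_real_derivative
         2 * Kr t r * Kt t r / (K t r)^3 - Krt t r / (K t r)\<^sup>2) (at t within I) \<and>
       ((\<lambda>r. - Kt t r / (K t r)\<^sup>2) has_real_derivative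
         2 * Kr t r * Kt t r / (K t r)^3 - Krt t r / (K t r)\<^sup>2) (at r)"
    using K z by (intro conjI) (auto intro!: derivative_eq_intros simp: field_simps power2_eq_square power3_eq_cube)
qed

text \<open>Existence only: the s-derivatives of \<beta> and \<gamma> can then be taken with
  \<open>deriv\<close>, and their long explicit formulas never appear.\<close>

definition twice_differentiable :: "(real \<Rightarrow> real) \<Rightarrow> bool" where
  "twice_differentiable K \<longleftrightarrow> (\<exists>K' K''. \<forall>r. 0 < r \<and> r < 1 \<longrightarrow>
     (K has_real_derivative K' r) (at r) \<and> (K' has_real_derivative K'' r) (at r))"

lemma twice_differentiableI:
  assumes "\<And>r. 0 < r \<Longrightarrow> r < 1 \<Longrightarrow> (K has_real_derivative K' r) (at r)"
    "\<And>r. 0 < r \<Longrightarrow> r < 1 \<Longrightarrow> (K' has_real_derivative K'' r) (at r)"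
  shows "twice_differentiable K"
  unfolding twice_differentiable_def using assms by blast

lemma twice_differentiable_mult: assumes "twice_differentiable K" "twice_differentiable L" shows "twice_differentiable (\<lambda>r. K r * L r)"
proof -
  obtain K' K'' where K: "\<And>r. 0 < r \<Longrightarrow> r < 1 \<Longrightarrow> (K has_real_derivative K' r) (at r)"
    "\<And>r. 0 < r \<Longrightarrow> r < 1 \<Longrightarrow> (K' has_real_derivative K'' r) (at r)" using assms(1) unfolding twice_differentiable_def by blast
  obtain L' L'' where L: "\<And>r. 0 < r \<Longrightarrow> r < 1 \<Longrightarrow> (L has_real_derivative L' r) (at r)"
    "\<And>r. 0 < r \<Longrightarrow> r < 1 \<Longrightarrow> (L' has_real_derivative L'' r) (at r)" using assms(2) unfolding twice_differentiable_def by blast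
  show ?thesis
    by (rule twice_differentiableI[where K' = "\<lambda>r. K' r * L r + L' r * K r" and
        K'' = "\<lambda>r. K'' r * L r + L' r * K' r + (L'' r * K r + K' r * L' r)"])
       (intro DERIV_add DERIV_mult K L; assumption)+
qed

lemma twice_differentiable_diff: assumes "twice_differentiable K" "twice_differentiable L" shows "twice_differentiable (\<lambda>r. K r - L r)"
proof -
  obtain K' K'' where K: "\<And>r. 0 < r \<Longrightarrow> r < 1 \<Longrightarrow> (K has_real_derivative K' r) (at r)"
    "\<And>r. 0 < r \<Longrightarrow> r < 1 \<Longrightarrow> (K' has_real_derivative K'' r) (at r)" using assms(1) unfolding twice_differentiable_def by blast
  obtain L' L'' where L: "\<And>r. 0 < r \<Longrightarrow> r < 1 \<Longrightarrow> (L has_real_derivative L' r) (at r)"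
    "\<And>r. 0 < r \<Longrightarrow> r < 1 \<Longrightarrow> (L' has_real_derivative L'' r) (at r)" using assms(2) unfolding twice_differentiable_def by blast
  show ?thesis
    by (rule twice_differentiableI[where K' = "\<lambda>r. K' r - L' r" and K'' = "\<lambda>r. K'' r - L'' r"])
       (intro DERIV_diff K L; assumption)+
qed

lemma twice_differentiable_inverse:
  assumes "twice_differentiable K" and nz: "\<And>r. 0 < r \<Longrightarrow> r < 1 \<Longrightarrow> K r \<noteq> 0" shows "twice_differentiable (\<lambda>r. inverse (K r))"
proof -
  obtain K' K'' where K: "\<And>r. 0 < r \<Longrightarrow> r < 1 \<Longrightarrow> (K has_real_derivative K' r) (at r)"
    "\<And>r. 0 < r \<Longrightarrow> r < 1 \<Longrightarrow> (K' has_real_derivative K'' r) (at r)" using assms(1) unfolding twice_differentiable_def by blast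
  show ?thesis
    by (rule twice_differentiableI[where K' = "\<lambda>r. - K' r / (K r)\<^sup>2" and K'' = "\<lambda>r. 2 * K' r * K' r / (K r)^3 - K'' r / (K r)\<^sup>2"])
       (use nz in \<open>auto intro!: derivative_eq_intros K simp: field_simps power2_eq_square power3_eq_cube\<close>)
qed

lemma twice_differentiable_cong: assumes "twice_differentiable K" "\<And>r. 0 < r \<Longrightarrow> r < 1 \<Longrightarrow> K r = L r" shows "twice_differentiable L"
proof -
  obtain K' K'' where K: "\<And>r. 0 < r \<Longrightarrow> r < 1 \<Longrightarrow> (K has_real_derivative K' r) (at r)"
    "\<And>r. 0 < r \<Longrightarrow> r < 1 \<Longrightarrow> (K' has_real_derivative K'' r) (at r)" using assms(1) unfolding twice_differentiable_def by blast
  show ?thesis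
  proof (rule twice_differentiableI[OF _ K(2)])
    fix r :: real assume "0 < r" "r < 1"
    then show "(L has_real_derivative K' r) (at r)"
      using assms(2) by (intro has_field_derivative_transform_within_open[OF K(1), where S = "{0<..<1}"]) auto
  qed
qed

lemma twice_differentiable_deriv:
  assumes "twice_differentiable K" "0 < r" "r < 1"
  shows "(K has_real_derivative deriv K r) (at r)" "(deriv K has_real_derivative deriv (deriv K) r) (at r)"
proof -
  obtain K' K'' where K: "\<And>r. 0 < r \<Longrightarrow> r < 1 \<Longrightarrow> (K has_real_derivative K' r) (at r)"
    "\<And>r. 0 < r \<Longrightarrow> r < 1 \<Longrightarrow> (K' has_real_derivative K'' r) (at r)" using assms(1) unfolding twice_differentiable_def by blast
  have eq: "K' x = deriv K x" if "0 < x" "x < 1" for x using DERIV_imp_deriv[OF K(1)] that by simp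
  show "(K has_real_derivative deriv K r) (at r)" using K(1) eq assms by simp
  have "(deriv K has_real_derivative K'' r) (at r)"
    by (rule has_field_derivative_transform_within_open[OF K(2), where S = "{0<..<1}"]) (use assms eq in auto)
  then show "(deriv K has_real_derivative deriv (deriv K) r) (at r)" using DERIV_imp_deriv by metis
qed

text \<open>The left-hand side is p_t q + p q_t with p_t = (\<alpha>\<gamma>)_s - \<beta>\<gamma> p
  and q_t = (\<alpha>\<beta>)_s - \<beta>\<gamma> q.\<close>

lemma evolution_a_identity:
  fixes a b c p q a1 a2 b1 c1 :: real
  assumes a: "a = p * q" and a1: "a1 = (c - a) * q + (b - a) * p"
    and a2: "a2 = (c1 - a1) * q + (c - a) * (b - q\<^sup>2) + (b1 - a1) * p + (b - a) * (c - p\<^sup>2)"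
  shows "(a1 * c + a * c1 - b * c * p) * q + p * (a1 * b + a * b1 - b * c * q)
    = a * a2 + (a * (p + q) + q * c + p * b) * a1
         + a * (a * b + a * c - 4 * b * c + (c - a) * q\<^sup>2 + (b - a) * p\<^sup>2)"
  unfolding a2 a1 a by (simp add: algebra_simps power2_eq_square)

text \<open>The left-hand side is \<gamma>_t obtained from \<gamma> = p_s + p^2: the terms are
  (\<alpha>\<gamma>)_ss - (\<beta>\<gamma>)_s p - 2 \<beta>\<gamma> p_s + 2 p p_t, with p_s = c -
  p^2.\<close>

lemma evolution_c_identity:
  fixes a b c p q a1 a2 b1 c1 c2 :: real
  assumes a: "a = p * q" and a1: "a1 = (c - a) * q + (b - a) * p"
    and a2: "a2 = (c1 - a1) * q + (c - a) * (b - q\<^sup>2) + (b1 - a1) * p + (b - a) * (c - p\<^sup>2)"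
  shows "a2 * c + 2 * a1 * c1 + a * c2 - b1 * c * p - b * c1 * p - 2 * b * c * (c - p\<^sup>2)
      + 2 * p * (a1 * c + a * c1 - b * c * p)
    = a * c2 + (2 * a1 + c * q + 2 * p * a - p * b) * c1 - 2 * c * (c - a) * q\<^sup>2 - 2 * a * b * c"
  unfolding a2 a1 a by (simp add: algebra_simps power2_eq_square)

section \<open>Regularity of the curvatures up to the core\<close>

text \<open>\<open>F i j\<close> is the derivative of order \<open>i\<close> in \<open>r\<close> and \<open>j\<close> in \<open>t\<close> of the odd extension of \<open>f\<close>;
  similarly for the even extensions of \<open>g\<close>, \<open>h\<close>.\<close>

locale rot_flow =
  fixes I :: "real set" and f g h :: "real \<Rightarrow> real \<Rightarrow> real" and F G H :: "nat \<Rightarrow> nat \<Rightarrow> real \<Rightarrow> real \<Rightarrow> real"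
  assumes I: "is_interval I" "0 \<in> I" "\<And>t. t \<in> I \<Longrightarrow> 0 \<le> t" "I \<noteq> {0}"
    and FGH: "\<And>t r. t \<in> I \<Longrightarrow> 0 \<le> r \<Longrightarrow> r \<le> 1 \<Longrightarrow> F 0 0 t r = f t r \<and> G 0 0 t r = g t r \<and> H 0 0 t r = h t r"
    and cont: "\<And>i j. continuous_on (I \<times> {-1..1}) (\<lambda>(t, r). F i j t r)"
      "\<And>i j. continuous_on (I \<times> {-1..1}) (\<lambda>(t, r). G i j t r)"
      "\<And>i j. continuous_on (I \<times> {-1..1}) (\<lambda>(t, r). H i j t r)"
    and dr: "\<And>i j t r. t \<in> I \<Longrightarrow> r \<in> {-1..1} \<Longrightarrow> (F i j t has_real_derivative F (Suc i) j t r) (at r within {-1..1})"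
      "\<And>i j t r. t \<in> I \<Longrightarrow> r \<in> {-1..1} \<Longrightarrow> (G i j t has_real_derivative G (Suc i) j t r) (at r within {-1..1})"
      "\<And>i j t r. t \<in> I \<Longrightarrow> r \<in> {-1..1} \<Longrightarrow> (H i j t has_real_derivative H (Suc i) j t r) (at r within {-1..1})"
    and dt: "\<And>i j t r. t \<in> I \<Longrightarrow> r \<in> {-1..1} \<Longrightarrow> ((\<lambda>\<tau>. F i j \<tau> r) has_real_derivative F i (Suc j) t r) (at t within I)"
      "\<And>i j t r. t \<in> I \<Longrightarrow> r \<in> {-1..1} \<Longrightarrow> ((\<lambda>\<tau>. G i j \<tau> r) has_real_derivative G i (Suc j) t r) (at t within I)"
      "\<And>i j t r. t \<in> I \<Longrightarrow> r \<in> {-1..1} \<Longrightarrow> ((\<lambda>\<tau>. H i j \<tau> r) has_real_derivative H i (Suc j) t r) (at t within I)"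
    and parity: "\<And>t r. t \<in> I \<Longrightarrow> r \<in> {-1..1} \<Longrightarrow> F 0 0 t (- r) = - F 0 0 t r"
      "\<And>t r. t \<in> I \<Longrightarrow> r \<in> {-1..1} \<Longrightarrow> G 0 0 t (- r) = G 0 0 t r"
      "\<And>t r. t \<in> I \<Longrightarrow> r \<in> {-1..1} \<Longrightarrow> H 0 0 t (- r) = H 0 0 t r"
    and pos: "\<And>t r. t \<in> I \<Longrightarrow> 0 < r \<Longrightarrow> r \<le> 1 \<Longrightarrow> 0 < F 0 0 t r"
      "\<And>t r. t \<in> I \<Longrightarrow> 0 \<le> r \<Longrightarrow> r \<le> 1 \<Longrightarrow> 0 < G 0 0 t r"
      "\<And>t r. t \<in> I \<Longrightarrow> 0 \<le> r \<Longrightarrow> r \<le> 1 \<Longrightarrow> 0 < H 0 0 t r"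
    and core_slope: "\<And>t. t \<in> I \<Longrightarrow> 0 < F 1 0 t 0"
    and ccf: "\<And>t x i j. t \<in> I \<Longrightarrow> x \<in> chart \<Longrightarrow>
      ((\<lambda>\<tau>. rot_metric (f \<tau>) (g \<tau>) (h \<tau>) x $ i $ j) has_real_derivative
           - 2 * cross_curvature chart (rot_metric (f t) (g t) (h t)) i j x) (at t within I)"
    and bc: "boundary_conditions I f g h"
begin

lemma interval_I: "t \<in> I \<Longrightarrow> 0 \<le> s \<Longrightarrow> s \<le> t \<Longrightarrow> s \<in> I"
  using I(1,2) unfolding is_interval_1 by blast

text \<open>An interval with more than one point has no isolated points, so derivatives within
  \<open>I\<close> are unique. This is where \<open>I \<noteq> {0}\<close> enters.\<close>

lemma nontrivial_at: "t \<in> I \<Longrightarrow> at t within I \<noteq> bot"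
  using connected_imp_perfect[of I t] I is_interval_connected[of I]
  by (metis empty_iff is_singletonE is_singletonI' singletonD trivial_limit_within)

lemma cont01:
  "continuous_on (I \<times> {0..1}) (\<lambda>z. F i j (fst z) (snd z))"
  "continuous_on (I \<times> {0..1}) (\<lambda>z. G i j (fst z) (snd z))"
  "continuous_on (I \<times> {0..1}) (\<lambda>z. H i j (fst z) (snd z))"
  by (rule continuous_on_subset[OF cont(1)[unfolded case_prod_beta]] continuous_on_subset[OF cont(2)[unfolded case_prod_beta]]
      continuous_on_subset[OF cont(3)[unfolded case_prod_beta]], auto)+

lemma dr_sub:
  assumes "t \<in> I" "r \<in> {-1..1}" "S \<subseteq> {-1..1}"
  shows "(F i j t has_real_derivative F (Suc i) j t r) (at r within S)"
    "(G i j t has_real_derivative G (Suc i) j t r) (at r within S)"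
    "(H i j t has_real_derivative H (Suc i) j t r) (at r within S)"
  using dr[OF assms(1,2)] assms(3) by (blast intro: DERIV_subset)+

lemma dr_at:
  assumes "t \<in> I" "0 < r" "r < 1"
  shows "(F i j t has_real_derivative F (Suc i) j t r) (at r)"
    "(G i j t has_real_derivative G (Suc i) j t r) (at r)"
    "(H i j t has_real_derivative H (Suc i) j t r) (at r)"
  using dr[OF assms(1), of r] assms(2,3) at_within_interior[of r "{-1..1}"] by auto

lemma vanish_at_core:
  assumes t: "t \<in> I"
  shows "F 0 0 t 0 = 0" "F 2 0 t 0 = 0" "G 1 0 t 0 = 0" "G 3 0 t 0 = 0" "H 1 0 t 0 = 0"
proof -
  show "F 0 0 t 0 = 0" using parity(1)[OF t, of 0] by simp
  have F1: "F 1 0 t (- r) = F 1 0 t r" if "r \<in> {-1..1}" for r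
    using derivative_parity[of "F 0 0 t" "F 1 0 t" "-1" r] dr(1)[OF t, of _ 0 0] parity(1)[OF t] that by simp
  show "F 2 0 t 0 = 0"
    using derivative_parity[of "F 1 0 t" "F 2 0 t" "1" 0] dr(1)[OF t, of _ 1 0] F1 by (simp add: numeral_2_eq_2)
  have G1: "G 1 0 t (- r) = - G 1 0 t r" if "r \<in> {-1..1}" for r
    using derivative_parity[of "G 0 0 t" "G 1 0 t" "1" r] dr(2)[OF t, of _ 0 0] parity(2)[OF t] that by simp
  then show "G 1 0 t 0 = 0" using G1[of 0] by simp
  have G2: "G 2 0 t (- r) = G 2 0 t r" if "r \<in> {-1..1}" for r
    using derivative_parity[of "G 1 0 t" "G 2 0 t" "-1" r] dr(2)[OF t, of _ 1 0] G1 that by (simp add: numeral_2_eq_2)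
  show "G 3 0 t 0 = 0"
    using derivative_parity[of "G 2 0 t" "G 3 0 t" "1" 0] dr(2)[OF t, of _ 2 0] G2 by (simp add: numeral_3_eq_3 numeral_2_eq_2)
  show "H 1 0 t 0 = 0"
    using derivative_parity[of "H 0 0 t" "H 1 0 t" "1" 0] dr(3)[OF t, of _ 0 0] parity(3)[OF t] by simp
qed

text \<open>Numerators that are odd in r, divided by r; the value at the core is the limit, namely
  the next r-derivative. Continuity up to the core comes from \<open>vanish_at_core\<close> and
  \<open>continuous_on_radial_quotient\<close>.\<close>

definition F0r where "F0r t r = (if r = 0 then F 1 0 t 0 else F 0 0 t r / r)"
definition F2r where "F2r t r = (if r = 0 then F 3 0 t 0 else F 2 0 t r / r)"
definition G1r where "G1r t r = (if r = 0 then G 2 0 t 0 else G 1 0 t r / r)"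
definition G3r where "G3r t r = (if r = 0 then G 4 0 t 0 else G 3 0 t r / r)"
definition H1r where "H1r t r = (if r = 0 then H 2 0 t 0 else H 1 0 t r / r)"

lemma cont_quotients:
  "continuous_on (I \<times> {0..1}) (\<lambda>z. F0r (fst z) (snd z))"
  "continuous_on (I \<times> {0..1}) (\<lambda>z. F2r (fst z) (snd z))"
  "continuous_on (I \<times> {0..1}) (\<lambda>z. G1r (fst z) (snd z))"
  "continuous_on (I \<times> {0..1}) (\<lambda>z. G3r (fst z) (snd z))"
  "continuous_on (I \<times> {0..1}) (\<lambda>z. H1r (fst z) (snd z))"
proof -
  have sub: "{0..1} \<subseteq> {-1..1::real}" by auto
  show "continuous_on (I \<times> {0..1}) (\<lambda>z. F0r (fst z) (snd z))"
    using continuous_on_radial_quotient[of I "F 0 0" "F 1 0"] dr_sub(1)[OF _ _ sub, of _ _ 0 0] vanish_at_core cont01(1)[of 1 0]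
    by (simp add: F0r_def case_prod_beta)
  show "continuous_on (I \<times> {0..1}) (\<lambda>z. F2r (fst z) (snd z))"
    using continuous_on_radial_quotient[of I "F 2 0" "F 3 0"] dr_sub(1)[OF _ _ sub, of _ _ 2 0] vanish_at_core cont01(1)[of 3 0]
    by (simp add: F2r_def case_prod_beta)
  show "continuous_on (I \<times> {0..1}) (\<lambda>z. G1r (fst z) (snd z))"
    using continuous_on_radial_quotient[of I "G 1 0" "G 2 0"] dr_sub(2)[OF _ _ sub, of _ _ 1 0] vanish_at_core cont01(2)[of 2 0]
    by (simp add: G1r_def case_prod_beta numeral_2_eq_2)
  show "continuous_on (I \<times> {0..1}) (\<lambda>z. G3r (fst z) (snd z))"
    using continuous_on_radial_quotient[of I "G 3 0" "G 4 0"] dr_sub(2)[OF _ _ sub, of _ _ 3 0] vanish_at_core cont01(2)[of 4 0]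
    by (simp add: G3r_def case_prod_beta)
  show "continuous_on (I \<times> {0..1}) (\<lambda>z. H1r (fst z) (snd z))"
    using continuous_on_radial_quotient[of I "H 1 0" "H 2 0"] dr_sub(3)[OF _ _ sub, of _ _ 1 0] vanish_at_core cont01(3)[of 2 0]
    by (simp add: H1r_def case_prod_beta numeral_2_eq_2)
qed

lemma F0r_pos: "t \<in> I \<Longrightarrow> 0 \<le> r \<Longrightarrow> r \<le> 1 \<Longrightarrow> 0 < F0r t r"
  using pos(1)[of t r] core_slope[of t] by (auto simp: F0r_def)

text \<open>\<open>a\<close>, \<open>b\<close>, \<open>c\<close> are \<open>\<alpha>\<close>, \<open>\<beta>\<close>, \<open>\<gamma>\<close>; the factors \<open>1/r\<close> cancel, so the formulas hold at the core as well.
  In contrast, \<open>p t 0\<close> is the junk value \<open>0\<close>.\<close>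

definition p where "p t r = F 1 0 t r / (F 0 0 t r * H 0 0 t r)"
definition q where "q t r = G 1 0 t r / (G 0 0 t r * H 0 0 t r)"
definition a where "a t r = F 1 0 t r * G1r t r / ((H 0 0 t r)\<^sup>2 * F0r t r * G 0 0 t r)"
definition b where "b t r = (G 2 0 t r * H 0 0 t r - G 1 0 t r * H 1 0 t r) / ((H 0 0 t r)^3 * G 0 0 t r)"
definition c where "c t r = (F2r t r * H 0 0 t r - F 1 0 t r * H1r t r) / ((H 0 0 t r)^3 * F0r t r)"

lemma cont_abc:
  "continuous_on (I \<times> {0..1}) (\<lambda>(t, r). a t r)"
  "continuous_on (I \<times> {0..1}) (\<lambda>(t, r). b t r)"
  "continuous_on (I \<times> {0..1}) (\<lambda>(t, r). c t r)"
proof -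
  have nz: "F0r (fst z) (snd z) \<noteq> 0" "G 0 0 (fst z) (snd z) \<noteq> 0" "H 0 0 (fst z) (snd z) \<noteq> 0"
    if "z \<in> I \<times> {0..1}" for z
    using F0r_pos[of "fst z" "snd z"] pos(2,3)[of "fst z" "snd z"] that by auto
  show "continuous_on (I \<times> {0..1}) (\<lambda>(t, r). a t r)"
    "continuous_on (I \<times> {0..1}) (\<lambda>(t, r). b t r)"
    "continuous_on (I \<times> {0..1}) (\<lambda>(t, r). c t r)"
    unfolding a_def b_def c_def case_prod_beta
    by (intro continuous_intros cont01 cont_quotients ballI, simp add: nz)+
qed

lemma a_off_core: "0 < r \<Longrightarrow> a t r = F 1 0 t r * G 1 0 t r / ((H 0 0 t r)\<^sup>2 * F 0 0 t r * G 0 0 t r)"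
  by (simp add: a_def G1r_def F0r_def)

lemma c_off_core: "0 < r \<Longrightarrow> c t r = (F 2 0 t r * H 0 0 t r - F 1 0 t r * H 1 0 t r) / ((H 0 0 t r)^3 * F 0 0 t r)"
  by (simp add: c_def F2r_def H1r_def F0r_def diff_divide_distrib[symmetric])

lemma rot_data_slice:
  assumes t: "t \<in> I"
  shows "rot_data (f t) (g t) (h t) (F 1 0 t) (G 1 0 t) (H 1 0 t) (F 2 0 t) (G 2 0 t) (H 2 0 t)"
proof
  fix r :: real assume r: "0 < r" "r \<le> 1"
  show "0 < f t r \<and> 0 < g t r \<and> 0 < h t r" using pos[OF t, of r] FGH[OF t, of r] r by auto
  have S: "r \<in> {-1..1}" "{0<..1} \<subseteq> {-1..1::real}" using r by auto
  note d = dr_sub[OF t S, where j = 0]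
  show "(f t has_real_derivative F 1 0 t r) (at r within {0<..1})"
    "(g t has_real_derivative G 1 0 t r) (at r within {0<..1})"
    "(h t has_real_derivative H 1 0 t r) (at r within {0<..1})"
    using d[of 0] FGH[OF t] r by (auto intro: has_field_derivative_transform_within[OF _ zero_less_one])
  show "(F 1 0 t has_real_derivative F 2 0 t r) (at r within {0<..1})"
    "(G 1 0 t has_real_derivative G 2 0 t r) (at r within {0<..1})"
    "(H 1 0 t has_real_derivative H 2 0 t r) (at r within {0<..1})"
    using d[of 1] by (simp_all add: numeral_2_eq_2)
qed

lemma slice_curvatures:
  assumes t: "t \<in> I" and r: "0 < r" "r \<le> 1"
  shows "rot_data.A (f t) (g t) (h t) (F 1 0 t) (G 1 0 t) r = a t r"
    "rot_data.B (g t) (h t) (G 1 0 t) (H 1 0 t) (G 2 0 t) r = b t r"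
    "rot_data.C (f t) (h t) (F 1 0 t) (H 1 0 t) (F 2 0 t) r = c t r"
proof -
  interpret rot_data "f t" "g t" "h t" "F 1 0 t" "G 1 0 t" "H 1 0 t" "F 2 0 t" "G 2 0 t" "H 2 0 t"
    by (rule rot_data_slice[OF t])
  show "A r = a t r" "B r = b t r" "C r = c t r"
    using FGH[OF t, of r] r by (simp_all add: A_def B_def C_def a_off_core c_off_core b_def del: One_nat_def)
qed

lemma sec_curv_slice:
  assumes t: "t \<in> I" and r: "0 \<le> r" "r \<le> 1"
  shows "sec_curv (f t) (g t) (h t) m l r X Y =
     - (a t r * (X $ 1 * Y $ 2 - X $ 2 * Y $ 1)\<^sup>2 + b t r * (X $ 2 * Y $ 3 - X $ 3 * Y $ 2)\<^sup>2
        + c t r * (X $ 1 * Y $ 3 - X $ 3 * Y $ 1)\<^sup>2)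
     / ((X $ 1 * Y $ 2 - X $ 2 * Y $ 1)\<^sup>2 + (X $ 2 * Y $ 3 - X $ 3 * Y $ 2)\<^sup>2 + (X $ 1 * Y $ 3 - X $ 3 * Y $ 1)\<^sup>2)"
proof -
  interpret rot_data "f t" "g t" "h t" "F 1 0 t" "G 1 0 t" "H 1 0 t" "F 2 0 t" "G 2 0 t" "H 2 0 t"
    by (rule rot_data_slice[OF t])
  show ?thesis
  proof (cases "r = 0")
    case False
    then show ?thesis using sec_curv_eq[of r m l X Y] slice_curvatures[OF t, of r] r by (simp add: plane_curv_def del: One_nat_def)
  next
    case True
    have sub: "Pair t ` {0..1::real} \<subseteq> I \<times> {0..1}" using t by auto
    have cp: "continuous_on {0..1::real} (Pair t)" by (intro continuous_intros)
    have slice: "continuous_on {0..1} (k t)" if "continuous_on (I \<times> {0..1}) (\<lambda>(t, r). k t r)" for k :: "real \<Rightarrow> real \<Rightarrow> real"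
      using continuous_on_compose2[OF that cp sub] by simp
    have lim: "(k t \<longlongrightarrow> k t 0) (at_right 0)" if "continuous_on (I \<times> {0..1}) (\<lambda>(t, r). k t r)" for k :: "real \<Rightarrow> real \<Rightarrow> real"
      using slice[OF that] unfolding continuous_on_def
      by (metis atLeastAtMost_iff at_within_Icc_at_right order_refl zero_le_one zero_less_one)
    have ev: "\<forall>\<^sub>F r in at_right (0::real). r \<in> {0<..<1}" by (rule eventually_at_right_real) simp
    have "(A \<longlongrightarrow> a t 0) (at_right 0)"
      by (rule Lim_transform_eventually[OF lim[OF cont_abc(1)]], rule eventually_mono[OF ev]) (simp add: slice_curvatures[OF t] del: One_nat_def)
    moreover have "(B \<longlongrightarrow> b t 0) (at_right 0)"
      by (rule Lim_transform_eventually[OF lim[OF cont_abc(2)]], rule eventually_mono[OF ev]) (simp add: slice_curvatures[OF t] del: One_nat_def)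
    moreover have "(C \<longlongrightarrow> c t 0) (at_right 0)"
      by (rule Lim_transform_eventually[OF lim[OF cont_abc(3)]], rule eventually_mono[OF ev]) (simp add: slice_curvatures[OF t] del: One_nat_def)
    ultimately show ?thesis unfolding True by (rule sec_curv_core)
  qed
qed

lemma principal_curvatures:
  assumes t: "t \<in> I" and r: "0 \<le> r" "r \<le> 1"
  shows "alpha (f t) (g t) (h t) r = a t r" "beta (f t) (g t) (h t) r = b t r" "gamma (f t) (g t) (h t) r = c t r"
  unfolding alpha_def beta_def gamma_def sec_curv_slice[OF assms] by (simp_all add: axis_def)

text \<open>The coordinate planes give one direction. Conversely every sectional curvature is minus
  a weighted mean of \<alpha>, \<beta>, \<gamma> whose weights are squared 2x2 minors, and these
  minors do not all vanish for independent X and Y.\<close>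

lemma negative_sectional_curvature_iff:
  assumes t: "t \<in> I"
  shows "negative_sectional_curvature (f t) (g t) (h t) \<longleftrightarrow> (\<forall>r\<in>{0..1}. 0 < a t r \<and> 0 < b t r \<and> 0 < c t r)"
proof
  assume neg: "negative_sectional_curvature (f t) (g t) (h t)"
  have ind: "independent {axis i 1, axis j 1 :: real^3} \<and> axis i 1 \<noteq> (axis j 1 :: real^3)" if "i \<noteq> j" for i j :: 3
  proof -
    have "{axis i 1, axis j 1 :: real^3} \<subseteq> Basis" by (auto simp: axis_in_Basis_iff)
    then have "independent {axis i 1, axis j 1 :: real^3}" by (rule independent_mono[OF independent_Basis])
    then show ?thesis using that by (simp add: axis_eq_axis)
  qed
  show "\<forall>r\<in>{0..1}. 0 < a t r \<and> 0 < b t r \<and> 0 < c t r"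
  proof
    fix r :: real assume r: "r \<in> {0..1}"
    then have "0 < alpha (f t) (g t) (h t) r" "0 < beta (f t) (g t) (h t) r" "0 < gamma (f t) (g t) (h t) r"
      using neg ind unfolding negative_sectional_curvature_def alpha_def beta_def gamma_def by auto
    then show "0 < a t r \<and> 0 < b t r \<and> 0 < c t r" using principal_curvatures[OF t] r by auto
  qed
next
  assume abc: "\<forall>r\<in>{0..1}. 0 < a t r \<and> 0 < b t r \<and> 0 < c t r"
  show "negative_sectional_curvature (f t) (g t) (h t)"
    unfolding negative_sectional_curvature_def
  proof (intro allI ballI impI)
    fix m l r :: real and X Y :: "real^3" assume r: "r \<in> {0..1}" and XY: "X \<noteq> Y \<and> independent {X, Y}"
    define m12 m23 m13 where "m12 = X $ 1 * Y $ 2 - X $ 2 * Y $ 1" and "m23 = X $ 2 * Y $ 3 - X $ 3 * Y $ 2"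
      and "m13 = X $ 1 * Y $ 3 - X $ 3 * Y $ 1"
    have "\<not> (m12 = 0 \<and> m23 = 0 \<and> m13 = 0)"
    proof
      assume 0: "m12 = 0 \<and> m23 = 0 \<and> m13 = 0"
      have "X \<noteq> 0" using XY dependent_zero[of "{X, Y}"] by auto
      then obtain i where i: "X $ i \<noteq> 0" by (auto simp: vec_eq_iff)
      have "\<forall>i j. X $ i * Y $ j = X $ j * Y $ i"
        using 0 by (simp add: forall_3 m12_def m23_def m13_def)
      then have "Y = (Y $ i / X $ i) *\<^sub>R X" using i by (simp add: vec_eq_iff field_simps)
      then have "Y \<in> span {X}" by (metis span_base span_mul singletonI)
      moreover have "{X, Y} - {Y} = {X}" using XY by auto
      ultimately have "dependent {X, Y}" unfolding dependent_def by auto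
      then show False using XY by simp
    qed
    then have sq: "0 < m12\<^sup>2 \<or> 0 < m23\<^sup>2 \<or> 0 < m13\<^sup>2" by simp
    have k: "0 < a t r" "0 < b t r" "0 < c t r" using abc r by auto
    have pos: "0 < x * m12\<^sup>2 + y * m23\<^sup>2 + z * m13\<^sup>2" if "0 < x" "0 < y" "0 < z" for x y z :: real
    proof -
      have "0 \<le> x * m12\<^sup>2" "0 \<le> y * m23\<^sup>2" "0 \<le> z * m13\<^sup>2" using that by simp_all
      moreover have "0 < x * m12\<^sup>2 \<or> 0 < y * m23\<^sup>2 \<or> 0 < z * m13\<^sup>2" using sq that by auto
      ultimately show ?thesis by linarith
    qed
    have "sec_curv (f t) (g t) (h t) m l r X Y
      = - (a t r * m12\<^sup>2 + b t r * m23\<^sup>2 + c t r * m13\<^sup>2) / (m12\<^sup>2 + m23\<^sup>2 + m13\<^sup>2)"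
      unfolding m12_def m23_def m13_def using r by (intro sec_curv_slice[OF t]) auto
    also have "\<dots> < 0"
      using pos[OF k] pos[of 1 1 1] by (intro divide_neg_pos) auto
    finally show "sec_curv (f t) (g t) (h t) m l r X Y < 0" .
  qed
qed

end

section \<open>Evolution of the curvatures\<close>

context rot_flow
begin

text \<open>The flow prescribes the t-derivatives of f^2, g^2 and h^2; comparison with 2 k k_t and
  division by k > 0 gives the rates of f, g, h. The radius r = 1 is included because the boundary
  conditions are evaluated there.\<close>

lemma flow_equations:
  assumes t: "t \<in> I" and r: "0 < r" "r \<le> 1"
  shows "F 0 1 t r = a t r * c t r * F 0 0 t r" "G 0 1 t r = a t r * b t r * G 0 0 t r"
    "H 0 1 t r = b t r * c t r * H 0 0 t r"
proof -
  note fpos = pos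
  interpret rot_data "f t" "g t" "h t" "F 1 0 t" "G 1 0 t" "H 1 0 t" "F 2 0 t" "G 2 0 t" "H 2 0 t"
    by (rule rot_data_slice[OF t])
  define x :: "real^3" where "x = vector [0, 0, r]"
  have x: "x \<in> chart" "x $ 3 = r" using r by (simp_all add: x_def chart_def)
  have r': "r \<in> {-1..1}" "0 \<le> r" using r by auto
  have sq: "k1 = e * k t r"
    if d: "((\<lambda>\<tau>. k \<tau> r) has_real_derivative k1) (at t within I)"
      and d2: "((\<lambda>\<tau>. (k' \<tau> r)\<^sup>2) has_real_derivative - 2 * (- e * (k' t r)\<^sup>2)) (at t within I)"
      and pos: "0 < k t r" and k': "\<And>t. t \<in> I \<Longrightarrow> k t r = k' t r" for k k' :: "real \<Rightarrow> real \<Rightarrow> real" and k1 e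
  proof -
    have "((\<lambda>\<tau>. (k \<tau> r)\<^sup>2) has_real_derivative - 2 * (- e * (k' t r)\<^sup>2)) (at t within I)"
      by (rule has_field_derivative_transform_within[OF d2 zero_less_one t]) (simp add: k')
    moreover have "((\<lambda>\<tau>. (k \<tau> r)\<^sup>2) has_real_derivative 2 * k1 * k t r) (at t within I)"
      using d by (auto intro!: derivative_eq_intros)
    ultimately have "- 2 * (- e * (k' t r)\<^sup>2) = 2 * k1 * k t r"
      by (rule has_field_derivative_unique[OF _ _ nontrivial_at[OF t]])
    then show ?thesis using pos k'[OF t] by (simp add: power2_eq_square)
  qed
  note cc = cross_curvature_eq[OF x(1), unfolded x(2) slice_curvatures[OF t r]]
  note D = ccf[OF t x(1)]
  have "((\<lambda>\<tau>. (f \<tau> r)\<^sup>2) has_real_derivative - 2 * (- (a t r * c t r) * (f t r)\<^sup>2)) (at t within I)"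
    using D[of 1 1] cc(1) x(2) by (simp add: rot_metric_def del: One_nat_def)
  then show "F 0 1 t r = a t r * c t r * F 0 0 t r"
    using sq[of "F 0 0" "F 0 1 t r" f "a t r * c t r"] dt(1)[OF t r'(1), of 0 0] fpos(1)[OF t r] FGH r r' by simp
  have "((\<lambda>\<tau>. (g \<tau> r)\<^sup>2) has_real_derivative - 2 * (- (a t r * b t r) * (g t r)\<^sup>2)) (at t within I)"
    using D[of 2 2] cc(2) x(2) by (simp add: rot_metric_def del: One_nat_def)
  then show "G 0 1 t r = a t r * b t r * G 0 0 t r"
    using sq[of "G 0 0" "G 0 1 t r" g "a t r * b t r"] dt(2)[OF t r'(1), of 0 0] fpos(2)[OF t r'(2) r(2)] FGH r r' by simp
  have "((\<lambda>\<tau>. (h \<tau> r)\<^sup>2) has_real_derivative - 2 * (- (b t r * c t r) * (h t r)\<^sup>2)) (at t within I)"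
    using D[of 3 3] cc(3) x(2) by (simp add: rot_metric_def del: One_nat_def)
  then show "H 0 1 t r = b t r * c t r * H 0 0 t r"
    using sq[of "H 0 0" "H 0 1 t r" h "b t r * c t r"] dt(3)[OF t r'(1), of 0 0] fpos(3)[OF t r'(2) r(2)] FGH r r' by simp
qed

lemma positive_off_core:
  assumes "t \<in> I" "0 < r" "r < 1"
  shows "0 < F 0 0 t r" "0 < G 0 0 t r" "0 < H 0 0 t r"
  using pos[of t r] assms by auto

lemma a_pq: "0 < r \<Longrightarrow> a t r = p t r * q t r"
  by (simp add: a_off_core p_def q_def power2_eq_square mult_ac)

lemma dr_p:
  assumes z: "t \<in> I" "0 < r" "r < 1"
  shows "(p t has_real_derivative H 0 0 t r * (c t r - (p t r)\<^sup>2)) (at r)"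
  unfolding p_def c_off_core[OF z(2)]
  using dr_at[OF z, of 0 0] dr_at[OF z, of 1 0] positive_off_core[OF z]
  by (auto intro!: derivative_eq_intros simp: field_simps power2_eq_square power3_eq_cube numeral_2_eq_2)

lemma dr_q:
  assumes z: "t \<in> I" "0 < r" "r < 1"
  shows "(q t has_real_derivative H 0 0 t r * (b t r - (q t r)\<^sup>2)) (at r)"
  unfolding q_def b_def
  using dr_at[OF z, of 0 0] dr_at[OF z, of 1 0] positive_off_core[OF z]
  by (auto intro!: derivative_eq_intros simp: field_simps power2_eq_square power3_eq_cube numeral_2_eq_2)

lemma twice_differentiable_abc:
  assumes t: "t \<in> I"
  shows "twice_differentiable (a t)" "twice_differentiable (b t)" "twice_differentiable (c t)"
proof -
  have FGH2: "twice_differentiable (F i j t)" "twice_differentiable (G i j t)" "twice_differentiable (H i j t)" for i j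
    using dr_at[OF t] by (blast intro: twice_differentiableI)+
  note nz = positive_off_core[OF t]
  have inv: "twice_differentiable (\<lambda>r. inverse ((H 0 0 t r)^3 * F 0 0 t r))" "twice_differentiable (\<lambda>r. inverse ((H 0 0 t r)^3 * G 0 0 t r))"
    "twice_differentiable (\<lambda>r. inverse ((H 0 0 t r)\<^sup>2 * F 0 0 t r * G 0 0 t r))"
    unfolding power3_eq_cube power2_eq_square
    by (intro twice_differentiable_inverse twice_differentiable_mult FGH2, use nz in force)+
  show "twice_differentiable (b t)"
    unfolding b_def[abs_def] divide_inverse by (intro twice_differentiable_mult twice_differentiable_diff FGH2 inv)
  have "twice_differentiable (\<lambda>r. (F 2 0 t r * H 0 0 t r - F 1 0 t r * H 1 0 t r) * inverse ((H 0 0 t r)^3 * F 0 0 t r))"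
    by (intro twice_differentiable_mult twice_differentiable_diff FGH2 inv)
  then show "twice_differentiable (c t)" by (rule twice_differentiable_cong) (simp add: c_off_core divide_inverse)
  have "twice_differentiable (\<lambda>r. F 1 0 t r * G 1 0 t r * inverse ((H 0 0 t r)\<^sup>2 * F 0 0 t r * G 0 0 t r))"
    by (intro twice_differentiable_mult FGH2 inv)
  then show "twice_differentiable (a t)" by (rule twice_differentiable_cong) (simp add: a_off_core divide_inverse)
qed

text \<open>The Codazzi identity serves as the definition of \<alpha>_s, and \<open>a2\<close> is
  its formal s-derivative; \<open>dr_a\<close> justifies both. Hence \<alpha>_ss involves no more
  than first derivatives of \<beta> and \<gamma>, as the algebraic evolution identities
  require.\<close>

definition a1 where "a1 t r = (c t r - a t r) * q t r + (b t r - a t r) * p t r"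
definition b1 where "b1 t r = deriv (b t) r / H 0 0 t r"
definition b2 where "b2 t r = deriv (b1 t) r / H 0 0 t r"
definition c1 where "c1 t r = deriv (c t) r / H 0 0 t r"
definition c2 where "c2 t r = deriv (c1 t) r / H 0 0 t r"
definition a2 where "a2 t r = (c1 t r - a1 t r) * q t r + (c t r - a t r) * (b t r - (q t r)\<^sup>2)
  + (b1 t r - a1 t r) * p t r + (b t r - a t r) * (c t r - (p t r)\<^sup>2)"

lemma dr_bc:
  assumes z: "t \<in> I" "0 < r" "r < 1"
  shows "(b t has_real_derivative H 0 0 t r * b1 t r) (at r)" "(b1 t has_real_derivative H 0 0 t r * b2 t r) (at r)"
    "(c t has_real_derivative H 0 0 t r * c1 t r) (at r)" "(c1 t has_real_derivative H 0 0 t r * c2 t r) (at r)"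
proof -
  have nz: "H 0 0 t r \<noteq> 0" using positive_off_core[OF z] by simp
  show "(b t has_real_derivative H 0 0 t r * b1 t r) (at r)" "(c t has_real_derivative H 0 0 t r * c1 t r) (at r)"
    using twice_differentiable_deriv(1)[OF twice_differentiable_abc(2)[OF z(1)] z(2,3)] twice_differentiable_deriv(1)[OF twice_differentiable_abc(3)[OF z(1)] z(2,3)] nz
    by (simp_all add: b1_def c1_def)
  have "\<exists>y. (b1 t has_real_derivative y) (at r)" "\<exists>y. (c1 t has_real_derivative y) (at r)"
    unfolding b1_def c1_def
    using DERIV_divide[OF twice_differentiable_deriv(2)[OF twice_differentiable_abc(2)[OF z(1)] z(2,3)] dr_at(3)[OF z] nz]
       DERIV_divide[OF twice_differentiable_deriv(2)[OF twice_differentiable_abc(3)[OF z(1)] z(2,3)] dr_at(3)[OF z] nz] by blast+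
  then show "(b1 t has_real_derivative H 0 0 t r * b2 t r) (at r)" "(c1 t has_real_derivative H 0 0 t r * c2 t r) (at r)"
    using nz DERIV_imp_deriv by (fastforce simp: b2_def c2_def)+
qed

lemma dr_a:
  assumes z: "t \<in> I" "0 < r" "r < 1"
  shows "(a t has_real_derivative H 0 0 t r * a1 t r) (at r)" "(a1 t has_real_derivative H 0 0 t r * a2 t r) (at r)"
proof -
  have da: "(a t has_real_derivative H 0 0 t r * a1 t r) (at r)" if z: "t \<in> I" "0 < r" "r < 1" for r
  proof -
    have "((\<lambda>r. p t r * q t r) has_real_derivative H 0 0 t r * a1 t r) (at r)"
      using dr_p[OF z] dr_q[OF z]
      by (auto intro!: derivative_eq_intros simp: a1_def a_pq[OF z(2)] algebra_simps power2_eq_square)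
    then show ?thesis
      by (rule has_field_derivative_transform_within_open[where S = "{0<..<1}"]) (use z in \<open>auto simp: a_pq\<close>)
  qed
  then show "(a t has_real_derivative H 0 0 t r * a1 t r) (at r)" using z .
  show "(a1 t has_real_derivative H 0 0 t r * a2 t r) (at r)"
    unfolding a1_def[abs_def] using dr_bc[OF z] dr_p[OF z] dr_q[OF z] da[OF z]
    by (auto intro!: derivative_eq_intros simp: a2_def algebra_simps)
qed

text \<open>Treats u, p, \<gamma> and v, q, \<beta> at once: K is f or g, \<open>e\<close> its
  logarithmic rate, P the s-derivative of its logarithm and k = P_s + P^2. Both formulas are the
  commutator [d_t, d_s] = - \<beta>\<gamma> d_s, applied once and twice.\<close>

lemma dt_radial_curvature:
  fixes K :: "nat \<Rightarrow> nat \<Rightarrow> real \<Rightarrow> real \<Rightarrow> real" and P k e e1 e2 :: "real \<Rightarrow> real \<Rightarrow> real"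
  assumes drK: "\<And>i j t r. t \<in> I \<Longrightarrow> 0 < r \<Longrightarrow> r < 1 \<Longrightarrow> (K i j t has_real_derivative K (Suc i) j t r) (at r)"
    and dtK: "\<And>i j t r. t \<in> I \<Longrightarrow> 0 < r \<Longrightarrow> r < 1 \<Longrightarrow> ((\<lambda>\<tau>. K i j \<tau> r) has_real_derivative K i (Suc j) t r) (at t within I)"
    and posK: "\<And>t r. t \<in> I \<Longrightarrow> 0 < r \<Longrightarrow> r < 1 \<Longrightarrow> 0 < K 0 0 t r"
    and P: "\<And>t r. P t r = K 1 0 t r / (K 0 0 t r * H 0 0 t r)"
    and flow: "\<And>t r. t \<in> I \<Longrightarrow> 0 < r \<Longrightarrow> r < 1 \<Longrightarrow> K 0 1 t r = e t r * K 0 0 t r"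
    and drP: "\<And>t r. t \<in> I \<Longrightarrow> 0 < r \<Longrightarrow> r < 1 \<Longrightarrow> (P t has_real_derivative H 0 0 t r * (k t r - (P t r)\<^sup>2)) (at r)"
    and dre: "\<And>t r. t \<in> I \<Longrightarrow> 0 < r \<Longrightarrow> r < 1 \<Longrightarrow> (e t has_real_derivative H 0 0 t r * e1 t r) (at r)"
      "\<And>t r. t \<in> I \<Longrightarrow> 0 < r \<Longrightarrow> r < 1 \<Longrightarrow> (e1 t has_real_derivative H 0 0 t r * e2 t r) (at r)"
    and z: "t \<in> I" "0 < r" "r < 1"
  shows "((\<lambda>\<tau>. P \<tau> r) has_real_derivative (e1 t r - b t r * c t r * P t r)) (at t within I)"
    "((\<lambda>\<tau>. k \<tau> r) has_real_derivative
       e2 t r - (b1 t r * c t r + b t r * c1 t r) * P t r - 2 * b t r * c t r * (k t r - (P t r)\<^sup>2)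
       + 2 * P t r * (e1 t r - b t r * c t r * P t r)) (at t within I)"
proof -
  have m: "has_mixed I (K i 0) (K (Suc i) 0) (K i 1) (K (Suc i) 1)" "has_mixed I (H i 0) (H (Suc i) 0) (H i 1) (H (Suc i) 1)" for i
    unfolding has_mixed_def
    using dr_at[where j = 0] dr_at[where j = 1] dt[where j = 0] drK[where j = 0] drK[where j = 1] dtK[where j = 0] by auto
  have nz: "K 0 0 t r * H 0 0 t r \<noteq> 0" if "t \<in> I" "0 < r" "r < 1" for t r
    using positive_off_core(3)[OF that] posK[OF that] by simp
  \<comment> \<open>Only the existence of matching derivatives is kept; their values are identified
    afterwards by uniqueness of derivatives.\<close>
  obtain Pr Pt Prt where M: "has_mixed I P Pr Pt Prt"
    using has_mixed_mult[OF m(1)[of 1] has_mixed_inverse[OF has_mixed_mult[OF m(1)[of 0] m(2)[of 0]] nz]]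
    unfolding P[abs_def] divide_inverse by blast
  have Pr: "Pr t r = H 0 0 t r * (k t r - (P t r)\<^sup>2)" if "t \<in> I" "0 < r" "r < 1" for t r
    using DERIV_unique[OF has_mixedD(1)[OF M that] drP[OF that]] .
  have Pt: "Pt t r = e1 t r - b t r * c t r * P t r" if z: "t \<in> I" "0 < r" "r < 1" for t r
  proof -
    have r': "r \<in> {-1..1}" "r \<le> 1" using z by auto
    note pos = posK[OF z] positive_off_core(3)[OF z]
    have "((\<lambda>r. e t r * K 0 0 t r) has_real_derivative H 0 0 t r * e1 t r * K 0 0 t r + e t r * K 1 0 t r) (at r)"
      using dre[OF z] drK[OF z, of 0 0] by (auto intro!: derivative_eq_intros simp: algebra_simps)
    then have "(K 0 1 t has_real_derivative H 0 0 t r * e1 t r * K 0 0 t r + e t r * K 1 0 t r) (at r)"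
      by (rule has_field_derivative_transform_within_open[where S = "{0<..<1}"]) (use z flow in auto)
    then have K11: "K 1 1 t r = H 0 0 t r * e1 t r * K 0 0 t r + e t r * K 1 0 t r"
      using DERIV_unique drK[OF z, of 0 1] by fastforce
    have "((\<lambda>\<tau>. P \<tau> r) has_real_derivative
        (K 1 1 t r * (K 0 0 t r * H 0 0 t r) - K 1 0 t r * (K 0 1 t r * H 0 0 t r + H 0 1 t r * K 0 0 t r))
        / ((K 0 0 t r * H 0 0 t r) * (K 0 0 t r * H 0 0 t r))) (at t within I)"
      unfolding P using dt(3)[OF z(1) r'(1), of 0 0] dtK[OF z, of 0 0] dtK[OF z, of 1 0] pos
      by (intro DERIV_divide DERIV_mult) auto
    then have "Pt t r = (K 1 1 t r * (K 0 0 t r * H 0 0 t r) - K 1 0 t r * (K 0 1 t r * H 0 0 t r + H 0 1 t r * K 0 0 t r))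
        / ((K 0 0 t r * H 0 0 t r) * (K 0 0 t r * H 0 0 t r))"
      using has_field_derivative_unique[OF has_mixedD(2)[OF M z] _ nontrivial_at[OF z(1)]] by blast
    also have "\<dots> = e1 t r - b t r * c t r * P t r"
      unfolding K11 flow[OF z] flow_equations(3)[OF z(1,2) r'(2)] P using pos by (simp add: field_simps)
    finally show ?thesis .
  qed
  note H_pos = positive_off_core(3)[OF z]
  show dP: "((\<lambda>\<tau>. P \<tau> r) has_real_derivative (e1 t r - b t r * c t r * P t r)) (at t within I)"
    using has_mixedD(2)[OF M z] Pt[OF z] by simp
  have "((\<lambda>r. e1 t r - b t r * c t r * P t r) has_real_derivative Prt t r) (at r)"
    by (rule has_field_derivative_transform_within_open[OF has_mixedD(4)[OF M z], where S = "{0<..<1}"]) (use Pt z in auto)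
  moreover have "((\<lambda>r. e1 t r - b t r * c t r * P t r) has_real_derivative
      H 0 0 t r * (e2 t r - (b1 t r * c t r + b t r * c1 t r) * P t r - b t r * c t r * (k t r - (P t r)\<^sup>2))) (at r)"
    using dre(2)[OF z] dr_bc[OF z] drP[OF z] by (auto intro!: derivative_eq_intros simp: algebra_simps)
  ultimately have Prt: "Prt t r = H 0 0 t r * (e2 t r - (b1 t r * c t r + b t r * c1 t r) * P t r - b t r * c t r * (k t r - (P t r)\<^sup>2))"
    by (rule DERIV_unique)
  \<comment> \<open>This function is k, because \<open>Pr\<close> is h P_s. Its t-derivative needs
    the t-derivative of \<open>Pr\<close>, which equals the r-derivative of \<open>Pt\<close>
    computed above.\<close>
  have "((\<lambda>\<tau>. Pr \<tau> r / H 0 0 \<tau> r + (P \<tau> r)\<^sup>2) has_real_derivative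
      (Prt t r * H 0 0 t r - Pr t r * H 0 1 t r) / (H 0 0 t r * H 0 0 t r) + 2 * (e1 t r - b t r * c t r * P t r) * P t r) (at t within I)"
    using has_mixedD(3)[OF M z] dt(3)[OF z(1), of r 0 0] dP z H_pos
    by (auto intro!: derivative_eq_intros)
  moreover have "(Prt t r * H 0 0 t r - Pr t r * H 0 1 t r) / (H 0 0 t r * H 0 0 t r) + 2 * (e1 t r - b t r * c t r * P t r) * P t r
    = e2 t r - (b1 t r * c t r + b t r * c1 t r) * P t r - 2 * b t r * c t r * (k t r - (P t r)\<^sup>2)
       + 2 * P t r * (e1 t r - b t r * c t r * P t r)"
    unfolding Prt Pr[OF z] flow_equations(3)[OF z(1,2) less_imp_le[OF z(3)]] using H_pos by (simp add: field_simps)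
  ultimately have "((\<lambda>\<tau>. Pr \<tau> r / H 0 0 \<tau> r + (P \<tau> r)\<^sup>2) has_real_derivative
       e2 t r - (b1 t r * c t r + b t r * c1 t r) * P t r - 2 * b t r * c t r * (k t r - (P t r)\<^sup>2)
       + 2 * P t r * (e1 t r - b t r * c t r * P t r)) (at t within I)" by simp
  then show "((\<lambda>\<tau>. k \<tau> r) has_real_derivative
       e2 t r - (b1 t r * c t r + b t r * c1 t r) * P t r - 2 * b t r * c t r * (k t r - (P t r)\<^sup>2)
       + 2 * P t r * (e1 t r - b t r * c t r * P t r)) (at t within I)"
    by (rule has_field_derivative_transform_within[OF _ zero_less_one z(1)])
       (use Pr positive_off_core(3) z in fastforce)
qed

lemma dt_pc:
  assumes z: "t \<in> I" "0 < r" "r < 1"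
  shows "((\<lambda>\<tau>. p \<tau> r) has_real_derivative (a1 t r * c t r + a t r * c1 t r - b t r * c t r * p t r)) (at t within I)"
    "((\<lambda>\<tau>. c \<tau> r) has_real_derivative
       a t r * c2 t r + (2 * a1 t r + c t r * q t r + 2 * p t r * a t r - p t r * b t r) * c1 t r
         - 2 * c t r * (c t r - a t r) * (q t r)\<^sup>2 - 2 * a t r * b t r * c t r) (at t within I)"
proof -
  let ?e = "\<lambda>t r. a t r * c t r" and ?e1 = "\<lambda>t r. a1 t r * c t r + a t r * c1 t r"
    and ?e2 = "\<lambda>t r. a2 t r * c t r + 2 * a1 t r * c1 t r + a t r * c2 t r"
  have e: "(?e t has_real_derivative H 0 0 t r * ?e1 t r) (at r)" "(?e1 t has_real_derivative H 0 0 t r * ?e2 t r) (at r)"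
    if "t \<in> I" "0 < r" "r < 1" for t r
    using dr_a[OF that] dr_bc[OF that] by (auto intro!: derivative_eq_intros simp: algebra_simps)
  note * = dt_radial_curvature[of F p ?e c ?e1 ?e2, OF _ _ _ p_def _ _ e z]
  show "((\<lambda>\<tau>. p \<tau> r) has_real_derivative (a1 t r * c t r + a t r * c1 t r - b t r * c t r * p t r)) (at t within I)"
    by (rule *(1)) (auto intro: dr_at dt positive_off_core flow_equations dr_p simp del: One_nat_def)
  have "((\<lambda>\<tau>. c \<tau> r) has_real_derivative
       ?e2 t r - (b1 t r * c t r + b t r * c1 t r) * p t r - 2 * b t r * c t r * (c t r - (p t r)\<^sup>2)
       + 2 * p t r * (?e1 t r - b t r * c t r * p t r)) (at t within I)"
    by (rule *(2)) (auto intro: dr_at dt positive_off_core flow_equations dr_p simp del: One_nat_def)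
  then show "((\<lambda>\<tau>. c \<tau> r) has_real_derivative
       a t r * c2 t r + (2 * a1 t r + c t r * q t r + 2 * p t r * a t r - p t r * b t r) * c1 t r
         - 2 * c t r * (c t r - a t r) * (q t r)\<^sup>2 - 2 * a t r * b t r * c t r) (at t within I)"
    unfolding evolution_c_identity[OF a_pq[OF z(2)] a1_def a2_def, symmetric]
    by (rule DERIV_cong) (simp add: algebra_simps)
qed

lemma dt_qb:
  assumes z: "t \<in> I" "0 < r" "r < 1"
  shows "((\<lambda>\<tau>. q \<tau> r) has_real_derivative (a1 t r * b t r + a t r * b1 t r - b t r * c t r * q t r)) (at t within I)"
    "((\<lambda>\<tau>. b \<tau> r) has_real_derivative
       a t r * b2 t r + (2 * a1 t r + b t r * p t r + 2 * q t r * a t r - q t r * c t r) * b1 t r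
         - 2 * b t r * (b t r - a t r) * (p t r)\<^sup>2 - 2 * a t r * b t r * c t r) (at t within I)"
proof -
  let ?e = "\<lambda>t r. a t r * b t r" and ?e1 = "\<lambda>t r. a1 t r * b t r + a t r * b1 t r"
    and ?e2 = "\<lambda>t r. a2 t r * b t r + 2 * a1 t r * b1 t r + a t r * b2 t r"
  have e: "(?e t has_real_derivative H 0 0 t r * ?e1 t r) (at r)" "(?e1 t has_real_derivative H 0 0 t r * ?e2 t r) (at r)"
    if "t \<in> I" "0 < r" "r < 1" for t r
    using dr_a[OF that] dr_bc[OF that] by (auto intro!: derivative_eq_intros simp: algebra_simps)
  note * = dt_radial_curvature[of G q ?e b ?e1 ?e2, OF _ _ _ q_def _ _ e z]
  show "((\<lambda>\<tau>. q \<tau> r) has_real_derivative (a1 t r * b t r + a t r * b1 t r - b t r * c t r * q t r)) (at t within I)"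
    by (rule *(1)) (auto intro: dr_at dt positive_off_core flow_equations dr_q simp del: One_nat_def)
  have "((\<lambda>\<tau>. b \<tau> r) has_real_derivative
       ?e2 t r - (b1 t r * c t r + b t r * c1 t r) * q t r - 2 * b t r * c t r * (b t r - (q t r)\<^sup>2)
       + 2 * q t r * (?e1 t r - b t r * c t r * q t r)) (at t within I)"
    by (rule *(2)) (auto intro: dr_at dt positive_off_core flow_equations dr_q simp del: One_nat_def)
  note db = this
  have eq: "a t r * b2 t r + (2 * a1 t r + b t r * p t r + 2 * q t r * a t r - q t r * c t r) * b1 t r
         - 2 * b t r * (b t r - a t r) * (p t r)\<^sup>2 - 2 * a t r * b t r * c t r
      = ?e2 t r - (b1 t r * c t r + b t r * c1 t r) * q t r - 2 * b t r * c t r * (b t r - (q t r)\<^sup>2)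
       + 2 * q t r * (?e1 t r - b t r * c t r * q t r)"
    \<comment> \<open>The identity for \<gamma> with p and q, \<beta> and \<gamma> exchanged;
      \<open>a1\<close> and \<open>a2\<close> are symmetric under this exchange.\<close>
    using evolution_c_identity[of "a t r" "q t r" "p t r" "a1 t r" "b t r" "c t r" "a2 t r" "b1 t r" "c1 t r" "b2 t r"]
      a_pq[OF z(2), of t]
    by (simp add: a1_def a2_def algebra_simps)
  show "((\<lambda>\<tau>. b \<tau> r) has_real_derivative
       a t r * b2 t r + (2 * a1 t r + b t r * p t r + 2 * q t r * a t r - q t r * c t r) * b1 t r
         - 2 * b t r * (b t r - a t r) * (p t r)\<^sup>2 - 2 * a t r * b t r * c t r) (at t within I)"
    unfolding eq by (rule db)
qed

lemma dt_a:
  assumes z: "t \<in> I" "0 < r" "r < 1"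
  shows "((\<lambda>\<tau>. a \<tau> r) has_real_derivative
         a t r * a2 t r + (a t r * (p t r + q t r) + q t r * c t r + p t r * b t r) * a1 t r
         + a t r * (a t r * b t r + a t r * c t r - 4 * b t r * c t r
            + (c t r - a t r) * (q t r)\<^sup>2 + (b t r - a t r) * (p t r)\<^sup>2)) (at t within I)"
proof -
  have "((\<lambda>\<tau>. p \<tau> r * q \<tau> r) has_real_derivative
      (a1 t r * c t r + a t r * c1 t r - b t r * c t r * p t r) * q t r
      + (a1 t r * b t r + a t r * b1 t r - b t r * c t r * q t r) * p t r) (at t within I)"
    by (rule DERIV_mult[OF dt_pc(1)[OF z] dt_qb(1)[OF z]])
  moreover have "(\<lambda>\<tau>. p \<tau> r * q \<tau> r) = (\<lambda>\<tau>. a \<tau> r)" using a_pq[OF z(2)] by simp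
  ultimately show ?thesis
    unfolding evolution_a_identity[OF a_pq[OF z(2)] a1_def a2_def, symmetric]
    by (simp only: mult.commute)
qed

section \<open>Behaviour at the core and at the boundary torus\<close>

lemma compact_bound:
  fixes k :: "real \<Rightarrow> real \<Rightarrow> real"
  assumes "continuous_on (I \<times> {0..1}) (\<lambda>z. k (fst z) (snd z))" and T: "T \<in> I"
  shows "\<exists>M>0. \<forall>t r. 0 \<le> t \<longrightarrow> t \<le> T \<longrightarrow> 0 \<le> r \<longrightarrow> r \<le> 1 \<longrightarrow> \<bar>k t r\<bar> \<le> M"
proof -
  have "{0..T} \<times> {0..1} \<subseteq> I \<times> {0..1::real}" using interval_I[OF T] by auto
  then have "continuous_on ({0..T} \<times> {0..1}) (\<lambda>z. k (fst z) (snd z))"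
    by (rule continuous_on_subset[OF assms(1)])
  then have "compact ((\<lambda>z. k (fst z) (snd z)) ` ({0..T} \<times> {0..1}))"
    by (rule compact_continuous_image) (intro compact_Times compact_Icc)
  then have "bounded ((\<lambda>z. k (fst z) (snd z)) ` ({0..T} \<times> {0..1}))" by (rule compact_imp_bounded)
  then obtain M where M: "M > 0" "\<forall>x\<in>(\<lambda>z. k (fst z) (snd z)) ` ({0..T} \<times> {0..1}). norm x \<le> M"
    unfolding bounded_pos by blast
  show ?thesis
  proof (intro exI[of _ M] conjI allI impI)
    fix t r :: real assume "0 \<le> t" "t \<le> T" "0 \<le> r" "r \<le> 1"
    then have "k t r \<in> (\<lambda>z. k (fst z) (snd z)) ` ({0..T} \<times> {0..1})" by (intro image_eqI[of _ _ "(t, r)"]) auto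
    then show "\<bar>k t r\<bar> \<le> M" using M(2) by auto
  qed (rule M(1))
qed

text \<open>Since p grows like 1/r, the claim is that \<alpha> and \<beta> agree at the core to
  second order. \<open>N\<close> is the numerator of \<beta> - \<alpha> over a denominator
  containing one factor f, itself of order r, so order r^3 is required of \<open>N\<close>;
  \<open>R\<close> and \<open>Q\<close> are the factors left after all powers of r are split
  off.\<close>

lemma core_bound:
  assumes T: "T \<in> I"
  shows "\<exists>D. \<forall>t r. 0 \<le> t \<longrightarrow> t \<le> T \<longrightarrow> 0 < r \<longrightarrow> r < 1 \<longrightarrow> \<bar>b t r - a t r\<bar> * (p t r)\<^sup>2 \<le> D"
proof -
  define N where "N t r = (G 2 0 t r * H 0 0 t r - G 1 0 t r * H 1 0 t r) * F 0 0 t r - F 1 0 t r * G 1 0 t r * H 0 0 t r" for t r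
  define R where "R t r = G3r t r * F0r t r * H 0 0 t r - 2 * F 1 0 t r * G1r t r * H1r t r
    - F0r t r * G1r t r * H 2 0 t r - F2r t r * G1r t r * H 0 0 t r" for t r
  define Q where "Q t r = (F 1 0 t r)\<^sup>2 / ((H 0 0 t r)^5 * G 0 0 t r * (F0r t r)^3)" for t r
  have "continuous_on (I \<times> {0..1}) (\<lambda>z. R (fst z) (snd z))"
    unfolding R_def by (intro continuous_intros cont01 cont_quotients)
  then obtain M where M: "M > 0" "\<And>t r. 0 \<le> t \<Longrightarrow> t \<le> T \<Longrightarrow> 0 \<le> r \<Longrightarrow> r \<le> 1 \<Longrightarrow> \<bar>R t r\<bar> \<le> M"
    using compact_bound[OF _ T] by blast
  have nz: "F0r (fst z) (snd z) \<noteq> 0" "G 0 0 (fst z) (snd z) \<noteq> 0" "H 0 0 (fst z) (snd z) \<noteq> 0"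
    if "z \<in> I \<times> {0..1}" for z
    using F0r_pos[of "fst z" "snd z"] pos(2,3)[of "fst z" "snd z"] that by auto
  have "continuous_on (I \<times> {0..1}) (\<lambda>z. Q (fst z) (snd z))"
    unfolding Q_def by (intro continuous_intros cont01 cont_quotients ballI, simp add: nz)
  then obtain M' where M': "M' > 0" "\<And>t r. 0 \<le> t \<Longrightarrow> t \<le> T \<Longrightarrow> 0 \<le> r \<Longrightarrow> r \<le> 1 \<Longrightarrow> \<bar>Q t r\<bar> \<le> M'"
    using compact_bound[OF _ T] by blast
  have "\<bar>b t r - a t r\<bar> * (p t r)\<^sup>2 \<le> M * M'" if tr: "0 \<le> t" "t \<le> T" "0 < r" "r < 1" for t r
  proof -
    have t: "t \<in> I" using interval_I[OF T] tr by auto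
    note z = t tr(3,4)
    \<comment> \<open>Every term of \<open>N\<^sub>r\<close> contains two odd factors, so \<open>N\<^sub>r = O(r\<^sup>2)\<close> and \<open>N = O(r\<^sup>3)\<close>.\<close>
    have dN: "(N t has_real_derivative x\<^sup>2 * R t x) (at x within {0..r})" if x: "0 \<le> x" "x \<le> r" for x
    proof -
      have S: "x \<in> {-1..1}" "{0..r} \<subseteq> {-1..1}" using x tr by auto
      have "(N t has_real_derivative G 3 0 t x * F 0 0 t x * H 0 0 t x - 2 * F 1 0 t x * G 1 0 t x * H 1 0 t x
          - F 0 0 t x * G 1 0 t x * H 2 0 t x - F 2 0 t x * G 1 0 t x * H 0 0 t x) (at x within {0..r})"
        unfolding N_def[abs_def]
        using dr_sub[OF t S, of 0 0] dr_sub[OF t S, of 1 0] dr_sub[OF t S, of 2 0]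
        by (auto intro!: derivative_eq_intros simp: algebra_simps numeral_2_eq_2 numeral_3_eq_3)
      moreover have "G 3 0 t x * F 0 0 t x * H 0 0 t x - 2 * F 1 0 t x * G 1 0 t x * H 1 0 t x
          - F 0 0 t x * G 1 0 t x * H 2 0 t x - F 2 0 t x * G 1 0 t x * H 0 0 t x = x\<^sup>2 * R t x"
      proof (cases "x = 0")
        case True then show ?thesis using vanish_at_core[OF t] by simp
      next
        case False
        then have "G 3 0 t x = x * G3r t x" "F 0 0 t x = x * F0r t x" "G 1 0 t x = x * G1r t x"
          "H 1 0 t x = x * H1r t x" "F 2 0 t x = x * F2r t x"
          by (simp_all add: G3r_def F0r_def G1r_def H1r_def F2r_def)
        then show ?thesis by (simp add: R_def algebra_simps power2_eq_square)
      qed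
      ultimately show ?thesis by simp
    qed
    have N0: "N t 0 = 0" using vanish_at_core[OF t] by (simp add: N_def)
    have "norm (N t r - N t 0) \<le> M * r\<^sup>2 * norm (r - 0)"
    proof (rule field_differentiable_bound[where S = "{0..r}"])
      fix x assume x: "x \<in> {0..r}"
      then show "(N t has_field_derivative x\<^sup>2 * R t x) (at x within {0..r})" using dN by auto
      have "x\<^sup>2 * \<bar>R t x\<bar> \<le> r\<^sup>2 * M" using x tr M by (intro mult_mono power_mono) auto
      then show "norm (x\<^sup>2 * R t x) \<le> M * r\<^sup>2" by (simp add: abs_mult mult.commute)
    qed (use tr in auto)
    then have N: "\<bar>N t r\<bar> \<le> M * r^3" using N0 tr by (simp add: power2_eq_square power3_eq_cube)
    note pos = positive_off_core[OF z]
    have ba: "b t r - a t r = N t r / ((H 0 0 t r)^3 * G 0 0 t r * F 0 0 t r)"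
      using pos by (simp add: a_off_core[OF tr(3)] b_def N_def field_simps power2_eq_square power3_eq_cube)
    have "(b t r - a t r) * (p t r)\<^sup>2 = N t r / r^3 * Q t r"
      unfolding ba p_def Q_def F0r_def using pos tr
      by (simp add: divide_simps) (simp add: eval_nat_numeral)
    then have "\<bar>b t r - a t r\<bar> * (p t r)\<^sup>2 = \<bar>N t r / r^3\<bar> * \<bar>Q t r\<bar>"
      by (metis abs_mult abs_power2)
    also have "\<bar>N t r / r^3\<bar> = \<bar>N t r\<bar> / r^3" using tr by (simp add: abs_divide)
    also have "\<bar>N t r\<bar> / r^3 * \<bar>Q t r\<bar> \<le> M * M'"
      using M' M(1) N tr by (intro mult_mono) (auto simp: divide_le_eq)
    finally show ?thesis .
  qed
  then show ?thesis by blast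
qed

text \<open>The logarithmic derivative of (1 + 4t)^(1/4) is 1/(1 + 4t), so the flow at r = 1 makes
  all three pairwise products of the curvatures equal to 1/(1 + 4t). Positivity selects the positive
  root.\<close>

lemma outer_boundary:
  assumes t: "t \<in> I" and pos1: "0 < a t 1" "0 < b t 1" "0 < c t 1"
  shows "a t 1 = (1 + 4 * t) powr (-1/2)" "b t 1 = (1 + 4 * t) powr (-1/2)" "c t 1 = (1 + 4 * t) powr (-1/2)"
proof -
  have t0: "0 < 1 + 4 * t" using I(3)[OF t] by simp
  have growth: "e = 1 / (1 + 4 * t)"
    if d: "((\<lambda>\<tau>. K \<tau>) has_real_derivative e * K t) (at t within I)" and k0: "0 < k0"
      and K: "\<And>t. t \<in> I \<Longrightarrow> 0 < K t" "\<And>t. t \<in> I \<Longrightarrow> ln (K t) = ln (k0 * (1 + 4 * t) powr (1/4))"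
    for e k0 :: real and K :: "real \<Rightarrow> real"
  proof -
    have Keq: "K t = k0 * (1 + 4 * t) powr (1/4)" if "t \<in> I" for t
      using K[OF that] k0 I(3)[OF that] by (subst (asm) ln_inj_iff) auto
    have "((\<lambda>\<tau>. 1 + 4 * \<tau>) has_real_derivative 4) (at t within I)"
      by (auto intro!: derivative_eq_intros)
    from DERIV_cmult[OF DERIV_chain'[OF this has_real_derivative_powr[OF t0, of "1/4"]], of k0]
    have "((\<lambda>\<tau>. k0 * (1 + 4 * \<tau>) powr (1/4)) has_real_derivative k0 * ((1 + 4 * t) powr (1/4) / (1 + 4 * t))) (at t within I)"
      using powr_diff[of "1 + 4 * t" "1/4" 1] t0 by simp
    then have "(K has_real_derivative k0 * ((1 + 4 * t) powr (1/4) / (1 + 4 * t))) (at t within I)"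
      by (rule has_field_derivative_transform_within[OF _ zero_less_one t]) (simp add: Keq)
    then have "e * K t = k0 * ((1 + 4 * t) powr (1/4) / (1 + 4 * t))"
      using has_field_derivative_unique[OF d _ nontrivial_at[OF t]] by blast
    then have "e * K t = 1 / (1 + 4 * t) * K t" using Keq[OF t] by simp
    moreover have "K t \<noteq> 0" using K(1)[OF t] by simp
    ultimately show ?thesis by (rule mult_right_cancel[THEN iffD1, rotated])
  qed
  have one: "(1::real) \<in> {-1..1}" by simp
  note d = dt[OF t one, of 0 0, folded One_nat_def, unfolded flow_equations[OF t zero_less_one order_refl]]
  note bc' = bc[unfolded boundary_conditions_def, rule_format]
  have f: "0 < F 0 0 t 1 \<and> 0 < G 0 0 t 1 \<and> 0 < H 0 0 t 1 \<and> F 0 0 t 1 = f t 1 \<and> G 0 0 t 1 = g t 1 \<and> H 0 0 t 1 = h t 1" if "t \<in> I" for t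
    using pos[OF that, of 1] FGH[OF that, of 1] by simp
  have "a t 1 * c t 1 = 1 / (1 + 4 * t)"
    by (rule growth[OF d(1), of "f 0 1"]) (use f bc' I(2) in \<open>force+\<close>)
  moreover have "a t 1 * b t 1 = 1 / (1 + 4 * t)"
    by (rule growth[OF d(2), of "g 0 1"]) (use f bc' I(2) in \<open>force+\<close>)
  moreover have "b t 1 * c t 1 = 1 / (1 + 4 * t)"
    by (rule growth[OF d(3), of 1]) (use f bc' I(2) in \<open>force+\<close>)
  ultimately have eq: "b t 1 = a t 1" "c t 1 = a t 1" and sq: "(a t 1)\<^sup>2 = 1 / (1 + 4 * t)"
    using pos1 by (auto simp: power2_eq_square) (metis mult.commute mult_right_cancel less_irrefl)+
  have pw: "((1 + 4 * t) powr (-1/2))\<^sup>2 = 1 / (1 + 4 * t)"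
    using powr_add[of "1 + 4 * t" "-1/2" "-1/2"] powr_neg_one[OF t0] by (simp add: power2_eq_square)
  have "a t 1 = (1 + 4 * t) powr (-1/2)"
    by (rule power2_eq_imp_eq[OF trans[OF sq pw[symmetric]] less_imp_le[OF pos1(1)]]) simp
  then show "a t 1 = (1 + 4 * t) powr (-1/2)" "b t 1 = (1 + 4 * t) powr (-1/2)" "c t 1 = (1 + 4 * t) powr (-1/2)"
    using eq by simp_all
qed

section \<open>Application of the maximum principle and the continuation argument\<close>

lemma curvature_evolution_exists:
  assumes T: "T \<in> I" and L0: "0 < L0"
    and init: "\<And>r. 0 \<le> r \<Longrightarrow> r \<le> 1 \<Longrightarrow> L0 \<le> a 0 r \<and> a 0 r \<le> K0"
      "\<And>r. 0 \<le> r \<Longrightarrow> r \<le> 1 \<Longrightarrow> L0 \<le> b 0 r \<and> b 0 r \<le> K0"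
      "\<And>r. 0 \<le> r \<Longrightarrow> r \<le> 1 \<Longrightarrow> L0 \<le> c 0 r \<and> c 0 r \<le> K0"
    and positive: "\<And>t r. 0 \<le> t \<Longrightarrow> t \<le> T \<Longrightarrow> 0 \<le> r \<Longrightarrow> r \<le> 1 \<Longrightarrow> 0 < a t r \<and> 0 < b t r \<and> 0 < c t r"
  shows "\<exists>D U. curvature_evolution T a b c p q (\<lambda>t r. ln (F 0 0 t r)) (H 0 0) (H 1 0) a1 a2 b1 b2 c1 c2 K0 L0 D U"
proof -
  obtain D where D: "\<And>t r. 0 \<le> t \<Longrightarrow> t \<le> T \<Longrightarrow> 0 < r \<Longrightarrow> r < 1 \<Longrightarrow> \<bar>b t r - a t r\<bar> * (p t r)\<^sup>2 \<le> D"
    using core_bound[OF T] by blast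
  obtain M where M: "M > 0" "\<And>t r. 0 \<le> t \<Longrightarrow> t \<le> T \<Longrightarrow> 0 \<le> r \<Longrightarrow> r \<le> 1 \<Longrightarrow> \<bar>F0r t r\<bar> \<le> M"
    using compact_bound[OF cont_quotients(1) T] by blast
  have TI: "t \<in> I" if "0 \<le> t" "t \<le> T" for t using interval_I[OF T that] .
  have sub: "{0..T} \<subseteq> I" using TI by auto
  \<comment> \<open>That is, u is at most ln r + ln M. It supplies the upper bound
    \<open>ln M\<close> for u and, with radius \<open>exp B / M\<close>, its uniform divergence at
    the core.\<close>
  have F_le: "F 0 0 t r \<le> r * M" if "0 \<le> t" "t \<le> T" "0 < r" "r \<le> 1" for t r
  proof -
    have "F 0 0 t r = r * F0r t r" using that by (simp add: F0r_def)
    also have "\<dots> \<le> r * M" using M(2)[of t r] that by (intro mult_left_mono) auto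
    finally show ?thesis .
  qed
  have "curvature_evolution T a b c p q (\<lambda>t r. ln (F 0 0 t r)) (H 0 0) (H 1 0) a1 a2 b1 b2 c1 c2 K0 L0 D (ln M)"
  proof
    show "0 \<le> T" using I(3)[OF T] .
    have "{0..T} \<times> {0..1} \<subseteq> I \<times> {0..1::real}" using sub by auto
    then show "continuous_on ({0..T} \<times> {0..1}) (\<lambda>(t, r). a t r)"
      "continuous_on ({0..T} \<times> {0..1}) (\<lambda>(t, r). b t r)"
      "continuous_on ({0..T} \<times> {0..1}) (\<lambda>(t, r). c t r)"
      using cont_abc continuous_on_subset by blast+
    have "continuous_on ({0..T} \<times> {0<..1}) (\<lambda>z. F 0 0 (fst z) (snd z))"
      by (rule continuous_on_subset[OF cont01(1)]) (use sub in auto)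
    then show "continuous_on ({0..T} \<times> {0<..1}) (\<lambda>(t, r). ln (F 0 0 t r))"
      unfolding case_prod_beta using pos(1) TI by (intro continuous_on_ln) force+
    show "ln (F 0 0 t r) \<le> ln M" if "0 \<le> t" "t \<le> T" "0 < r" "r \<le> 1" for t r
    proof -
      have "F 0 0 t r \<le> r * M" using F_le that by simp
      also have "\<dots> \<le> 1 * M" using that M by (intro mult_right_mono) auto
      finally show ?thesis using pos(1)[of t r] TI that M by (subst ln_le_cancel_iff) auto
    qed
    show "\<exists>\<delta>>0. \<forall>t r. 0 \<le> t \<longrightarrow> t \<le> T \<longrightarrow> 0 < r \<longrightarrow> r < \<delta> \<longrightarrow> r \<le> 1 \<longrightarrow> ln (F 0 0 t r) \<le> B" for B
    proof (intro exI[of _ "exp B / M"] conjI allI impI)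
      show "0 < exp B / M" using M by simp
      fix t r assume *: "0 \<le> t" "t \<le> T" "0 < r" "r < exp B / M" "r \<le> 1"
      have "F 0 0 t r \<le> r * M" using F_le * by simp
      also have "\<dots> \<le> exp B" using * M by (simp add: field_simps)
      finally show "ln (F 0 0 t r) \<le> B" using pos(1)[of t r] TI * by (metis ln_exp ln_le_cancel_iff exp_gt_zero)
    qed
    fix t r :: real assume tr: "0 \<le> t" "t \<le> T" "0 < r" "r < 1"
    then have z: "t \<in> I" "0 < r" "r < 1" using TI by auto
    note pos = positive_off_core[OF z]
    show "0 < H 0 0 t r" by fact
    show "a t r = p t r * q t r" using z by (simp add: a_pq)
    show "a1 t r = (c t r - a t r) * q t r + (b t r - a t r) * p t r" by (rule a1_def)
    show "\<bar>b t r - a t r\<bar> * (p t r)\<^sup>2 \<le> D" using D tr by simp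
    show "(H 0 0 t has_real_derivative H 1 0 t r) (at r)" using dr_at(3)[OF z, of 0 0] by simp
    show "((\<lambda>r. ln (F 0 0 t r)) has_real_derivative H 0 0 t r * p t r) (at r)"
      using dr_at(1)[OF z, of 0 0] pos by (auto intro!: derivative_eq_intros simp: p_def)
    show "(p t has_real_derivative H 0 0 t r * (c t r - (p t r)\<^sup>2)) (at r)" by (rule dr_p[OF z])
    show "(a t has_real_derivative H 0 0 t r * a1 t r) (at r)" "(a1 t has_real_derivative H 0 0 t r * a2 t r) (at r)"
      by (rule dr_a[OF z])+
    show "(b t has_real_derivative H 0 0 t r * b1 t r) (at r)" "(b1 t has_real_derivative H 0 0 t r * b2 t r) (at r)"
      "(c t has_real_derivative H 0 0 t r * c1 t r) (at r)" "(c1 t has_real_derivative H 0 0 t r * c2 t r) (at r)"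
      by (rule dr_bc[OF z])+
    show "((\<lambda>\<tau>. ln (F 0 0 \<tau> r)) has_real_derivative a t r * c t r) (at t within {0..T})"
      using dt(1)[OF z(1), of r 0 0, THEN DERIV_subset, OF _ sub] pos flow_equations(1)[OF z(1,2)] tr
      by (auto intro!: derivative_eq_intros)
    show "((\<lambda>\<tau>. a \<tau> r) has_real_derivative
         a t r * a2 t r + (a t r * (p t r + q t r) + q t r * c t r + p t r * b t r) * a1 t r
         + a t r * (a t r * b t r + a t r * c t r - 4 * b t r * c t r
            + (c t r - a t r) * (q t r)\<^sup>2 + (b t r - a t r) * (p t r)\<^sup>2)) (at t within {0..T})"
      by (rule DERIV_subset[OF dt_a[OF z] sub])
    show "((\<lambda>\<tau>. b \<tau> r) has_real_derivative
         a t r * b2 t r + (2 * a1 t r + b t r * p t r + 2 * q t r * a t r - q t r * c t r) * b1 t r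
         - 2 * b t r * (b t r - a t r) * (p t r)\<^sup>2 - 2 * a t r * b t r * c t r) (at t within {0..T})"
      by (rule DERIV_subset[OF dt_qb(2)[OF z] sub])
    show "((\<lambda>\<tau>. c \<tau> r) has_real_derivative
         a t r * c2 t r + (2 * a1 t r + c t r * q t r + 2 * p t r * a t r - p t r * b t r) * c1 t r
         - 2 * c t r * (c t r - a t r) * (q t r)\<^sup>2 - 2 * a t r * b t r * c t r) (at t within {0..T})"
      by (rule DERIV_subset[OF dt_pc(2)[OF z] sub])
  next
    fix t assume "0 \<le> t" "t \<le> T"
    then show "a t 1 = (1 + 4 * t) powr (-1/2)" "b t 1 = (1 + 4 * t) powr (-1/2)" "c t 1 = (1 + 4 * t) powr (-1/2)"
      using outer_boundary[of t] TI positive[of t 1] by auto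
  qed (use init L0 positive in auto)
  then show ?thesis by blast
qed

lemma bounds_while_positive:
  assumes T: "T \<in> I" and L0: "0 < L0"
    and init: "\<And>r. 0 \<le> r \<Longrightarrow> r \<le> 1 \<Longrightarrow> L0 \<le> a 0 r \<and> a 0 r \<le> K0"
      "\<And>r. 0 \<le> r \<Longrightarrow> r \<le> 1 \<Longrightarrow> L0 \<le> b 0 r \<and> b 0 r \<le> K0"
      "\<And>r. 0 \<le> r \<Longrightarrow> r \<le> 1 \<Longrightarrow> L0 \<le> c 0 r \<and> c 0 r \<le> K0"
    and positive: "\<And>t r. 0 \<le> t \<Longrightarrow> t \<le> T \<Longrightarrow> 0 \<le> r \<Longrightarrow> r \<le> 1 \<Longrightarrow> 0 < a t r \<and> 0 < b t r \<and> 0 < c t r"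
    and r: "0 \<le> r" "r \<le> 1"
  shows "a T r \<le> K0 \<and> b T r \<le> K0 \<and> c T r \<le> K0"
    "L0 * exp (- 4 * K0\<^sup>2 * T) \<le> a T r \<and> L0 * exp (- 4 * K0\<^sup>2 * T) \<le> b T r \<and> L0 * exp (- 4 * K0\<^sup>2 * T) \<le> c T r"
    "L0 / (4 * K0 * L0 * T + 1) \<le> a T r"
proof -
  obtain D U where "curvature_evolution T a b c p q (\<lambda>t r. ln (F 0 0 t r)) (H 0 0) (H 1 0) a1 a2 b1 b2 c1 c2 K0 L0 D U"
    using curvature_evolution_exists[OF assms(1-6)] by blast
  then interpret curvature_evolution T a b c p q "\<lambda>t r. ln (F 0 0 t r)" "H 0 0" "H 1 0" a1 a2 b1 b2 c1 c2 K0 L0 D U .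
  have T': "0 \<le> T" "T \<le> T" using I(3)[OF assms(1)] by auto
  show "a T r \<le> K0 \<and> b T r \<le> K0 \<and> c T r \<le> K0" by (rule upper_bound[OF T' r])
  show "L0 * exp (- 4 * K0\<^sup>2 * T) \<le> a T r \<and> L0 * exp (- 4 * K0\<^sup>2 * T) \<le> b T r \<and> L0 * exp (- 4 * K0\<^sup>2 * T) \<le> c T r"
    using exp_lower_bound_a[OF T' r] lower_bound_b[OF T' r] lower_bound_c[OF T' r] by blast
  show "L0 / (4 * K0 * L0 * T + 1) \<le> a T r" by (rule lower_bound_a[OF T' r])
qed

text \<open>The lower bound of \<open>bounds_while_positive\<close> stays away from zero up to a first time at which
  positivity could fail.\<close>

lemma positivity_preserved:
  assumes L0: "0 < L0"
    and init: "\<And>r. 0 \<le> r \<Longrightarrow> r \<le> 1 \<Longrightarrow> L0 \<le> a 0 r \<and> a 0 r \<le> K0"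
      "\<And>r. 0 \<le> r \<Longrightarrow> r \<le> 1 \<Longrightarrow> L0 \<le> b 0 r \<and> b 0 r \<le> K0"
      "\<And>r. 0 \<le> r \<Longrightarrow> r \<le> 1 \<Longrightarrow> L0 \<le> c 0 r \<and> c 0 r \<le> K0"
    and T: "T \<in> I" and r: "0 \<le> r" "r \<le> 1"
  shows "0 < a T r \<and> 0 < b T r \<and> 0 < c T r"
proof (rule ccontr)
  assume neg: "\<not> ?thesis"
  define m where "m z = min (a (fst z) (snd z)) (min (b (fst z) (snd z)) (c (fst z) (snd z)))" for z
  let ?S = "{0..T} \<times> {0..1::real}"
  have TI: "t \<in> I" if "0 \<le> t" "t \<le> T" for t using interval_I[OF T that] .
  have T0: "0 \<le> T" using I(3)[OF T] .
  have contm: "continuous_on ?S m"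
  proof -
    have "?S \<subseteq> I \<times> {0..1}" using TI by auto
    then show ?thesis
      unfolding m_def using cont_abc[unfolded case_prod_beta] continuous_on_subset
      by (intro continuous_intros; blast)
  qed
  \<comment> \<open>The times at which some curvature fails to be positive somewhere. As the
    projection of a compact set, \<open>Z\<close> contains its first time \<open>t0\<close>.\<close>
  define Z where "Z = fst ` {z \<in> ?S. m z \<le> 0}"
  have S: "compact ?S" by (intro compact_Times compact_Icc)
  have "closed {z \<in> ?S. m z \<le> 0}"
    by (intro continuous_on_closed_Collect_le contm continuous_on_const compact_imp_closed S)
  then have "compact (?S \<inter> {z \<in> ?S. m z \<le> 0})" by (rule compact_Int_closed[OF S])
  moreover have "?S \<inter> {z \<in> ?S. m z \<le> 0} = {z \<in> ?S. m z \<le> 0}" by blast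
  ultimately have "compact {z \<in> ?S. m z \<le> 0}" by simp
  then have Z: "compact Z" unfolding Z_def by (intro compact_continuous_image continuous_intros)
  have "(T, r) \<in> {z \<in> ?S. m z \<le> 0}" using neg T0 r by (auto simp: m_def min_le_iff_disj not_less)
  then have "Z \<noteq> {}" unfolding Z_def by blast
  then obtain t0 where t0: "t0 \<in> Z" "\<And>t. t \<in> Z \<Longrightarrow> t0 \<le> t" using compact_attains_inf[OF Z] by blast
  then obtain r0 where r0: "0 \<le> t0" "t0 \<le> T" "0 \<le> r0" "r0 \<le> 1" "m (t0, r0) \<le> 0" by (auto simp: Z_def)
  have before: "0 < a t r \<and> 0 < b t r \<and> 0 < c t r" if "0 \<le> t" "t < t0" "0 \<le> r" "r \<le> 1" for t r
  proof (rule ccontr)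
    assume "\<not> ?thesis"
    then have "(t, r) \<in> {z \<in> ?S. m z \<le> 0}" using that r0 by (auto simp: m_def min_le_iff_disj not_less)
    then have "t \<in> Z" unfolding Z_def by force
    then show False using t0(2)[of t] that by simp
  qed
  have "t0 \<noteq> 0" using r0 init[of r0] L0 by (auto simp: m_def min_le_iff_disj)
  then have "0 < t0" using r0 by simp
  \<comment> \<open>The exponential bound decreases in time, so its value at \<open>t0\<close> is a
    positive lower bound at every earlier time and, by continuity, at \<open>t0\<close>.\<close>
  define \<delta> where "\<delta> = L0 * exp (- 4 * K0\<^sup>2 * t0)"
  have low: "\<delta> \<le> m (t, r0)" if "0 \<le> t" "t < t0" for t
  proof -
    have tI: "t \<in> I" using TI that r0 by auto
    have "\<delta> \<le> L0 * exp (- 4 * K0\<^sup>2 * t)"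
      using L0 that mult_left_mono[of t t0 "4 * K0\<^sup>2"] by (simp add: \<delta>_def)
    also have "\<dots> \<le> m (t, r0)"
      using bounds_while_positive(2)[OF tI L0 init _ r0(3,4)] before that by (simp add: m_def)
    finally show ?thesis .
  qed
  have "((\<lambda>t. m (t, r0)) \<longlongrightarrow> m (t0, r0)) (at t0 within {0..T})"
  proof -
    have "continuous_on {0..T} (\<lambda>t. (t, r0))" by (intro continuous_intros)
    then have "continuous_on {0..T} (\<lambda>t. m (t, r0))"
      by (rule continuous_on_compose2[OF contm]) (use r0 in auto)
    then show ?thesis using r0 by (simp add: continuous_on_def)
  qed
  then have "((\<lambda>t. m (t, r0)) \<longlongrightarrow> m (t0, r0)) (at t0 within {0..<t0})"
    by (rule tendsto_within_subset) (use r0 in auto)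
  moreover have "at t0 within {0..<t0} \<noteq> bot" using \<open>0 < t0\<close> by (simp add: trivial_limit_within)
  moreover have "\<forall>\<^sub>F t in at t0 within {0..<t0}. \<delta> \<le> m (t, r0)"
    using low by (auto simp: eventually_at_filter)
  ultimately have "\<delta> \<le> m (t0, r0)" by (intro tendsto_lowerbound)
  moreover have "0 < \<delta>" using L0 by (simp add: \<delta>_def)
  ultimately show False using r0(5) by simp
qed

end

section \<open>Preservation of negative curvature\<close>

lemma smooth_familyD:
  assumes "smooth_family_on I A \<Phi>"
  shows "\<exists>D. (\<forall>t\<in>I. \<forall>r\<in>A. D 0 0 t r = \<Phi> t r) \<and>
    (\<forall>i j. continuous_on (I \<times> A) (\<lambda>(t, r). D i j t r)) \<and>
    (\<forall>i j. \<forall>t\<in>I. \<forall>r\<in>A. (D i j t has_real_derivative D (Suc i) j t r) (at r within A)) \<and>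
    (\<forall>i j. \<forall>t\<in>I. \<forall>r\<in>A. ((\<lambda>\<tau>. D i j \<tau> r) has_real_derivative D i (Suc j) t r) (at t within I))"
proof -
  from assms obtain D where "\<forall>t\<in>I. \<forall>r\<in>A. D 0 0 t r = \<Phi> t r"
    "\<forall>i j. continuous_on (I \<times> A) (\<lambda>(t, r). D i j t r)"
    "\<forall>i j. \<forall>t\<in>I. \<forall>r\<in>A.
           ((\<lambda>\<rho>. D i j t \<rho>) has_real_derivative D (Suc i) j t r) (at r within A) \<and>
           ((\<lambda>\<tau>. D i j \<tau> r) has_real_derivative D i (Suc j) t r) (at t within I)"
    unfolding smooth_family_on_def by (elim exE conjE)
  then show ?thesis by (intro exI[of _ D]) simp
qed

lemma rot_flow_exists:
  assumes I: "is_interval I" "0 \<in> I" "\<forall>t\<in>I. 0 \<le> t" "I \<noteq> {0}"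
    and flow: "cross_curvature_flow I f g h" and bc: "boundary_conditions I f g h"
  shows "\<exists>F G H. rot_flow I f g h F G H"
proof -
  have smooth: "smooth_rot_metrics I f g h" using flow by (simp add: cross_curvature_flow_def)
  then have "smooth_odd_family I f" "smooth_even_family I g" "smooth_even_family I h"
    by (simp_all add: smooth_rot_metrics_def)
  then obtain f' g' h' where f': "smooth_family_on I {-1..1} f'"
      "\<forall>t\<in>I. \<forall>r\<in>{-1..1}. f' t (- r) = - f' t r" "\<forall>t\<in>I. \<forall>r\<in>{0..1}. f' t r = f t r"
    and g': "smooth_family_on I {-1..1} g'"
      "\<forall>t\<in>I. \<forall>r\<in>{-1..1}. g' t (- r) = g' t r" "\<forall>t\<in>I. \<forall>r\<in>{0..1}. g' t r = g t r"
    and h': "smooth_family_on I {-1..1} h'"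
      "\<forall>t\<in>I. \<forall>r\<in>{-1..1}. h' t (- r) = h' t r" "\<forall>t\<in>I. \<forall>r\<in>{0..1}. h' t r = h t r"
    unfolding smooth_odd_family_def smooth_even_family_def by (elim exE conjE)
  from smooth_familyD[OF f'(1)] obtain F where F: "\<forall>t\<in>I. \<forall>r\<in>{-1..1}. F 0 0 t r = f' t r"
    "\<forall>i j. continuous_on (I \<times> {-1..1}) (\<lambda>(t, r). F i j t r)"
    "\<forall>i j. \<forall>t\<in>I. \<forall>r\<in>{-1..1}. (F i j t has_real_derivative F (Suc i) j t r) (at r within {-1..1})"
    "\<forall>i j. \<forall>t\<in>I. \<forall>r\<in>{-1..1}. ((\<lambda>\<tau>. F i j \<tau> r) has_real_derivative F i (Suc j) t r) (at t within I)"
    by (elim exE conjE)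
  from smooth_familyD[OF g'(1)] obtain G where G: "\<forall>t\<in>I. \<forall>r\<in>{-1..1}. G 0 0 t r = g' t r"
    "\<forall>i j. continuous_on (I \<times> {-1..1}) (\<lambda>(t, r). G i j t r)"
    "\<forall>i j. \<forall>t\<in>I. \<forall>r\<in>{-1..1}. (G i j t has_real_derivative G (Suc i) j t r) (at r within {-1..1})"
    "\<forall>i j. \<forall>t\<in>I. \<forall>r\<in>{-1..1}. ((\<lambda>\<tau>. G i j \<tau> r) has_real_derivative G i (Suc j) t r) (at t within I)"
    by (elim exE conjE)
  from smooth_familyD[OF h'(1)] obtain H where H: "\<forall>t\<in>I. \<forall>r\<in>{-1..1}. H 0 0 t r = h' t r"
    "\<forall>i j. continuous_on (I \<times> {-1..1}) (\<lambda>(t, r). H i j t r)"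
    "\<forall>i j. \<forall>t\<in>I. \<forall>r\<in>{-1..1}. (H i j t has_real_derivative H (Suc i) j t r) (at r within {-1..1})"
    "\<forall>i j. \<forall>t\<in>I. \<forall>r\<in>{-1..1}. ((\<lambda>\<tau>. H i j \<tau> r) has_real_derivative H i (Suc j) t r) (at t within I)"
    by (elim exE conjE)
  have FGH: "F 0 0 t r = f t r \<and> G 0 0 t r = g t r \<and> H 0 0 t r = h t r" if "t \<in> I" "0 \<le> r" "r \<le> 1" for t r
    using F(1) G(1) H(1) f'(3) g'(3) h'(3) that by simp
  have pos: "0 < f t r" if "t \<in> I" "0 < r" "r \<le> 1" for t r
    using smooth that by (simp add: smooth_rot_metrics_def)
  have pos2: "0 < g t r" "0 < h t r" if "t \<in> I" "0 \<le> r" "r \<le> 1" for t r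
    using smooth that by (simp_all add: smooth_rot_metrics_def)
  \<comment> \<open>Smoothness across the core prescribes the slope 2 pi h(0) of f at r = 0; its
    positivity keeps the quotient f/r away from 0 there.\<close>
  have slope: "0 < F 1 0 t 0" if t: "t \<in> I" for t
  proof -
    have "(F 0 0 t has_real_derivative F (Suc 0) 0 t 0) (at 0 within {0..1})"
      by (rule DERIV_subset[of _ _ _ "{-1..1}"]) (use F(3) t in auto)
    then have "(f t has_real_derivative F (Suc 0) 0 t 0) (at 0 within {0..1})"
      by (rule has_field_derivative_transform_within[OF _ zero_less_one]) (use FGH t in auto)
    then have "d_r (f t) 0 = F 1 0 t 0"
      unfolding d_r_def One_nat_def has_real_derivative_iff_has_vector_derivative
      by (intro vector_derivative_within) (auto simp: trivial_limit_within)
    moreover have "d_r (f t) 0 = 2 * pi * h t 0" using smooth t by (simp add: smooth_rot_metrics_def)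
    moreover have "0 < 2 * pi * h t 0" using pos2(2)[of t 0] t by simp
    ultimately show ?thesis by simp
  qed
  have "rot_flow I f g h F G H"
  proof
    show "is_interval I" "0 \<in> I" "I \<noteq> {0}" by fact+
    show "0 \<le> t" if "t \<in> I" for t using I(3) that by blast
    show "continuous_on (I \<times> {- 1..1}) (\<lambda>(t, r). F i j t r)" "continuous_on (I \<times> {- 1..1}) (\<lambda>(t, r). G i j t r)"
      "continuous_on (I \<times> {- 1..1}) (\<lambda>(t, r). H i j t r)" for i j
      using F(2) G(2) H(2) by simp_all
    fix t assume t: "t \<in> I"
    show "0 < F 1 0 t 0" by (rule slope[OF t])
    show "((\<lambda>\<tau>. rot_metric (f \<tau>) (g \<tau>) (h \<tau>) x $ i $ j) has_real_derivative
        - 2 * cross_curvature chart (rot_metric (f t) (g t) (h t)) i j x) (at t within I)"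
      if "x \<in> chart" for x i j
      using flow t that unfolding cross_curvature_flow_def by blast
    fix r :: real
    show "0 < F 0 0 t r" if "0 < r" "r \<le> 1" using FGH[OF t, of r] pos[OF t, of r] that by simp
    show "F 0 0 t r = f t r \<and> G 0 0 t r = g t r \<and> H 0 0 t r = h t r" "0 < G 0 0 t r" "0 < H 0 0 t r" if "0 \<le> r" "r \<le> 1"
      using FGH[OF t, of r] pos2[OF t, of r] that by simp_all
    assume r: "r \<in> {-1..1}"
    show "F 0 0 t (- r) = - F 0 0 t r" "G 0 0 t (- r) = G 0 0 t r" "H 0 0 t (- r) = H 0 0 t r"
      using F(1) G(1) H(1) f'(2) g'(2) h'(2) t r by simp_all
    show "(F i j t has_real_derivative F (Suc i) j t r) (at r within {- 1..1})"
      "(G i j t has_real_derivative G (Suc i) j t r) (at r within {- 1..1})"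
      "(H i j t has_real_derivative H (Suc i) j t r) (at r within {- 1..1})"
      "((\<lambda>\<tau>. F i j \<tau> r) has_real_derivative F i (Suc j) t r) (at t within I)"
      "((\<lambda>\<tau>. G i j \<tau> r) has_real_derivative G i (Suc j) t r) (at t within I)"
      "((\<lambda>\<tau>. H i j \<tau> r) has_real_derivative H i (Suc j) t r) (at t within I)" for i j
      using F(3,4) G(3,4) H(3,4) t r by simp_all
  qed (rule bc)
  then show ?thesis by blast
qed

text \<open>The initial curvature values form a compact set, so the infimum is attained and inherits
  strict positivity from negative curvature.\<close>

lemma (in rot_flow) initial_bounds:
  assumes neg: "negative_sectional_curvature (f 0) (g 0) (h 0)"
  defines "S \<equiv> curvature_values (f 0) (g 0) (h 0)"
  shows "0 < Inf S"
    "0 \<le> r \<Longrightarrow> r \<le> 1 \<Longrightarrow> Inf S \<le> a 0 r \<and> a 0 r \<le> Sup S"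
    "0 \<le> r \<Longrightarrow> r \<le> 1 \<Longrightarrow> Inf S \<le> b 0 r \<and> b 0 r \<le> Sup S"
    "0 \<le> r \<Longrightarrow> r \<le> 1 \<Longrightarrow> Inf S \<le> c 0 r \<and> c 0 r \<le> Sup S"
proof -
  have S: "S = a 0 ` {0..1} \<union> b 0 ` {0..1} \<union> c 0 ` {0..1}"
    unfolding S_def curvature_values_def using principal_curvatures[OF I(2)] by auto
  have "continuous_on {0..1::real} (Pair (0::real))" by (intro continuous_intros)
  moreover have "Pair 0 ` {0..1::real} \<subseteq> I \<times> {0..1}" using I(2) by auto
  ultimately have slice: "continuous_on {0..1} (k 0)" if "continuous_on (I \<times> {0..1}) (\<lambda>(t, r). k t r)" for k :: "real \<Rightarrow> real \<Rightarrow> real"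
    using continuous_on_compose2[OF that] by force
  have "compact S" unfolding S
    by (intro compact_Un compact_continuous_image slice cont_abc compact_Icc)
  then have bdd: "bdd_above S" "bdd_below S" and cl: "closed S"
    by (auto intro: compact_imp_closed compact_imp_bounded bounded_imp_bdd_above bounded_imp_bdd_below)
  have "S \<noteq> {}" unfolding S by auto
  then have "Inf S \<in> S" using closed_contains_Inf bdd(2) cl by blast
  then show "0 < Inf S" using neg unfolding negative_sectional_curvature_iff[OF I(2)] by (auto simp: S)
  have "Inf S \<le> x \<and> x \<le> Sup S" if "x \<in> S" for x
    using cInf_lower[OF that bdd(2)] cSup_upper[OF that bdd(1)] by simp
  then show "0 \<le> r \<Longrightarrow> r \<le> 1 \<Longrightarrow> Inf S \<le> a 0 r \<and> a 0 r \<le> Sup S"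
    "0 \<le> r \<Longrightarrow> r \<le> 1 \<Longrightarrow> Inf S \<le> b 0 r \<and> b 0 r \<le> Sup S"
    "0 \<le> r \<Longrightarrow> r \<le> 1 \<Longrightarrow> Inf S \<le> c 0 r \<and> c 0 r \<le> Sup S"
    by (simp_all add: S)
qed

theorem theorem5:
  fixes f g h :: "real \<Rightarrow> real \<Rightarrow> real"
    and I :: "real set"
    and \<theta> K0 L0 :: real
  assumes "0 < \<theta>" and "\<theta> < 1"
    and "is_interval I" and "0 \<in> I" and "\<forall>t\<in>I. 0 \<le> t" and "I \<noteq> {0}"
    and "cross_curvature_flow I f g h"
    and "boundary_conditions I f g h"
    and "admissible_initial_metric \<theta> (f 0) (g 0) (h 0)"
    and "K0 = Sup (curvature_values (f 0) (g 0) (h 0))"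
    and "L0 = Inf (curvature_values (f 0) (g 0) (h 0))"
  shows "(\<forall>t\<in>I. \<forall>r\<in>{0..1}. alpha (f t) (g t) (h t) r > 0)
    \<and> (\<forall>t\<in>I. \<forall>r\<in>{0..1}. alpha (f t) (g t) (h t) r \<le> K0
         \<and> beta (f t) (g t) (h t) r \<le> K0 \<and> gamma (f t) (g t) (h t) r \<le> K0)
    \<and> (\<forall>t\<in>I. \<forall>r\<in>{0..1}. L0 * exp (- 4 * K0\<^sup>2 * t) \<le> alpha (f t) (g t) (h t) r
         \<and> L0 * exp (- 4 * K0\<^sup>2 * t) \<le> beta (f t) (g t) (h t) r
         \<and> L0 * exp (- 4 * K0\<^sup>2 * t) \<le> gamma (f t) (g t) (h t) r)
    \<and> (\<forall>t\<in>I. negative_sectional_curvature (f t) (g t) (h t))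
    \<and> (\<forall>t\<in>I. \<forall>r\<in>{0..1}. L0 / (4 * K0 * L0 * t + 1) \<le> alpha (f t) (g t) (h t) r)"
proof -
  obtain F G H where "rot_flow I f g h F G H"
    using rot_flow_exists[OF assms(3-8)] by blast
  then interpret rot_flow I f g h F G H .
  have neg: "negative_sectional_curvature (f 0) (g 0) (h 0)"
    using assms(9) by (simp add: admissible_initial_metric_def)
  note init = initial_bounds[OF neg, folded assms(10,11)]
  have positive: "0 < a t r \<and> 0 < b t r \<and> 0 < c t r" if "t \<in> I" "0 \<le> r" "r \<le> 1" for t r
    using positivity_preserved[OF init that] .
  have bounds: "a t r \<le> K0 \<and> b t r \<le> K0 \<and> c t r \<le> K0"
    "L0 * exp (- 4 * K0\<^sup>2 * t) \<le> a t r \<and> L0 * exp (- 4 * K0\<^sup>2 * t) \<le> b t r \<and> L0 * exp (- 4 * K0\<^sup>2 * t) \<le> c t r"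
    "L0 / (4 * K0 * L0 * t + 1) \<le> a t r" if "t \<in> I" "0 \<le> r" "r \<le> 1" for t r
    using bounds_while_positive[OF that(1) init positive[OF interval_I[OF that(1)]] that(2,3)] by blast+
  show ?thesis
    using positive bounds negative_sectional_curvature_iff principal_curvatures by simp
qed

end
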